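(* Let $\beta>0$ and $\nu\in ID$. Define $r_{(\beta,\beta)}(u):=u^{\beta}(1-\beta\log u)$ for $u\in(0,1]$ and $r_{(\beta,\beta)}(0):=0$. Then $r_{(\beta,\beta)}$ is an increasing time change on $[0,1]$ and $$\mathcal{J}^{\beta}\bigl(\mathcal{J}^{\beta}(\nu)\bigr)=\mathcal{L}\Bigl(\int_0^1 t\,dY_{\nu}\bigl(r_{(\beta,\beta)}(t)\bigr)\Bigr).$$
   Context: $ID$ is the set of all infinitely divisible Borel probability measures on $\mathbb{R}^d$. $\mathcal{L}(X)$ denotes the probability distribution of a random vector $X$. For $\nu\in ID$, $(Y_\nu(t))_{t\ge 0}$ denotes an $\mathbb{R}^d$-valued Lévy process with $\mathcal{L}(Y_\nu(1))=\nu$, i.e. a process starting from zero, with stationary and independent increments, and with paths that are right continuous with finite left limits. Random integrals are defined pathwise by formal integration by parts: for a continuous function $h$ of bounded variation on $[0,1]$ and a continuous nondecreasing time change $r:[0,1]\to[0,\infty)$, $$\int_0^1 h(t)\,dY(r(t)):=h(1)Y(r(1))-h(0)Y(r(0))-\int_{(0,1]}Y(r(t)-)\,dh(t).$$ For $\beta>0$ the mapping $\mathcal{J}^\beta: ID\to ID$ is defined by $$\mathcal{J}^\beta(\nu):=\mathcal{L}\Bigl(\int_0^1 t^{1/\beta}\,dY_\nu(t)\Bigr)=\mathcal{L}\Bigl(\int_0^1 t\,dY_\nu(t^\beta)\Bigr).$$ *)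

theory Defs
  imports "HOL-Probability.Probability"
begin

primrec convolution_power :: "'a::ordered_euclidean_space measure \<Rightarrow> nat \<Rightarrow> 'a measure" where
  "convolution_power \<mu> 0 = return borel 0"
| "convolution_power \<mu> (Suc n) = (\<mu> \<star> convolution_power \<mu> n)"

definition infinitely_divisible :: "'a::ordered_euclidean_space measure \<Rightarrow> bool" where
  "infinitely_divisible \<nu> \<longleftrightarrow>
     prob_space \<nu> \<and> sets \<nu> = sets borel \<and>
     (\<forall>n\<ge>1. \<exists>\<mu>. prob_space \<mu> \<and> sets \<mu> = sets borel \<and> convolution_power \<mu> n = \<nu>)"

text \<open>The time set is \<open>[0, \<infinity>)\<close>; values of paths at negative times are irrelevant throughout.\<close>

definition cadlag :: "(real \<Rightarrow> 'a::euclidean_space) \<Rightarrow> bool" where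
  "cadlag f \<longleftrightarrow>
     (\<forall>t\<ge>0. continuous (at_right t) f) \<and> (\<forall>t>0. \<exists>l. (f \<longlongrightarrow> l) (at_left t))"

definition levy_process :: "'w measure \<Rightarrow> (real \<Rightarrow> 'w \<Rightarrow> 'a::euclidean_space) \<Rightarrow> bool" where
  "levy_process M Y \<longleftrightarrow>
     prob_space M \<and>
     (\<forall>t\<ge>0. Y t \<in> borel_measurable M) \<and>
     (\<forall>\<omega>\<in>space M. Y 0 \<omega> = 0) \<and>
     (\<forall>s\<ge>0. \<forall>h\<ge>0. distr M borel (\<lambda>\<omega>. Y (s + h) \<omega> - Y s \<omega>) = distr M borel (\<lambda>\<omega>. Y h \<omega> - Y 0 \<omega>)) \<and>
     (\<forall>(n::nat) t. 0 \<le> t 0 \<and> (\<forall>i<n. t i \<le> t (Suc i)) \<longrightarrow>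
        prob_space.indep_vars M (\<lambda>_. borel) (\<lambda>i \<omega>. Y (t (Suc i)) \<omega> - Y (t i) \<omega>) {..<n}) \<and>
     (\<forall>\<omega>\<in>space M. cadlag (\<lambda>t. Y t \<omega>))"

text \<open>Left limit \<open>f(t-)\<close> of a path on \<open>[0, \<infinity>)\<close>, with the usual convention \<open>f(0-) = f(0)\<close>.\<close>

definition left_limit :: "(real \<Rightarrow> 'a::euclidean_space) \<Rightarrow> real \<Rightarrow> 'a" where
  "left_limit f t = (if t \<le> 0 then f 0 else Lim (at_left t) f)"

definition total_variation :: "(real \<Rightarrow> real) \<Rightarrow> real \<Rightarrow> real \<Rightarrow> real" where
  "total_variation h a b =
     (SUP D\<in>{D. D division_of {a..b}}. \<Sum>K\<in>D. \<bar>h (Sup K) - h (Inf K)\<bar>)"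

text \<open>
  Lebesgue--Stieltjes integral over \<open>(0,1]\<close> with respect to a continuous function \<open>h\<close> of bounded
  variation on \<open>[0,1]\<close>: with \<open>V\<close> the variation function of \<open>h\<close>, both \<open>V\<close> and \<open>V - h\<close> are
  nondecreasing and continuous, and \<open>dh = dV - d(V - h)\<close>. Both are extended to the real line by
  constants because \<^const>\<open>interval_measure\<close> is about functions on the whole line.
\<close>

definition unit_clip :: "real \<Rightarrow> real" where
  "unit_clip t = max 0 (min 1 t)"

definition stieltjes_integral :: "(real \<Rightarrow> 'a::euclidean_space) \<Rightarrow> (real \<Rightarrow> real) \<Rightarrow> 'a" where
  "stieltjes_integral f h =
     (let V = (\<lambda>t. total_variation h 0 (unit_clip t)) in
        set_lebesgue_integral (interval_measure V) {0<..1} f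
      - set_lebesgue_integral (interval_measure (\<lambda>t. V t - h (unit_clip t))) {0<..1} f)"

definition time_change :: "(real \<Rightarrow> real) \<Rightarrow> bool" where
  "time_change r \<longleftrightarrow>
     continuous_on {0..1} r \<and> mono_on {0..1} r \<and> (\<forall>t\<in>{0..1}. 0 \<le> r t)"

text \<open>\<open>\<integral>\<^sub>0\<^sup>1 h(t) dY(r(t))\<close>, defined pathwise by formal integration by parts.\<close>

definition random_integral ::
    "(real \<Rightarrow> real) \<Rightarrow> (real \<Rightarrow> 'w \<Rightarrow> 'a::euclidean_space) \<Rightarrow> (real \<Rightarrow> real) \<Rightarrow> 'w \<Rightarrow> 'a" where
  "random_integral h Y r \<omega> =
     h 1 *\<^sub>R Y (r 1) \<omega> - h 0 *\<^sub>R Y (r 0) \<omega>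
     - stieltjes_integral (\<lambda>t. left_limit (\<lambda>s. Y s \<omega>) (r t)) h"

text \<open>
  The law of \<open>\<integral>\<^sub>0\<^sup>1 t\<^bsup>1/\<beta>\<^esup> dY(t)\<close> for a Levy process \<open>Y\<close> with \<open>\<L>(Y(1)) = \<nu>\<close>. A definition cannot
  quantify over sample-space types, so the probability space lives on the type of paths; this is no
  restriction, since every Levy process can be realised as the coordinate process on its path space.
\<close>

definition J :: "real \<Rightarrow> 'a::euclidean_space measure \<Rightarrow> 'a measure" where
  "J \<beta> \<nu> = (THE \<mu>. \<exists>(M :: (real \<Rightarrow> 'a) measure) Y.
      levy_process M Y \<and> distr M borel (Y 1) = \<nu> \<and>
      \<mu> = distr M borel (random_integral (\<lambda>t. t powr (1 / \<beta>)) Y (\<lambda>t. t)))"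

definition r_beta :: "real \<Rightarrow> real \<Rightarrow> real" where
  "r_beta \<beta> u = (if u = 0 then 0 else u powr \<beta> * (1 - \<beta> * ln u))"

end

theory Submission
  imports Defs "HOL-Real_Asymp.Real_Asymp"
begin

text \<open>
  A Levy process with law \<open>\<nu>\<close> at time one has characteristic functions \<open>exp (t \<psi>)\<close> for the continuous
  logarithm \<open>\<psi>\<close> of the characteristic function of \<open>\<nu>\<close> with \<open>\<psi> 0 = 0\<close>. The pathwise integral \<open>\<integral> h dY(r)\<close>
  is a limit of sums of independent increments, so its law has exponent \<open>u \<mapsto> \<integral> \<psi>(h(t) u) dr(t)\<close>. Hence
  \<open>\<J>(\<nu>)\<close> has exponent \<open>\<Psi>(u) = \<integral>\<^sub>0\<^sup>1 \<psi>(s\<^bsup>1/\<beta>\<^esup> u) ds\<close>, and \<open>\<J>(\<J>(\<nu>))\<close> has exponent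
  \<open>\<integral>\<integral> \<psi>((s t)\<^bsup>1/\<beta>\<^esup> u) ds dt\<close>. On the other side \<open>r_beta\<close> is the distribution function of \<open>(S T)\<^bsup>1/\<beta>\<^esup>\<close> for
  independent uniform \<open>S\<close> and \<open>T\<close>, so \<open>\<integral> t dY(r_beta t)\<close> has the same exponent.

  Because \<open>J\<close> is a definite description, \<open>\<J>(\<J>(\<nu>))\<close> makes sense only once a Levy process with law
  \<open>\<J>(\<nu>)\<close> is known to exist. The integrals \<open>\<integral>\<^sub>0\<^sup>1 s\<^bsup>1/\<beta>\<^esup> dY(\<tau> s)\<close> give its convolution semigroup; Kolmogorov
  extension gives the process at dyadic times, and an Ottaviani type estimate shows that its
  dyadic paths almost surely have one-sided limits.
\<close>

section \<open>Uniqueness of characteristic functions in several dimensions\<close>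

text \<open>Cadlag paths are required at every sample point, so almost sure statements do not
  suffice: on the null set where dyadic increments are inconsistent or oscillate infinitely often,
  the path is replaced by zero. The constructed process lives on sequences of increments over all
  dyadic levels, whereas \<open>J\<close> quantifies over measures on path space; the process is
  therefore transported there, and the law of its integral is shown to depend on the law at time one
  alone.

  Using integrals of the given process as the semigroup yields the exponent
  \<open>\<tau> * \<Psi>\<close> directly, and smallness for small \<tau> follows from right
  continuity of the given paths, so no Levy-Khintchine representation enters.

  Characteristic functions identify laws throughout. Uniqueness on the line is lifted to finite
  families of vectors rather than to single vectors, because independence of increments is itself
  read off from a factorised joint characteristic function.\<close>

lemma cos_weight_eq:
  "of_real (1 + cos (x - c)) = 1 + (iexp (- c) * iexp x + iexp c * iexp (- x)) / 2"
proof -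
  have "complex_of_real (cos (x - c)) = (iexp (x - c) + iexp (c - x)) / 2"
    using cos_exp_eq[of "complex_of_real (x - c)"]
    by (simp add: cos_of_real minus_diff_eq[symmetric, of c x] del: minus_diff_eq of_real_diff)
  then show ?thesis
    by (simp add: exp_add[symmetric] algebra_simps)
qed

lemma cos_weight_mult:
  "iexp a * of_real ((1 + cos (x - c)) * G) = iexp (a + 0 * x) * of_real G
    + (iexp (- c) / 2) * (iexp (a + 1 * x) * of_real G) + (iexp c / 2) * (iexp (a + (- 1) * x) * of_real G)"
proof -
  have 1: "iexp (a + 0 * x) = iexp a" "iexp (a + 1 * x) = iexp a * iexp x"
    "iexp (a + (- 1) * x) = iexp a * iexp (- x)"
    by (simp_all add: exp_add[symmetric] algebra_simps)
  show ?thesis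
    unfolding of_real_mult cos_weight_eq 1 by algebra
qed

text \<open>Expanding the cosine leaves only the multiples 0, 1 and -1 of \<theta> in the exponent.
  The transform under the nonnegative weight \<open>1 + cos (\<theta> - c)\<close> is thus
  determined by unweighted transforms.\<close>

lemma (in prob_space) integral_cos_weight:
  assumes G: "\<And>f. f \<in> borel_measurable M \<Longrightarrow> complex_integrable M (\<lambda>w. iexp (f w) * of_real (G w))"
    and [measurable]: "a \<in> borel_measurable M" "\<theta> \<in> borel_measurable M"
  shows "(CLINT w|M. iexp (a w) * of_real ((1 + cos (\<theta> w - c)) * G w)) =
    (CLINT w|M. iexp (a w + 0 * \<theta> w) * of_real (G w))
    + (iexp (- c) / 2) * (CLINT w|M. iexp (a w + 1 * \<theta> w) * of_real (G w))
    + (iexp c / 2) * (CLINT w|M. iexp (a w + (-1) * \<theta> w) * of_real (G w))"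
proof -
  have i: "complex_integrable M (\<lambda>w. z * (iexp (a w + s * \<theta> w) * of_real (G w)))" for s z
    by (intro integrable_mult_right G) simp
  have j: "complex_integrable M (\<lambda>w. iexp (a w + s * \<theta> w) * of_real (G w))" for s
    by (intro G) simp
  show ?thesis
    unfolding cos_weight_mult
    by (simp only: Bochner_Integration.integral_add Bochner_Integration.integrable_add i j
        integral_mult_right_zero)
qed

text \<open>Normalising a nonnegative weight of positive mass gives a probability law, to which
  uniqueness on the line applies.\<close>

lemma (in prob_space) tilted_law:
  fixes X :: "'a \<Rightarrow> real"
  assumes [measurable]: "X \<in> borel_measurable M" "g \<in> borel_measurable M"
    and g: "integrable M g" "\<And>x. 0 \<le> g x" and c: "c = (LINT x|M. g x)" "0 < c"
  defines "D \<equiv> distr (density M (\<lambda>x. ennreal (g x / c))) borel X"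
  shows "real_distribution D"
    and "char D t = (CLINT x|M. iexp (t * X x) * of_real (g x)) / c"
    and "f \<in> borel_measurable borel \<Longrightarrow> (LINT x|D. f x) = (LINT x|M. g x * f (X x)) / c"
proof -
  have "prob_space (density M (\<lambda>x. ennreal (g x / c)))"
    by (rule prob_spaceI) (use c g in \<open>simp add: emeasure_density nn_integral_eq_integral\<close>)
  then show "real_distribution D"
    unfolding D_def by (rule prob_space.real_distribution_distr) simp
  have "char D t = (CLINT x|M. (g x / c) *\<^sub>R iexp (t * X x))"
    unfolding char_def D_def using c(2) g(2) by (simp add: integral_distr integral_density)
  also have "\<dots> = (CLINT x|M. (iexp (t * X x) * of_real (g x)) / c)"
    by (intro Bochner_Integration.integral_cong) (auto simp: scaleR_conv_of_real)
  finally show "char D t = (CLINT x|M. iexp (t * X x) * of_real (g x)) / c" by simp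
  show "(LINT x|D. f x) = (LINT x|M. g x * f (X x)) / c" if [measurable]: "f \<in> borel_measurable borel"
    unfolding D_def using c(2) g(2) by (simp add: integral_distr integral_density)
qed

text \<open>At \<open>t = 0\<close> the assumption says that the two weights have the same total
  mass. If it is zero, both vanish almost everywhere; otherwise normalise and use Levy
  uniqueness.\<close>

lemma weighted_char_unique:
  fixes X :: "'w \<Rightarrow> real" and X' :: "'v \<Rightarrow> real"
  assumes "prob_space M" "prob_space M'"
    and X[measurable]: "X \<in> borel_measurable M" and X'[measurable]: "X' \<in> borel_measurable M'"
    and g[measurable]: "g \<in> borel_measurable M" and g'[measurable]: "g' \<in> borel_measurable M'"
    and gb: "\<And>x. 0 \<le> g x" "\<And>x. g x \<le> C" and gb': "\<And>x. 0 \<le> g' x" "\<And>x. g' x \<le> C"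
    and eq: "\<And>t. (CLINT x|M. iexp (t * X x) * of_real (g x)) = (CLINT x|M'. iexp (t * X' x) * of_real (g' x))"
    and B[measurable]: "B \<in> sets borel"
  shows "(LINT x|M. g x * indicator B (X x)) = (LINT x|M'. g' x * indicator B (X' x))"
proof -
  interpret M: prob_space M by fact
  interpret M': prob_space M' by fact
  have ig: "integrable M g"
    by (rule M.integrable_const_bound[where B=C]) (use gb in auto)
  have ig': "integrable M' g'"
    by (rule M'.integrable_const_bound[where B=C]) (use gb' in auto)
  define c where "c = (LINT x|M. g x)"
  have "complex_of_real (LINT x|M. g x) = complex_of_real (LINT x|M'. g' x)"
    using eq[of 0] by simp
  then have c': "c = (LINT x|M'. g' x)" unfolding c_def of_real_eq_iff .
  have c0: "c \<ge> 0" unfolding c_def by (rule Bochner_Integration.integral_nonneg) (simp add: gb)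
  show ?thesis
  proof (cases "c = 0")
    case True
    have "AE x in M. g x = 0" using integral_nonneg_eq_0_iff_AE[OF ig] gb(1) True c_def by simp
    then have "(LINT x|M. g x * indicator B (X x)) = (LINT x|M. 0)"
      by (intro integral_cong_AE) auto
    moreover have "AE x in M'. g' x = 0" using integral_nonneg_eq_0_iff_AE[OF ig'] gb'(1) True c' by simp
    then have "(LINT x|M'. g' x * indicator B (X' x)) = (LINT x|M'. 0)"
      by (intro integral_cong_AE) auto
    ultimately show ?thesis by simp
  next
    case False
    with c0 have cp: "c > 0" by simp
    note D = M.tilted_law[OF X g ig gb(1) c_def cp]
    note D' = M'.tilted_law[OF X' g' ig' gb'(1) c' cp]
    have "distr (density M (\<lambda>x. ennreal (g x / c))) borel X = distr (density M' (\<lambda>x. ennreal (g' x / c))) borel X'"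
      by (rule Levy_uniqueness[OF D(1) D'(1)]) (unfold fun_eq_iff D(2) D'(2) eq, simp)
    then show ?thesis
      using D(3)[of "indicator B"] D'(3)[of "indicator B"] cp by simp
  qed
qed

text \<open>Recovers the oscillating factor from nonnegative weights: the shift 0 yields the cosine,
  the shift \<open>pi / 2\<close> the sine, and subtracting the integral of \<open>H\<close> removes
  the additive 1.\<close>

lemma (in prob_space) integral_iexp_cos:
  assumes [measurable]: "\<theta> \<in> borel_measurable M" "H \<in> borel_measurable M" and H: "\<And>w. \<bar>H w\<bar> \<le> 1"
  shows "(CLINT w|M. iexp (\<theta> w) * of_real (H w)) =
    of_real ((LINT w|M. (1 + cos (\<theta> w - 0)) * H w) - (LINT w|M. H w))
    + \<i> * of_real ((LINT w|M. (1 + cos (\<theta> w - pi / 2)) * H w) - (LINT w|M. H w))"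
proof -
  have i: "integrable M (\<lambda>w. cos (\<theta> w - c) * H w)" for c
    by (rule integrable_const_bound[where B=1]) (use H in \<open>auto simp: abs_mult intro!: mult_le_one\<close>)
  have iH: "integrable M H"
    by (rule integrable_const_bound[where B=1]) (use H in auto)
  have c: "(LINT w|M. (1 + cos (\<theta> w - c)) * H w) - (LINT w|M. H w) = (LINT w|M. cos (\<theta> w - c) * H w)" for c
    using Bochner_Integration.integral_add[OF iH i[of c]] by (simp add: distrib_right)
  have e: "iexp x * of_real h = of_real (cos (x - 0) * h) + \<i> * of_real (cos (x - pi / 2) * h)" for x h
    by (simp add: cos_diff exp_Euler cos_of_real sin_of_real algebra_simps)
  show ?thesis
    unfolding e c
    by (subst Bochner_Integration.integral_add)
      (auto intro!: i i[of 0, simplified] integrable_mult_right integrable_of_real simp del: of_real_mult simp: integral_complex_of_real)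
qed

text \<open>One coordinate at a time, \<open>e\<^bsup>i u x\<^esup>\<close> is traded for an indicator: the remaining oscillating
  factor \<open>e\<^bsup>i\<theta>\<^esup>\<close> is split into the nonnegative weights \<open>1 + cos (\<theta> - c)\<close>, which turn the statement
  into one about positive measures on the line.\<close>

lemma mixed_char_unique:
  fixes X :: "'i \<Rightarrow> 'w \<Rightarrow> real" and X' :: "'i \<Rightarrow> 'v \<Rightarrow> real"
  assumes "prob_space M" "prob_space M'" and "finite K"
    and X[measurable]: "\<And>k. X k \<in> borel_measurable M"
    and X'[measurable]: "\<And>k. X' k \<in> borel_measurable M'"
    and eq: "\<And>u. (CLINT w|M. iexp (\<Sum>k\<in>K. u k * X k w)) = (CLINT w|M'. iexp (\<Sum>k\<in>K. u k * X' k w))"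
    and B[measurable]: "\<And>k. B k \<in> sets borel"
    and "S \<subseteq> K"
  shows "(CLINT w|M. iexp (\<Sum>k\<in>K-S. u k * X k w) * of_real (\<Prod>k\<in>S. indicator (B k) (X k w))) =
      (CLINT w|M'. iexp (\<Sum>k\<in>K-S. u k * X' k w) * of_real (\<Prod>k\<in>S. indicator (B k) (X' k w)))"
  using finite_subset[OF \<open>S \<subseteq> K\<close> \<open>finite K\<close>] \<open>S \<subseteq> K\<close>
proof (induction S arbitrary: u rule: finite_induct)
  case empty
  then show ?case using eq by simp
next
  case (insert j S)
  interpret M: prob_space M by fact
  interpret M': prob_space M' by fact
  have jK: "j \<in> K" "S \<subseteq> K" using insert by auto
  define L where "L = K - insert j S"
  have L: "K - S = insert j L" "j \<notin> L" "finite L" using insert jK \<open>finite K\<close> by (auto simp: L_def)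
  define \<theta> where "\<theta> w = (\<Sum>k\<in>L. u k * X k w)" for w
  define \<theta>' where "\<theta>' w = (\<Sum>k\<in>L. u k * X' k w)" for w
  define G where "G w = (\<Prod>k\<in>S. indicator (B k) (X k w) :: real)" for w
  define G' where "G' w = (\<Prod>k\<in>S. indicator (B k) (X' k w) :: real)" for w
  have [measurable]: "\<theta> \<in> borel_measurable M" "\<theta>' \<in> borel_measurable M'"
    "G \<in> borel_measurable M" "G' \<in> borel_measurable M'"
    unfolding \<theta>_def[abs_def] \<theta>'_def[abs_def] G_def[abs_def] G'_def[abs_def] by measurable
  have Gb: "0 \<le> G w" "G w \<le> 1" "0 \<le> G' w'" "G' w' \<le> 1" for w w'
    by (auto simp: G_def G'_def intro!: prod_nonneg prod_le_1)
  \<comment> \<open>The induction hypothesis allows arbitrary coefficients: that of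
    \<open>X j\<close> is taken to be t, the others are scaled jointly by s. Below, s is 0, 1 or -1,
    as produced by the cosine weight.\<close>
  have IH: "(CLINT w|M. iexp (t * X j w + s * \<theta> w) * of_real (G w)) =
      (CLINT w|M'. iexp (t * X' j w + s * \<theta>' w) * of_real (G' w))" for t s
  proof -
    have "(\<Sum>k\<in>K-S. (if k = j then t else s * u k) * X k w) = t * X j w + s * \<theta> w" for w
      unfolding L using L by (simp add: \<theta>_def sum_distrib_left mult.assoc cong: sum.cong)
        (intro sum.cong; auto)
    moreover have "(\<Sum>k\<in>K-S. (if k = j then t else s * u k) * X' k w) = t * X' j w + s * \<theta>' w" for w
      unfolding L using L by (simp add: \<theta>'_def sum_distrib_left mult.assoc cong: sum.cong)
        (intro sum.cong; auto)
    ultimately show ?thesis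
      using insert.IH[OF jK(2), of "\<lambda>k. if k = j then t else s * u k"] unfolding G_def G'_def by simp
  qed
  have intb: "integrable M (\<lambda>w. iexp (f w) * of_real (G w))" if [measurable]: "f \<in> borel_measurable M" for f
    by (rule M.integrable_const_bound[where B=1]) (use Gb in \<open>auto simp: norm_mult\<close>)
  have intb': "integrable M' (\<lambda>w. iexp (f w) * of_real (G' w))" if [measurable]: "f \<in> borel_measurable M'" for f
    by (rule M'.integrable_const_bound[where B=1]) (use Gb in \<open>auto simp: norm_mult\<close>)
  have W: "(LINT w|M. ((1 + cos (\<theta> w - c)) * G w) * indicator (B j) (X j w)) =
      (LINT w|M'. ((1 + cos (\<theta>' w - c)) * G' w) * indicator (B j) (X' j w))" for c
  proof (rule weighted_char_unique[where C=2, OF \<open>prob_space M\<close> \<open>prob_space M'\<close>])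
    fix w show "0 \<le> (1 + cos (\<theta> w - c)) * G w" by (intro mult_nonneg_nonneg Gb) (use cos_ge_minus_one[of "\<theta> w - c"] in linarith)
    show "(1 + cos (\<theta> w - c)) * G w \<le> 2"
      using mult_mono[of "1 + cos (\<theta> w - c)" 2 "G w" 1] cos_le_one[of "\<theta> w - c"] Gb by simp
  next
    fix w show "0 \<le> (1 + cos (\<theta>' w - c)) * G' w" by (intro mult_nonneg_nonneg Gb) (use cos_ge_minus_one[of "\<theta>' w - c"] in linarith)
    show "(1 + cos (\<theta>' w - c)) * G' w \<le> 2"
      using mult_mono[of "1 + cos (\<theta>' w - c)" 2 "G' w" 1] cos_le_one[of "\<theta>' w - c"] Gb by simp
  next
    fix t
    have 1: "(CLINT w|M. iexp (t * X j w) * of_real ((1 + cos (\<theta> w - c)) * G w)) =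
       (CLINT w|M. iexp (t * X j w + 0 * \<theta> w) * of_real (G w))
       + (iexp (- c) / 2) * (CLINT w|M. iexp (t * X j w + 1 * \<theta> w) * of_real (G w))
       + (iexp c / 2) * (CLINT w|M. iexp (t * X j w + (-1) * \<theta> w) * of_real (G w))"
      by (rule M.integral_cos_weight[OF intb]) auto
    have 2: "(CLINT w|M'. iexp (t * X' j w) * of_real ((1 + cos (\<theta>' w - c)) * G' w)) =
       (CLINT w|M'. iexp (t * X' j w + 0 * \<theta>' w) * of_real (G' w))
       + (iexp (- c) / 2) * (CLINT w|M'. iexp (t * X' j w + 1 * \<theta>' w) * of_real (G' w))
       + (iexp c / 2) * (CLINT w|M'. iexp (t * X' j w + (-1) * \<theta>' w) * of_real (G' w))"
      by (rule M'.integral_cos_weight[OF intb']) auto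
    show "(CLINT w|M. iexp (t * X j w) * of_real ((1 + cos (\<theta> w - c)) * G w)) =
      (CLINT w|M'. iexp (t * X' j w) * of_real ((1 + cos (\<theta>' w - c)) * G' w))"
      unfolding 1 2 IH ..
  qed measurable
  have W0: "(LINT w|M. G w * indicator (B j) (X j w)) = (LINT w|M'. G' w * indicator (B j) (X' j w))"
    by (rule weighted_char_unique[where C=1, OF \<open>prob_space M\<close> \<open>prob_space M'\<close>])
      (use Gb IH[of _ 0] in \<open>auto\<close>)
  define H where "H w = G w * indicator (B j) (X j w)" for w
  define H' where "H' w = G' w * indicator (B j) (X' j w)" for w
  have [measurable]: "H \<in> borel_measurable M" "H' \<in> borel_measurable M'"
    unfolding H_def[abs_def] H'_def[abs_def] by measurable
  have Hb: "\<bar>H w\<bar> \<le> 1" "\<bar>H' w'\<bar> \<le> 1" for w w'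
    using Gb(1,2)[of w] Gb(3,4)[of w'] by (auto simp: H_def H'_def indicator_def)
  have "(LINT w|M. (1 + cos (\<theta> w - c)) * H w) = (LINT w|M'. (1 + cos (\<theta>' w - c)) * H' w)" for c
    using W[of c] by (simp add: H_def H'_def mult.assoc)
  moreover have "(LINT w|M. H w) = (LINT w|M'. H' w)" using W0 by (simp add: H_def H'_def)
  ultimately have "(CLINT w|M. iexp (\<theta> w) * of_real (H w)) = (CLINT w|M'. iexp (\<theta>' w) * of_real (H' w))"
    by (simp only: M.integral_iexp_cos[OF _ _ Hb(1)] M'.integral_iexp_cos[OF _ _ Hb(2)]
        \<open>\<theta> \<in> borel_measurable M\<close> \<open>\<theta>' \<in> borel_measurable M'\<close> \<open>H \<in> borel_measurable M\<close> \<open>H' \<in> borel_measurable M'\<close>)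
  then show ?case
    using insert unfolding L_def[symmetric] \<theta>_def \<theta>'_def H_def H'_def G_def G'_def
    by (simp add: mult.commute)
qed

text \<open>The exponent over the empty set \<open>K-K\<close> matches the final stage
  \<open>S = K\<close> of \<open>mixed_char_unique\<close>, where every coordinate has become an
  indicator.\<close>

lemma (in prob_space) prob_rectangle:
  fixes X :: "'i \<Rightarrow> 'a \<Rightarrow> real"
  assumes "finite K" and [measurable]: "\<And>k. X k \<in> borel_measurable M" "\<And>k. C k \<in> sets borel"
  shows "complex_of_real (prob ((\<lambda>w. \<lambda>k\<in>K. X k w) -` Pi\<^sub>E K C \<inter> space M)) =
    (CLINT w|M. iexp (\<Sum>k\<in>K-K. 0 * X k w) * of_real (\<Prod>k\<in>K. indicator (C k) (X k w)))"
proof -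
  have m: "(\<lambda>w. \<lambda>k\<in>K. X k w) -` Pi\<^sub>E K C \<inter> space M \<in> sets M"
    by (rule measurable_sets[of _ M "PiM K (\<lambda>_. borel)"]) (auto intro!: sets_PiM_I_finite \<open>finite K\<close>)
  have "(CLINT w|M. iexp (\<Sum>k\<in>K-K. 0 * X k w) * of_real (\<Prod>k\<in>K. indicator (C k) (X k w))) =
     complex_of_real (LINT w|M. (\<Prod>k\<in>K. indicator (C k) (X k w)))"
    by (simp del: of_real_prod)
  also have "(LINT w|M. (\<Prod>k\<in>K. indicator (C k) (X k w) :: real)) =
     (LINT w|M. indicator ((\<lambda>w. \<lambda>k\<in>K. X k w) -` Pi\<^sub>E K C \<inter> space M) w)"
    using \<open>finite K\<close>
    by (intro Bochner_Integration.integral_cong) (auto simp: indicator_def PiE_def Pi_def intro!: prod.neutral)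
  finally show ?thesis using m by simp
qed

lemma real_family_char_unique:
  fixes X :: "'i \<Rightarrow> 'w \<Rightarrow> real" and X' :: "'i \<Rightarrow> 'v \<Rightarrow> real"
  assumes "prob_space M" "prob_space M'" and "finite K"
    and X[measurable]: "\<And>k. X k \<in> borel_measurable M"
    and X'[measurable]: "\<And>k. X' k \<in> borel_measurable M'"
    and eq: "\<And>u. (CLINT w|M. iexp (\<Sum>k\<in>K. u k * X k w)) = (CLINT w|M'. iexp (\<Sum>k\<in>K. u k * X' k w))"
  shows "distr M (PiM K (\<lambda>_. borel)) (\<lambda>w. \<lambda>k\<in>K. X k w) = distr M' (PiM K (\<lambda>_. borel)) (\<lambda>w. \<lambda>k\<in>K. X' k w)"
proof -
  interpret M: prob_space M by fact
  interpret M': prob_space M' by fact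
  show ?thesis
  proof (rule measure_eqI_PiM_finite[OF \<open>finite K\<close>])
    fix B :: "'i \<Rightarrow> real set" assume B: "\<And>k. k \<in> K \<Longrightarrow> B k \<in> sets borel"
    \<comment> \<open>Measurability of \<open>B\<close> is known on \<open>K\<close> only, but is
      wanted for every index; empty sets elsewhere do not change the rectangle.\<close>
    define C where "C k = (if k \<in> K then B k else {})" for k
    have C[measurable]: "\<And>k. C k \<in> sets borel" using B by (auto simp: C_def)
    have PC: "Pi\<^sub>E K B = Pi\<^sub>E K C" by (auto simp: C_def PiE_def Pi_def)
    have "measure M ((\<lambda>w. \<lambda>k\<in>K. X k w) -` Pi\<^sub>E K C \<inter> space M) = measure M' ((\<lambda>w. \<lambda>k\<in>K. X' k w) -` Pi\<^sub>E K C \<inter> space M')"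
      unfolding of_real_eq_iff[where 'a=complex, symmetric]
        M.prob_rectangle[OF \<open>finite K\<close> X C] M'.prob_rectangle[OF \<open>finite K\<close> X' C]
      using mixed_char_unique[OF assms(1-3) X X' eq C order_refl, of "\<lambda>_. 0"] by simp
    then show "emeasure (distr M (PiM K (\<lambda>_. borel)) (\<lambda>w. \<lambda>k\<in>K. X k w)) (Pi\<^sub>E K B) =
       emeasure (distr M' (PiM K (\<lambda>_. borel)) (\<lambda>w. \<lambda>k\<in>K. X' k w)) (Pi\<^sub>E K B)"
      unfolding PC using \<open>finite K\<close>
      by (subst (1 2) emeasure_distr) (auto intro!: sets_PiM_I_finite simp: M.emeasure_eq_measure M'.emeasure_eq_measure)
  next
    show "range (\<lambda>_::nat. space (PiM K (\<lambda>_. borel :: real measure))) \<subseteq> prod_algebra K (\<lambda>_. borel)"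
      using prod_algebraI_finite[OF \<open>finite K\<close>, of "\<lambda>_. UNIV" "\<lambda>_. borel :: real measure"]
      by (auto simp: space_PiM)
    show "emeasure (distr M (PiM K (\<lambda>_. borel)) (\<lambda>w. \<lambda>k\<in>K. X k w)) (space (PiM K (\<lambda>_. borel))) \<noteq> \<infinity>" for i :: nat
      by (simp add: emeasure_distr M.emeasure_eq_measure)
  qed auto
qed

section \<open>Vector-valued families and independence\<close>

definition mchar :: "'a::euclidean_space measure \<Rightarrow> 'a \<Rightarrow> complex" where
  "mchar \<mu> u = (CLINT x|\<mu>. iexp (u \<bullet> x))"

text \<open>Vectors are split into real coordinates indexed by \<open>K \<times> Basis\<close>, and
  reassembled by the measurable map \<open>R\<close>. Coordinates are set to zero off
  \<open>K\<close> to be measurable for every index.\<close>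

lemma vec_family_char_unique:
  fixes X :: "'i \<Rightarrow> 'w \<Rightarrow> 'a::euclidean_space" and X' :: "'i \<Rightarrow> 'v \<Rightarrow> 'a"
  assumes "prob_space M" "prob_space M'" and "finite K"
    and X[measurable]: "\<And>k. k \<in> K \<Longrightarrow> X k \<in> borel_measurable M"
    and X'[measurable]: "\<And>k. k \<in> K \<Longrightarrow> X' k \<in> borel_measurable M'"
    and eq: "\<And>u. (CLINT w|M. iexp (\<Sum>k\<in>K. u k \<bullet> X k w)) = (CLINT w|M'. iexp (\<Sum>k\<in>K. u k \<bullet> X' k w))"
  shows "distr M (PiM K (\<lambda>_. borel)) (\<lambda>w. \<lambda>k\<in>K. X k w) = distr M' (PiM K (\<lambda>_. borel)) (\<lambda>w. \<lambda>k\<in>K. X' k w)"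
proof -
  have rep: "(\<Sum>b\<in>Basis. (b \<bullet> x) *\<^sub>R b) = x" for x :: 'a
    by (subst inner_commute) (rule euclidean_representation)
  define Z where "Z p w = (if fst p \<in> K then snd p \<bullet> X (fst p) w else 0)" for p w
  define Z' where "Z' p w = (if fst p \<in> K then snd p \<bullet> X' (fst p) w else 0)" for p w
  define KB where "KB = K \<times> (Basis :: 'a set)"
  have [measurable]: "Z p \<in> borel_measurable M" "Z' p \<in> borel_measurable M'" for p
    by (cases "fst p \<in> K"; simp add: Z_def[abs_def] Z'_def[abs_def])+
  have s: "(\<Sum>p\<in>KB. u p * Z p w) = (\<Sum>k\<in>K. (\<Sum>b\<in>Basis. u (k, b) *\<^sub>R b) \<bullet> X k w)" for u w
    by (simp add: KB_def Z_def sum.cartesian_product' inner_sum_left cong: sum.cong)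
  have s': "(\<Sum>p\<in>KB. u p * Z' p w) = (\<Sum>k\<in>K. (\<Sum>b\<in>Basis. u (k, b) *\<^sub>R b) \<bullet> X' k w)" for u w
    by (simp add: KB_def Z'_def sum.cartesian_product' inner_sum_left cong: sum.cong)
  have fin: "finite KB" using \<open>finite K\<close> by (simp add: KB_def)
  have D: "distr M (PiM KB (\<lambda>_. borel)) (\<lambda>w. \<lambda>p\<in>KB. Z p w) = distr M' (PiM KB (\<lambda>_. borel)) (\<lambda>w. \<lambda>p\<in>KB. Z' p w)"
    by (rule real_family_char_unique[OF assms(1,2) fin]) (simp_all only: s s' eq, simp_all)
  define R where "R x = (\<lambda>k\<in>K. \<Sum>b\<in>Basis. x (k, b) *\<^sub>R b)" for x :: "'i \<times> 'a \<Rightarrow> real"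
  have mR: "R \<in> measurable (PiM KB (\<lambda>_. borel)) (PiM K (\<lambda>_. borel))"
    unfolding R_def[abs_def]
    by (intro measurable_restrict borel_measurable_sum borel_measurable_scaleR measurable_component_singleton)
      (auto simp: KB_def)
  have mZ: "(\<lambda>w. \<lambda>p\<in>KB. Z p w) \<in> measurable M (PiM KB (\<lambda>_. borel))"
    "(\<lambda>w. \<lambda>p\<in>KB. Z' p w) \<in> measurable M' (PiM KB (\<lambda>_. borel))"
    by measurable
  have "distr M (PiM K (\<lambda>_. borel)) (\<lambda>w. \<lambda>k\<in>K. X k w)
      = distr (distr M (PiM KB (\<lambda>_. borel)) (\<lambda>w. \<lambda>p\<in>KB. Z p w)) (PiM K (\<lambda>_. borel)) R"
    unfolding distr_distr[OF mR mZ(1)] by (intro distr_cong refl) (simp add: fun_eq_iff R_def KB_def Z_def rep)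
  also have "\<dots> = distr M' (PiM K (\<lambda>_. borel)) (\<lambda>w. \<lambda>k\<in>K. X' k w)"
    unfolding D distr_distr[OF mR mZ(2)]
    by (intro distr_cong refl) (simp add: fun_eq_iff R_def KB_def Z'_def rep)
  finally show ?thesis .
qed

lemma mchar_unique:
  fixes \<mu> \<nu> :: "'a::euclidean_space measure"
  assumes "prob_space \<mu>" "prob_space \<nu>" and sets: "sets \<mu> = sets borel" "sets \<nu> = sets borel"
    and eq: "\<And>u. mchar \<mu> u = mchar \<nu> u"
  shows "\<mu> = \<nu>"
proof -
  have m: "(\<lambda>x. x) \<in> borel_measurable \<mu>" "(\<lambda>x. x) \<in> borel_measurable \<nu>"
    by (simp_all add: measurable_ident_sets sets)
  have D: "distr \<mu> (PiM {()} (\<lambda>_. borel)) (\<lambda>w. \<lambda>k\<in>{()}. w) = distr \<nu> (PiM {()} (\<lambda>_. borel)) (\<lambda>w. \<lambda>k\<in>{()}. w)"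
    by (rule vec_family_char_unique[OF assms(1,2)]) (use eq m in \<open>auto simp: mchar_def\<close>)
  have "\<mu> = distr (distr \<mu> (PiM {()} (\<lambda>_. borel)) (\<lambda>w. \<lambda>k\<in>{()}. w)) borel (\<lambda>x. x ())"
    using m by (subst distr_distr) (auto simp: comp_def distr_id2 sets)
  also have "\<dots> = \<nu>"
    unfolding D using m by (subst distr_distr) (auto simp: comp_def distr_id2 sets)
  finally show ?thesis .
qed

lemma mchar_distr:
  assumes "X \<in> borel_measurable M"
  shows "mchar (distr M borel X) u = (CLINT w|M. iexp (u \<bullet> X w))"
  unfolding mchar_def using assms by (subst integral_distr) auto

text \<open>The product of the marginal laws has the factorised transform assumed of the joint law,
  so uniqueness identifies the two.\<close>

lemma (in prob_space) indep_vars_charI: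
  fixes W :: "'i \<Rightarrow> 'a \<Rightarrow> 'b::euclidean_space"
  assumes "finite K" and W[measurable]: "\<And>k. k \<in> K \<Longrightarrow> W k \<in> borel_measurable M"
    and eq: "\<And>u. (CLINT w|M. iexp (\<Sum>k\<in>K. u k \<bullet> W k w)) = (\<Prod>k\<in>K. (CLINT w|M. iexp (u k \<bullet> W k w)))"
  shows "indep_vars (\<lambda>_. borel) W K"
proof (cases "K = {}")
  case True
  then show ?thesis by (simp add: indep_vars_def indep_sets_def)
next
  case False
  \<comment> \<open>The product measure asks for a probability space at every index, hence a point
    mass off \<open>K\<close>.\<close>
  define D where "D k = (if k \<in> K then distr M borel (W k) else return borel 0)" for k
  have D: "prob_space (D k)" for k
    by (auto simp: D_def intro!: prob_space_distr prob_space_return)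
  interpret D: product_prob_space D K by (rule product_prob_spaceI) (rule D)
  have setsD: "sets (D k) = sets borel" for k by (simp add: D_def)
  have PD: "prob_space (PiM K D)" by (intro prob_space_PiM D)
  have mD: "(\<lambda>x. x k) \<in> borel_measurable (PiM K D)" if "k \<in> K" for k
    using measurable_component_singleton[OF that, of D] measurable_cong_sets[OF refl setsD] by blast
  have "distr M (PiM K (\<lambda>_. borel)) (\<lambda>w. \<lambda>k\<in>K. W k w) = distr (PiM K D) (PiM K (\<lambda>_. borel)) (\<lambda>w. \<lambda>k\<in>K. w k)"
  proof (rule vec_family_char_unique[OF prob_space_axioms PD \<open>finite K\<close> W mD])
    fix u :: "'i \<Rightarrow> 'b"
    have "(CLINT w|PiM K D. iexp (\<Sum>k\<in>K. u k \<bullet> w k)) = (CLINT w|PiM K D. (\<Prod>k\<in>K. iexp (u k \<bullet> w k)))"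
      using \<open>finite K\<close> by (simp add: exp_sum sum_distrib_left)
    also have "\<dots> = (\<Prod>k\<in>K. CLINT x|D k. iexp (u k \<bullet> x))"
    proof (rule D.product_integral_prod[OF \<open>finite K\<close>])
      fix k assume "k \<in> K"
      show "complex_integrable (D k) (\<lambda>x. iexp (u k \<bullet> x))"
        by (rule finite_measure.integrable_const_bound[OF prob_space.finite_measure[OF D], where B=1])
          (auto simp: measurable_cong_sets[OF setsD refl])
    qed
    also have "\<dots> = (\<Prod>k\<in>K. (CLINT w|M. iexp (u k \<bullet> W k w)))"
      by (intro prod.cong refl) (simp add: D_def mchar_distr[unfolded mchar_def])
    finally show "(CLINT w|M. iexp (\<Sum>k\<in>K. u k \<bullet> W k w)) = (CLINT w|PiM K D. iexp (\<Sum>k\<in>K. u k \<bullet> w k))"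
      unfolding eq by simp
  qed
  also have "\<dots> = distr (PiM K D) (PiM K D) (\<lambda>w. w)"
    by (rule distr_cong) (auto simp: setsD space_PiM PiE_def extensional_restrict intro!: sets_PiM_cong)
  also have "\<dots> = PiM K (\<lambda>k. distr M borel (W k))"
    by (simp add: D_def cong: PiM_cong)
  finally show ?thesis
    using indep_vars_iff_distr_eq_PiM'[OF False W] by simp
qed

lemma (in prob_space) char_indep_sum:
  fixes W :: "'i \<Rightarrow> 'a \<Rightarrow> 'b::euclidean_space"
  assumes "finite K" and ind: "indep_vars (\<lambda>_. borel) W K"
  shows "(CLINT w|M. iexp (\<Sum>k\<in>K. u k \<bullet> W k w)) = (\<Prod>k\<in>K. (CLINT w|M. iexp (u k \<bullet> W k w)))"
proof -
  have W[measurable]: "\<And>k. k \<in> K \<Longrightarrow> W k \<in> borel_measurable M" using ind by (simp add: indep_vars_def)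
  have "(CLINT w|M. iexp (\<Sum>k\<in>K. u k \<bullet> W k w)) = (CLINT w|M. (\<Prod>k\<in>K. iexp (u k \<bullet> W k w)))"
    using \<open>finite K\<close> by (simp add: exp_sum sum_distrib_left)
  also have "\<dots> = (\<Prod>k\<in>K. CLINT w|M. iexp (u k \<bullet> W k w))"
  proof (rule indep_vars_lebesgue_integral[OF \<open>finite K\<close>])
    show "indep_vars (\<lambda>_. borel) (\<lambda>k w. iexp (u k \<bullet> W k w)) K"
      by (rule indep_vars_compose2[OF ind, of "\<lambda>k x. iexp (u k \<bullet> x)"]) simp
    show "complex_integrable M (\<lambda>w. iexp (u k \<bullet> W k w))" if "k \<in> K" for k
      by (rule integrable_const_bound[where B=1]) (use that in auto)
  qed
  finally show ?thesis .
qed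

section \<open>Characteristic exponents of Levy processes\<close>

lemma nonneg_of_steps:
  fixes t :: "nat \<Rightarrow> real"
  assumes "0 \<le> t 0" "\<And>i. i < n \<Longrightarrow> t i \<le> t (Suc i)"
  shows "i \<le> n \<Longrightarrow> 0 \<le> t i"
proof (induction i)
  case (Suc i)
  then show ?case using assms(2)[of i] by simp
qed (use assms in simp)

locale levy =
  fixes M :: "'w measure" and Y :: "real \<Rightarrow> 'w \<Rightarrow> 'a::euclidean_space"
  assumes levy: "levy_process M Y"

sublocale levy \<subseteq> prob_space M
  using levy by (simp add: levy_process_def)

context levy
begin

lemma measurable_Y[measurable]: "0 \<le> t \<Longrightarrow> Y t \<in> borel_measurable M"
  using levy by (simp add: levy_process_def)

lemma Y_0: "w \<in> space M \<Longrightarrow> Y 0 w = 0"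
  using levy by (simp add: levy_process_def)

lemma cadlag_Y: "w \<in> space M \<Longrightarrow> cadlag (\<lambda>t. Y t w)"
  using levy by (simp add: levy_process_def)

definition phi :: "real \<Rightarrow> 'a \<Rightarrow> complex" where
  "phi t u = (CLINT w|M. iexp (u \<bullet> Y t w))"

lemma char_increment:
  assumes "0 \<le> s" "0 \<le> h"
  shows "(CLINT w|M. iexp (u \<bullet> (Y (s + h) w - Y s w))) = phi h u"
proof -
  have "distr M borel (\<lambda>w. Y (s + h) w - Y s w) = distr M borel (\<lambda>w. Y h w - Y 0 w)"
    using levy assms by (simp add: levy_process_def)
  also have "\<dots> = distr M borel (Y h)"
    by (rule distr_cong) (auto simp: Y_0)
  finally have "mchar (distr M borel (\<lambda>w. Y (s + h) w - Y s w)) u = mchar (distr M borel (Y h)) u"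
    by simp
  then show ?thesis using assms by (simp add: mchar_distr phi_def)
qed

lemma char_increments:
  assumes "0 \<le> t 0" and t: "\<And>i. i < n \<Longrightarrow> t i \<le> t (Suc i)"
  shows "(CLINT w|M. iexp (\<Sum>i<n. u i \<bullet> (Y (t (Suc i)) w - Y (t i) w))) = (\<Prod>i<n. phi (t (Suc i) - t i) (u i))"
proof -
  have t0: "0 \<le> t i" if "i \<le> n" for i
    using that
  proof (induction i)
    case (Suc i)
    then show ?case using t[of i] by simp
  qed (use assms in simp)
  have "indep_vars (\<lambda>_. borel) (\<lambda>i w. Y (t (Suc i)) w - Y (t i) w) {..<n}"
    using levy assms by (simp add: levy_process_def)
  from char_indep_sum[OF _ this, of u]
  have "(CLINT w|M. iexp (\<Sum>i<n. u i \<bullet> (Y (t (Suc i)) w - Y (t i) w))) =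
      (\<Prod>i<n. (CLINT w|M. iexp (u i \<bullet> (Y (t (Suc i)) w - Y (t i) w))))" by simp
  also have "\<dots> = (\<Prod>i<n. phi (t (Suc i) - t i) (u i))"
  proof (intro prod.cong refl)
    fix i assume "i \<in> {..<n}"
    then show "(CLINT w|M. iexp (u i \<bullet> (Y (t (Suc i)) w - Y (t i) w))) = phi (t (Suc i) - t i) (u i)"
      using char_increment[of "t i" "t (Suc i) - t i" "u i"] t t0[of i] by simp
  qed
  finally show ?thesis .
qed

lemma phi_mult_nat:
  assumes "0 \<le> h"
  shows "phi (real n * h) u = phi h u ^ n"
proof -
  have "(\<Sum>i<n. u \<bullet> (Y (real (Suc i) * h) w - Y (real i * h) w)) = u \<bullet> Y (real n * h) w"
    if "w \<in> space M" for w
  proof -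
    have "(\<Sum>i<n. u \<bullet> (Y (real (Suc i) * h) w - Y (real i * h) w)) =
      u \<bullet> (\<Sum>i<n. (Y (real (Suc i) * h) w - Y (real i * h) w))"
      by (simp only: inner_sum_right)
    also have "(\<Sum>i<n. (Y (real (Suc i) * h) w - Y (real i * h) w)) = Y (real n * h) w"
      using sum_lessThan_telescope[of "\<lambda>i. Y (real i * h) w" n] Y_0[OF that] by simp
    finally show ?thesis .
  qed
  then have "phi (real n * h) u = (CLINT w|M. iexp (\<Sum>i<n. u \<bullet> (Y (real (Suc i) * h) w - Y (real i * h) w)))"
    unfolding phi_def by (intro Bochner_Integration.integral_cong) auto
  also have "\<dots> = (\<Prod>i<n. phi (real (Suc i) * h - real i * h) u)"
    using assms by (intro char_increments) (auto intro: mult_right_mono)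
  also have "\<dots> = phi h u ^ n"
    by (simp add: algebra_simps)
  finally show ?thesis .
qed

lemma Y_right_tendsto:
  assumes "0 \<le> t" "q \<longlonglongrightarrow> t" "\<And>n. t < q n" "w \<in> space M"
  shows "(\<lambda>n. Y (q n) w) \<longlonglongrightarrow> Y t w"
proof -
  have "((\<lambda>t. Y t w) \<longlongrightarrow> Y t w) (at_right t)"
    using cadlag_Y[OF assms(4)] assms(1) by (simp add: cadlag_def continuous_within)
  moreover have "filterlim q (at_right t) sequentially"
    unfolding filterlim_at using assms(2) assms(3)[THEN less_imp_neq] assms(3)
    by (auto intro!: always_eventually simp: eq_commute)
  ultimately show ?thesis by (rule filterlim_compose)
qed

lemma phi_right_tendsto:
  assumes "0 \<le> t" "q \<longlonglongrightarrow> t" "\<And>n. t < q n"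
  shows "(\<lambda>n. phi (q n) u) \<longlonglongrightarrow> phi t u"
  unfolding phi_def
proof (rule integral_dominated_convergence[where w="\<lambda>_. 1"])
  have "0 \<le> q n" for n using assms(1) assms(3)[of n] by simp
  then show "(\<lambda>w. iexp (u \<bullet> Y (q n) w)) \<in> borel_measurable M" for n by measurable
  show "AE w in M. (\<lambda>n. iexp (u \<bullet> Y (q n) w)) \<longlonglongrightarrow> iexp (u \<bullet> Y t w)"
    by (intro AE_I2 tendsto_intros Y_right_tendsto assms)
qed (use assms in auto)

lemma phi_0: "phi 0 u = 1"
proof -
  have "phi 0 u = (CLINT w|M. 1)" unfolding phi_def
    by (intro Bochner_Integration.integral_cong) (auto simp: Y_0)
  then show ?thesis by (simp add: prob_space)
qed

lemma phi_zero_arg: "phi t 0 = 1"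
  by (simp add: phi_def prob_space)

text \<open>By right continuity \<open>phi (t / real (Suc n)) u\<close> tends to
  \<open>phi 0 u = 1\<close>, hence is nonzero for some n, and \<open>phi t u\<close> is a power of
  it.\<close>

lemma phi_nonzero:
  assumes "0 \<le> t"
  shows "phi t u \<noteq> 0"
proof (cases "t = 0")
  case True
  then show ?thesis by (simp add: phi_0)
next
  case False
  have "(\<lambda>n. phi (t / real (Suc n)) u) \<longlonglongrightarrow> phi 0 u"
    by (rule phi_right_tendsto[OF order_refl LIMSEQ_Suc[OF lim_const_over_n]]) (use False assms in auto)
  then have "\<forall>\<^sub>F n in sequentially. phi (t / real (Suc n)) u \<noteq> 0"
    by (rule tendsto_imp_eventually_ne) (simp add: phi_0)
  then obtain n where "phi (t / real (Suc n)) u \<noteq> 0"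
    by (meson eventually_sequentially order_refl)
  moreover have "phi t u = phi (t / real (Suc n)) u ^ Suc n"
    using phi_mult_nat[of "t / real (Suc n)" "Suc n" u] assms by (simp del: of_nat_Suc)
  ultimately show ?thesis by simp
qed

lemma continuous_phi:
  assumes "0 \<le> t"
  shows "continuous_on UNIV (phi t)"
  unfolding continuous_on_sequentially comp_def
proof safe
  fix u and x :: "nat \<Rightarrow> 'a" assume x: "x \<longlonglongrightarrow> u"
  show "(\<lambda>n. phi t (x n)) \<longlonglongrightarrow> phi t u"
    unfolding phi_def
  proof (rule integral_dominated_convergence[where w="\<lambda>_. 1"])
    show "AE w in M. (\<lambda>n. iexp (x n \<bullet> Y t w)) \<longlonglongrightarrow> iexp (u \<bullet> Y t w)"
      by (intro AE_I2 tendsto_intros x)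
  qed (use assms in auto)
qed

text \<open>\<open>phi (1/n) exp (- \<psi>/n)\<close> is a continuous choice of \<open>n\<close>-th roots of unity that is \<open>1\<close> at the
  origin, hence constant.\<close>

lemma phi_eq_exp:
  assumes c: "continuous_on UNIV \<psi>" and p0: "\<psi> 0 = 0" and p: "\<And>u. phi 1 u = exp (\<psi> u)"
    and t: "0 \<le> t"
  shows "phi t u = exp (of_real t * \<psi> u)"
proof -
  have inv: "phi (1 / real (Suc n)) u = exp (\<psi> u / of_nat (Suc n))" for n u
  proof -
    define g where "g u = phi (1 / real (Suc n)) u * exp (- (\<psi> u / of_nat (Suc n)))" for u
    have gp: "g u ^ Suc n = 1" for u
    proof -
      have "g u ^ Suc n = phi 1 u * exp (- (\<psi> u / of_nat (Suc n))) ^ Suc n"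
        using phi_mult_nat[of "1 / real (Suc n)" "Suc n" u]
        by (simp add: g_def power_mult_distrib del: of_nat_Suc power_Suc)
      also have "exp (- (\<psi> u / of_nat (Suc n))) ^ Suc n = exp (- \<psi> u)"
        unfolding exp_of_nat_mult[symmetric] by (simp del: of_nat_Suc)
      finally show ?thesis using p by (simp add: exp_minus)
    qed
    have cg: "continuous_on UNIV g" unfolding g_def
      by (intro continuous_intros continuous_phi c) (auto simp del: of_nat_Suc)
    have "range g \<subseteq> {z. z ^ Suc n = 1}" using gp by auto
    then have fin: "finite (range g)"
      by (rule finite_subset) (rule finite_roots_unity, simp)
    have "g constant_on UNIV"
      by (rule continuous_finite_range_constant[OF connected_UNIV cg fin])
    then have "g u = g 0" by (auto simp: constant_on_def)
    also have "\<dots> = 1" by (simp add: g_def phi_zero_arg p0)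
    finally show ?thesis by (simp add: g_def exp_minus field_simps)
  qed
  have rat: "phi (real m / real (Suc n)) u = exp (of_real (real m / real (Suc n)) * \<psi> u)" for m n
    using phi_mult_nat[of "1 / real (Suc n)" m u] inv[of n u]
    by (simp add: exp_of_nat_mult[symmetric])
  \<comment> \<open>Rational times strictly above t, at distance at most
    \<open>1 / real (Suc n)\<close>: right continuity carries the identity from them to t.\<close>
  define q where "q n = real (Suc (nat \<lfloor>t * real (Suc n)\<rfloor>)) / real (Suc n)" for n
  have q: "t < q n" "q n \<le> t + 1 / real (Suc n)" for n
  proof -
    have "real (nat \<lfloor>t * real (Suc n)\<rfloor>) = of_int \<lfloor>t * real (Suc n)\<rfloor>" using t by simp
    then have f: "t * real (Suc n) < real (Suc (nat \<lfloor>t * real (Suc n)\<rfloor>))"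
      "real (Suc (nat \<lfloor>t * real (Suc n)\<rfloor>)) \<le> t * real (Suc n) + 1"
      using floor_correct[of "t * real (Suc n)"] unfolding of_nat_Suc[of "nat _"] by linarith+
    from f(1) show "t < q n" unfolding q_def by (simp add: pos_less_divide_eq del: of_nat_Suc)
    have "t + 1 / real (Suc n) = (t * real (Suc n) + 1) / real (Suc n)"
      by (simp add: add_divide_distrib del: of_nat_Suc)
    with f(2) show "q n \<le> t + 1 / real (Suc n)"
      unfolding q_def by (simp add: divide_right_mono del: of_nat_Suc)
  qed
  have "(\<lambda>n. t + 1 / real (Suc n)) \<longlonglongrightarrow> t + 0"
    by (rule tendsto_add[OF tendsto_const LIMSEQ_Suc[OF lim_const_over_n]])
  moreover have "\<forall>\<^sub>F n in sequentially. t \<le> q n" "\<forall>\<^sub>F n in sequentially. q n \<le> t + 1 / real (Suc n)"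
    by (intro always_eventually allI less_imp_le q, intro always_eventually allI q)
  ultimately have qt: "q \<longlonglongrightarrow> t"
    using tendsto_sandwich[OF _ _ tendsto_const[of t], of q sequentially] by simp
  have "(\<lambda>n. phi (q n) u) \<longlonglongrightarrow> phi t u" by (rule phi_right_tendsto[OF t qt q(1)])
  moreover have "(\<lambda>n. phi (q n) u) \<longlonglongrightarrow> exp (of_real t * \<psi> u)"
  proof -
    have "phi (q n) u = exp (of_real (q n) * \<psi> u)" for n unfolding q_def by (rule rat)
    then show ?thesis by (simp only:) (intro tendsto_intros qt)
  qed
  ultimately show ?thesis by (rule LIMSEQ_unique)
qed

text \<open>A continuous function without zeros on a contractible space has a continuous logarithm.
  As \<open>phi 1 0 = 1\<close>, subtracting its value at the origin leaves the exponential
  unchanged.\<close>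

lemma exponent_exists:
  obtains \<psi> where "continuous_on UNIV \<psi>" "\<psi> 0 = 0" "\<And>u. phi 1 u = exp (\<psi> u)"
proof -
  obtain g where g: "continuous_on UNIV g" "\<And>u. phi 1 u = exp (g u)"
    using continuous_logarithm_on_contractible[OF continuous_phi[of 1] convex_imp_contractible[OF convex_UNIV]]
      phi_nonzero[of 1] by auto
  show ?thesis
  proof
    show "continuous_on UNIV (\<lambda>u. g u - g 0)" by (intro continuous_intros g)
    show "phi 1 u = exp (g u - g 0)" for u
      using g(2)[of 0] g(2)[of u] by (simp add: phi_zero_arg exp_diff)
  qed simp
qed

end

section \<open>Pathwise integrals as limits of Riemann sums\<close>

text \<open>Tagging each interval with its left endpoint makes a tagged division, over which
  \<open>additive_tagged_division_1\<close> telescopes.\<close>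

lemma sum_division_of_telescope:
  fixes f :: "real \<Rightarrow> real"
  assumes "a \<le> b" and D: "D division_of {a..b}"
  shows "(\<Sum>K\<in>D. f (Sup K) - f (Inf K)) = f b - f a"
proof -
  let ?p = "(\<lambda>K. (Inf K, K)) ` D"
  have ne: "K \<noteq> {}" "\<exists>c d. K = cbox c d" if "K \<in> D" for K using D that by (auto simp: division_of_def)
  have inf: "Inf K \<in> K" if "K \<in> D" for K
    using ne[OF that] by (auto simp: box_real)
  have "?p tagged_division_of {a..b}"
    unfolding tagged_division_of_def tagged_partial_division_of_def
  proof (intro conjI allI impI)
    show "finite ?p" using D by (auto simp: division_of_def)
    fix x K assume xK: "(x, K) \<in> ?p"
    then show "x \<in> K" "K \<subseteq> {a..b}" "\<exists>a b. K = cbox a b" using inf D by (auto simp: division_of_def)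
  next
    fix x K x' K' assume "(x, K) \<in> ?p \<and> (x', K') \<in> ?p \<and> (x, K) \<noteq> (x', K')"
    then have "K \<in> D" "K' \<in> D" "K \<noteq> K'" by auto
    then show "interior K \<inter> interior K' = {}" using D by (simp add: division_of_def)
  next
    show "\<Union> {K. \<exists>x. (x, K) \<in> ?p} = {a..b}"
      using D unfolding division_of_def by (auto simp: image_iff)
  qed
  from additive_tagged_division_1[OF assms(1) this, of f] show ?thesis
    by (subst (asm) sum.reindex) (auto simp: inj_on_def)
qed

lemma total_variation_mono:
  assumes mono: "mono_on {a..b} h" and "a \<le> b"
  shows "total_variation h a b = h b - h a"
proof -
  have eq: "(\<Sum>K\<in>D. \<bar>h (Sup K) - h (Inf K)\<bar>) = h b - h a" if D: "D division_of {a..b}" for D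
  proof -
    have "(\<Sum>K\<in>D. \<bar>h (Sup K) - h (Inf K)\<bar>) = (\<Sum>K\<in>D. h (Sup K) - h (Inf K))"
    proof (intro sum.cong refl)
      fix K assume K: "K \<in> D"
      obtain c d where cd: "K = {c..d}" "c \<le> d" "{c..d} \<subseteq> {a..b}"
        using D K unfolding division_of_def by (auto simp: box_real)
      then have "h (Inf K) \<le> h (Sup K)" using mono by (auto simp: mono_on_def)
      then show "\<bar>h (Sup K) - h (Inf K)\<bar> = h (Sup K) - h (Inf K)" by simp
    qed
    then show ?thesis using sum_division_of_telescope[OF \<open>a \<le> b\<close> D] by simp
  qed
  have "{{a..b}} division_of {a..b}"
    using division_of_self[of a b] assms(2) by (simp add: box_real)
  then have "{D. D division_of {a..b}} \<noteq> {}" by auto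
  then show ?thesis
    unfolding total_variation_def using eq by (simp cong: SUP_cong_simp)
qed

lemma unit_clip_in: "unit_clip t \<in> {0..1}"
  and unit_clip_mono: "s \<le> t \<Longrightarrow> unit_clip s \<le> unit_clip t"
  and unit_clip_id: "t \<in> {0..1} \<Longrightarrow> unit_clip t = t"
  by (auto simp: unit_clip_def)

lemma continuous_unit_clip: "continuous_on UNIV unit_clip"
  unfolding unit_clip_def[abs_def] by (intro continuous_intros)

text \<open>For nondecreasing \<open>h\<close> the variation function minus \<open>h\<close> is
  constant, so the second integral in \<open>stieltjes_integral\<close> vanishes.\<close>

lemma set_integral_interval_measure_const:
  "set_lebesgue_integral (interval_measure (\<lambda>_. c)) A f = 0"
proof -
  let ?M = "interval_measure (\<lambda>_. c :: real)"
  have "emeasure ?M (\<Union>n::nat. {- real n<..real n}) = 0"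
    by (rule emeasure_UN_eq_0) (auto simp: emeasure_interval_measure_Ioc)
  then have "UNIV \<in> null_sets ?M" by (simp add: UN_Ioc_eq_UNIV null_sets_def)
  then have "AE x in ?M. False" by (rule AE_I') auto
  then have "AE x in ?M. indicator A x *\<^sub>R f x = 0" by eventually_elim simp
  then show ?thesis unfolding set_lebesgue_integral_def by (rule integral_eq_zero_AE)
qed

section \<open>Uniform grids and convergence of Stieltjes sums\<close>

abbreviation (input) node :: "nat \<Rightarrow> nat \<Rightarrow> real" where
  "node n k \<equiv> real k / real (Suc n)"

text \<open>Index of the cell that contains t. Cells are open on the left and closed on the right,
  the intervals on which \<open>interval_measure\<close> is known; hence the ceiling minus
  one.\<close>

definition grid_index :: "nat \<Rightarrow> real \<Rightarrow> nat" where
  "grid_index n t = nat \<lceil>real (Suc n) * t\<rceil> - 1"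

lemma grid_index:
  assumes "0 < t" "t \<le> 1"
  shows "grid_index n t \<le> n" "node n (grid_index n t) < t"
    "t \<le> node n (Suc (grid_index n t))"
proof -
  let ?c = "\<lceil>real (Suc n) * t\<rceil>"
  have p: "0 < real (Suc n) * t" "real (Suc n) * t \<le> real (Suc n)"
    using assms by (simp_all add: mult_left_le del: of_nat_Suc)
  have c: "1 \<le> ?c" "?c \<le> int (Suc n)" using p by (simp_all add: ceiling_le_iff del: of_nat_Suc)
  have c2: "of_int ?c - 1 < real (Suc n) * t" "real (Suc n) * t \<le> of_int ?c"
    using ceiling_correct[of "real (Suc n) * t"] by auto
  have r: "real (grid_index n t) = of_int ?c - 1" "real (Suc (grid_index n t)) = of_int ?c"
    unfolding grid_index_def using c by (simp_all add: of_nat_diff nat_le_iff le_nat_iff del: of_nat_Suc) linarith+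
  show "grid_index n t \<le> n" unfolding grid_index_def using c by linarith
  show "node n (grid_index n t) < t" "t \<le> node n (Suc (grid_index n t))"
    unfolding r using c2 by (simp_all add: field_simps del: of_nat_Suc)
qed

lemma grid_index_tendsto:
  assumes t: "0 < t" "t \<le> 1"
  shows "(\<lambda>n. node n (grid_index n t)) \<longlonglongrightarrow> t"
    "(\<lambda>n. node n (Suc (grid_index n t))) \<longlonglongrightarrow> t"
proof -
  have e: "node n (Suc (grid_index n t)) = node n (grid_index n t) + 1 / real (Suc n)" for n
    by (simp add: add_divide_distrib)
  have z: "(\<lambda>n. 1 / real (Suc n)) \<longlonglongrightarrow> 0" by (rule LIMSEQ_Suc[OF lim_const_over_n])
  have l: "(\<lambda>n. t - 1 / real (Suc n)) \<longlonglongrightarrow> t" using tendsto_diff[OF tendsto_const z, of t] by simp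
  have "t - 1 / real (Suc n) \<le> node n (grid_index n t)" for n
    using grid_index(3)[OF t, of n] unfolding e by linarith
  moreover have "node n (grid_index n t) \<le> t" for n
    using grid_index(2)[OF t, of n] by linarith
  ultimately show *: "(\<lambda>n. node n (grid_index n t)) \<longlonglongrightarrow> t"
    by (intro tendsto_sandwich[OF _ _ l tendsto_const] always_eventually allI)
  show "(\<lambda>n. node n (Suc (grid_index n t))) \<longlonglongrightarrow> t"
    unfolding e using tendsto_add[OF * z] by simp
qed

lemma grid_step_sum:
  fixes c :: "nat \<Rightarrow> 'b::real_vector"
  shows "(\<Sum>k<Suc n. indicator {node n k<..node n (Suc k)} t *\<^sub>R c k) =
    indicator {0<..1} t *\<^sub>R c (grid_index n t)"
proof (cases "0 < t \<and> t \<le> 1")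
  case True
  then have t: "0 < t" "t \<le> 1" by auto
  have "indicator {node n k<..node n (Suc k)} t *\<^sub>R c k =
    (if k = grid_index n t then c k else 0)" for k
  proof (cases "t \<in> {node n k<..node n (Suc k)}")
    case True
    then have "real k < real (Suc (grid_index n t))" "real (grid_index n t) < real (Suc k)"
      using grid_index(2,3)[OF t, of n]
      by (auto simp: pos_divide_less_eq pos_less_divide_eq pos_divide_le_eq pos_le_divide_eq simp del: of_nat_Suc)
    then have "k = grid_index n t" by linarith
    with True show ?thesis by simp
  next
    case False
    moreover have "t \<in> {node n k<..node n (Suc k)}" if "k = grid_index n t"
      using grid_index(2,3)[OF t, of n] that by simp
    ultimately show ?thesis by auto
  qed
  then show ?thesis using grid_index(1)[OF t, of n] t by (simp add: less_Suc_eq_le del: sum.lessThan_Suc)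
next
  case False
  have "t \<notin> {node n k<..node n (Suc k)}" if "k < Suc n" for k
  proof
    assume a: "t \<in> {node n k<..node n (Suc k)}"
    have "0 \<le> node n k" by simp
    moreover have "node n (Suc k) \<le> 1" using that by (simp del: of_nat_Suc)
    ultimately show False using a False unfolding greaterThanAtMost_iff by linarith
  qed
  then show ?thesis using False by (auto intro!: sum.neutral simp: indicator_def simp del: sum.lessThan_Suc)
qed

text \<open>The sums are integrals of step functions, so dominated convergence applies. The
  coefficients stay abstract to cover two uses: path values at left nodes, which produce left
  limits, and exponents at right nodes, with a continuous integrand.\<close>

lemma stieltjes_sum_tendsto:
  fixes L :: "real \<Rightarrow> 'b::{banach, second_countable_topology}"
  assumes mono: "\<And>x y. x \<le> y \<Longrightarrow> V x \<le> V y" and cont: "\<And>a. continuous (at_right a) V"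
    and L: "\<And>t. 0 < t \<Longrightarrow> t \<le> 1 \<Longrightarrow> (\<lambda>n. c n (grid_index n t)) \<longlonglongrightarrow> L t"
    and B: "\<And>n k. k \<le> n \<Longrightarrow> norm (c n k) \<le> B"
  shows "(\<lambda>n. \<Sum>k<Suc n. (V (node n (Suc k)) - V (node n k)) *\<^sub>R c n k)
    \<longlonglongrightarrow> set_lebesgue_integral (interval_measure V) {0<..1} L"
proof -
  let ?M = "interval_measure V"
  define f where "f n t = (\<Sum>k<Suc n. indicator {node n k<..node n (Suc k)} t *\<^sub>R c n k)" for n t
  have fin: "emeasure ?M {a<..b} < \<infinity>" for a b
    using emeasure_interval_measure_Ioc[OF _ mono cont, of a b] by (cases "a \<le> b") auto
  have int: "(LINT t|?M. f n t) = (\<Sum>k<Suc n. (V (node n (Suc k)) - V (node n k)) *\<^sub>R c n k)" for n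
  proof -
    have "(LINT t|?M. f n t) = (\<Sum>k<Suc n. LINT t|?M. indicator {node n k<..node n (Suc k)} t *\<^sub>R c n k)"
      unfolding f_def by (intro Bochner_Integration.integral_sum integrable_scaleR_left) (use fin in auto)
    also have "\<dots> = (\<Sum>k<Suc n. (V (node n (Suc k)) - V (node n k)) *\<^sub>R c n k)"
    proof (intro sum.cong refl)
      fix k
      have "node n k \<le> node n (Suc k)" by (simp add: divide_right_mono)
      from measure_interval_measure_Ioc[OF this mono cont]
      show "(LINT t|?M. indicator {node n k<..node n (Suc k)} t *\<^sub>R c n k) =
          (V (node n (Suc k)) - V (node n k)) *\<^sub>R c n k"
        using fin by simp
    qed
    finally show ?thesis .
  qed
  have lim: "(\<lambda>n. f n t) \<longlonglongrightarrow> indicator {0<..1} t *\<^sub>R L t" for t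
    unfolding f_def grid_step_sum
    by (cases "0 < t \<and> t \<le> 1") (use L in \<open>auto simp: indicator_def\<close>)
  have meas: "f n \<in> borel_measurable ?M" for n unfolding f_def[abs_def] by measurable
  have "(\<lambda>n. LINT t|?M. f n t) \<longlonglongrightarrow> (LINT t|?M. indicator {0<..1} t *\<^sub>R L t)"
  proof (rule integral_dominated_convergence[where w="\<lambda>t. indicator {0<..1} t * B"])
    show "(\<lambda>t. indicator {0<..1} t *\<^sub>R L t) \<in> borel_measurable ?M"
      by (rule borel_measurable_LIMSEQ_metric[OF meas lim])
    show "integrable ?M (\<lambda>t. indicator {0<..1} t * B)"
      using fin by (intro integrable_mult_left) auto
    show "AE t in ?M. norm (f n t) \<le> indicator {0<..1} t * B" for n
      unfolding f_def grid_step_sum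
      by (intro AE_I2) (use B grid_index(1) in \<open>auto simp: indicator_def\<close>)
  qed (use meas lim in auto)
  then show ?thesis unfolding int set_lebesgue_integral_def .
qed

text \<open>Bisection: around each point the path is bounded, by its right limit on one side and its
  left limit on the other, and bounds on adjacent intervals combine.\<close>

lemma cadlag_bounded:
  assumes f: "cadlag f" and "0 \<le> T"
  shows "\<exists>B. \<forall>s\<in>{0..T}. norm (f s) \<le> B"
proof -
  have "\<exists>B. \<forall>s\<in>{0..T} \<inter> {0..}. norm (f s) \<le> B"
  \<comment> \<open>Intersecting with \<open>{0..}\<close> discards negative times, about which
    \<open>cadlag\<close> says nothing but which neighbourhoods of 0 contain.\<close>
  proof (rule Bolzano[where P="\<lambda>a b. \<exists>B. \<forall>s\<in>{a..b} \<inter> {0..}. norm (f s) \<le> B", OF \<open>0 \<le> T\<close>], goal_cases)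
    case trans: (1 a b c)
    from trans obtain B B' where "\<forall>s\<in>{a..b} \<inter> {0..}. norm (f s) \<le> B" "\<forall>s\<in>{b..c} \<inter> {0..}. norm (f s) \<le> B'"
      by blast
    then have "\<forall>s\<in>{a..c} \<inter> {0..}. norm (f s) \<le> max B B'"
      by (metis Int_iff atLeastAtMost_iff le_max_iff_disj nle_le)
    then show ?case by blast
  next
    case local: (2 x)
    have "(f \<longlongrightarrow> f x) (at_right x)" using f local by (simp add: cadlag_def continuous_within)
    then have "\<forall>\<^sub>F s in at_right x. dist (f s) (f x) < 1" by (rule tendstoD) simp
    then obtain d1 where d1: "d1 > x" "\<And>s. x < s \<Longrightarrow> s < d1 \<Longrightarrow> dist (f s) (f x) < 1"
      by (auto simp: eventually_at_right_field)
    have "\<exists>l. x > 0 \<longrightarrow> (f \<longlongrightarrow> l) (at_left x)" using f by (auto simp: cadlag_def)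
    then obtain l where l: "x > 0 \<Longrightarrow> (f \<longlongrightarrow> l) (at_left x)" by auto
    have "\<exists>d2<x. \<forall>s. 0 \<le> s \<longrightarrow> d2 < s \<longrightarrow> s < x \<longrightarrow> dist (f s) l < 1"
    proof (cases "x > 0")
      case True
      from tendstoD[OF l[OF this], of 1] show ?thesis by (auto simp: eventually_at_left_field)
    next
      case False
      then show ?thesis by (intro exI[of _ "x - 1"]) auto
    qed
    then obtain d2 where d2: "d2 < x" "\<And>s. 0 \<le> s \<Longrightarrow> d2 < s \<Longrightarrow> s < x \<Longrightarrow> dist (f s) l < 1" by blast
    have b: "norm (f s) \<le> norm (f x) + norm l + 1" if "0 \<le> s" "d2 < s" "s < d1" for s
    proof (cases s x rule: linorder_cases)
      case less
      then have "dist (f s) l < 1" using d2 that by auto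
      then show ?thesis using norm_triangle_sub[of "f s" l] norm_ge_zero[of "f x"] unfolding dist_norm by linarith
    next
      case equal
      then show ?thesis by simp
    next
      case greater
      then have "dist (f s) (f x) < 1" using d1 that by auto
      then show ?thesis using norm_triangle_sub[of "f s" "f x"] norm_ge_zero[of l] unfolding dist_norm by linarith
    qed
    show ?case
    proof (rule exI[of _ "min (d1 - x) (x - d2)"], intro conjI allI impI)
      show "0 < min (d1 - x) (x - d2)" using d1 d2 by simp
      fix a c assume "a \<le> x \<and> x \<le> c \<and> c - a < min (d1 - x) (x - d2)"
      then show "\<exists>B. \<forall>s\<in>{a..c} \<inter> {0..}. norm (f s) \<le> B"
        by (intro exI[of _ "norm (f x) + norm l + 1"]) (auto intro!: b)
    qed
  qed
  then show ?thesis by auto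
qed

lemma sum_by_parts:
  fixes y :: "nat \<Rightarrow> 'b::real_vector"
  shows "(\<Sum>k<n. h (Suc k) *\<^sub>R (y (Suc k) - y k)) = h n *\<^sub>R y n - h 0 *\<^sub>R y 0 - (\<Sum>k<n. (h (Suc k) - h k) *\<^sub>R y k)"
  by (induction n) (simp_all add: algebra_simps)

text \<open>Abel summation moves the increments from the path to \<open>h\<close> and leaves path
  values at left nodes. As \<open>r\<close> is strictly increasing, the left node of the cell of t
  is mapped strictly below \<open>r t\<close>, so these values tend to the left limit.\<close>

lemma path_integral_sum_tendsto:
  fixes f :: "real \<Rightarrow> 'a::euclidean_space"
  assumes f: "cadlag f"
    and h: "mono_on {0..1} h" "continuous_on {0..1} h"
    and r: "strict_mono_on {0..1} r" "continuous_on {0..1} r" "0 \<le> r 0"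
  shows "(\<lambda>n. \<Sum>k<Suc n. h (node n (Suc k)) *\<^sub>R
      (f (r (node n (Suc k))) - f (r (node n k))))
    \<longlonglongrightarrow> h 1 *\<^sub>R f (r 1) - h 0 *\<^sub>R f (r 0) - stieltjes_integral (\<lambda>t. left_limit f (r t)) h"
proof -
  \<comment> \<open>The variation function of \<open>h\<close>, extended by constants. Its
    difference from the clipped \<open>h\<close> is the constant \<open>- h 0\<close>.\<close>
  define V where "V t = h (unit_clip t) - h 0" for t
  have TV: "total_variation h 0 (unit_clip t) = V t" for t
    unfolding V_def using unit_clip_in[of t] h(1)
    by (intro total_variation_mono) (auto simp: mono_on_def)
  have mono: "V x \<le> V y" if "x \<le> y" for x y
    using h(1) unit_clip_in[of x] unit_clip_in[of y] unit_clip_mono[OF that] by (auto simp: V_def mono_on_def)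
  have "continuous_on UNIV (\<lambda>t. h (unit_clip t))"
    using unit_clip_in by (intro continuous_on_compose2[OF h(2) continuous_unit_clip]) auto
  then have "continuous_on UNIV V" unfolding V_def by (intro continuous_intros)
  then have cont: "continuous (at_right a) V" for a
    by (metis continuous_at_imp_continuous_at_within continuous_on_eq_continuous_at iso_tuple_UNIV_I open_UNIV)
  have stie: "stieltjes_integral (\<lambda>t. left_limit f (r t)) h =
      set_lebesgue_integral (interval_measure V) {0<..1} (\<lambda>t. left_limit f (r t))"
  proof -
    have "(\<lambda>t. V t - h (unit_clip t)) = (\<lambda>_. - h 0)" by (simp add: V_def)
    then show ?thesis
      unfolding stieltjes_integral_def TV by (simp add: set_integral_interval_measure_const)
  qed
  have r0: "0 \<le> r t" "r t \<le> r 1" if "t \<in> {0..1}" for t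
    using strict_mono_onD[OF r(1), of 0 t] strict_mono_onD[OF r(1), of t 1] r(3) that
    by (cases "t = 0"; cases "t = 1"; force)+
  obtain B where B: "\<And>s. s \<in> {0..r 1} \<Longrightarrow> norm (f s) \<le> B"
    using cadlag_bounded[OF f r0(1)[of 1]] by (metis atLeastAtMost_iff order_refl zero_le_one)
  have grid: "node n k \<in> {0..1}" if "k \<le> Suc n" for k n
    using that by (simp del: of_nat_Suc)
  have lim: "(\<lambda>n. f (r (node n (grid_index n t)))) \<longlonglongrightarrow> left_limit f (r t)"
    if t: "0 < t" "t \<le> 1" for t
  proof -
    have rt: "0 < r t" using strict_mono_onD[OF r(1), of 0 t] t r(3) by simp
    obtain l where l: "(f \<longlongrightarrow> l) (at_left (r t))" using f rt by (auto simp: cadlag_def)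
    have ll: "left_limit f (r t) = l"
      using rt l by (simp add: left_limit_def tendsto_Lim)
    have g: "node n (grid_index n t) \<in> {0..1}" for n
      using grid_index(1)[OF t, of n] by (intro grid) simp
    have "(\<lambda>n. r (node n (grid_index n t))) \<longlonglongrightarrow> r t"
      by (rule continuous_on_tendsto_compose[OF r(2) grid_index_tendsto(1)[OF t]]) (use t g in auto)
    moreover have "r (node n (grid_index n t)) < r t" for n
      using strict_mono_onD[OF r(1) g[of n] _ grid_index(2)[OF t]] t by simp
    ultimately have "filterlim (\<lambda>n. r (node n (grid_index n t))) (at_left (r t)) sequentially"
      unfolding filterlim_at by (auto intro!: always_eventually simp: less_imp_neq)
    from filterlim_compose[OF l this] show ?thesis unfolding ll .
  qed
  have "(\<lambda>n. \<Sum>k<Suc n. (V (node n (Suc k)) - V (node n k)) *\<^sub>R f (r (node n k)))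
      \<longlonglongrightarrow> stieltjes_integral (\<lambda>t. left_limit f (r t)) h"
    unfolding stie
  proof (rule stieltjes_sum_tendsto[where B=B, OF mono cont])
    show "(\<lambda>n. f (r (node n (grid_index n t)))) \<longlonglongrightarrow> left_limit f (r t)"
      if "0 < t" "t \<le> 1" for t
      using that by (rule lim)
    show "norm (f (r (node n k))) \<le> B" if "k \<le> n" for n k :: nat
      using that r0[OF grid[of k n]] by (intro B) auto
  qed
  then have "(\<lambda>n. h 1 *\<^sub>R f (r 1) - h 0 *\<^sub>R f (r 0) -
      (\<Sum>k<Suc n. (V (node n (Suc k)) - V (node n k)) *\<^sub>R f (r (node n k))))
      \<longlonglongrightarrow> h 1 *\<^sub>R f (r 1) - h 0 *\<^sub>R f (r 0) - stieltjes_integral (\<lambda>t. left_limit f (r t)) h"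
    by (intro tendsto_diff tendsto_const)
  moreover have "(\<Sum>k<Suc n. h (node n (Suc k)) *\<^sub>R
      (f (r (node n (Suc k))) - f (r (node n k)))) =
      h 1 *\<^sub>R f (r 1) - h 0 *\<^sub>R f (r 0) -
      (\<Sum>k<Suc n. (V (node n (Suc k)) - V (node n k)) *\<^sub>R f (r (node n k)))" for n
  proof -
    have "(\<Sum>k<Suc n. (V (node n (Suc k)) - V (node n k)) *\<^sub>R f (r (node n k))) =
       (\<Sum>k<Suc n. (h (node n (Suc k)) - h (node n k)) *\<^sub>R f (r (node n k)))"
      by (intro sum.cong refl) (simp add: V_def unit_clip_id[OF grid] del: of_nat_Suc)
    then show ?thesis
      using sum_by_parts[of "\<lambda>k. h (node n k)" "\<lambda>k. f (r (node n k))" "Suc n"]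
      by (simp del: of_nat_Suc sum.lessThan_Suc)
  qed
  ultimately show ?thesis by (simp only:)
qed

context levy
begin

lemma random_integral_sum_tendsto:
  assumes "mono_on {0..1} h" "continuous_on {0..1} h"
    and "strict_mono_on {0..1} r" "continuous_on {0..1} r" "0 \<le> r 0" "w \<in> space M"
  shows "(\<lambda>n. \<Sum>k<Suc n. h (node n (Suc k)) *\<^sub>R
      (Y (r (node n (Suc k))) w - Y (r (node n k)) w))
    \<longlonglongrightarrow> random_integral h Y r w"
  unfolding random_integral_def by (rule path_integral_sum_tendsto[OF cadlag_Y]) fact+

text \<open>Independent increments turn the transform of a Riemann sum into the exponential of a
  Stieltjes sum of \<psi>. The factor \<tau> is kept apart from \<open>V\<close> so that
  \<open>V\<close> can be the identity, with Lebesgue measure as its interval measure, for every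
  horizon; the clipped \<open>r_beta\<close> occurs with \<tau> = 1.\<close>

lemma
  assumes h: "mono_on {0..1} h" "continuous_on {0..1} h"
    and r: "strict_mono_on {0..1} r" "continuous_on {0..1} r" "0 \<le> r 0"
  shows measurable_random_integral: "random_integral h Y r \<in> borel_measurable M"
    and char_random_integral:
      "\<And>V \<tau> \<psi>. \<lbrakk>\<And>x y. x \<le> y \<Longrightarrow> V x \<le> V y; \<And>a. continuous (at_right a) V;
        \<And>x. x \<in> {0..1} \<Longrightarrow> r x = \<tau> * V x;
        continuous_on UNIV \<psi>; \<And>t u. 0 \<le> t \<Longrightarrow> phi t u = exp (of_real t * \<psi> u)\<rbrakk> \<Longrightarrow>
        (CLINT w|M. iexp (u \<bullet> random_integral h Y r w)) =
          exp (of_real \<tau> * set_lebesgue_integral (interval_measure V) {0<..1} (\<lambda>t. \<psi> (h t *\<^sub>R u)))"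
proof -
  have grid: "node n k \<in> {0..1}" if "k \<le> Suc n" for k n
    using that by (simp del: of_nat_Suc)
  have r0: "0 \<le> r t" if "t \<in> {0..1}" for t
    using strict_mono_onD[OF r(1), of 0 t] r(3) that by (cases "t = 0"; force)
  define S where "S n w = (\<Sum>k<Suc n. h (node n (Suc k)) *\<^sub>R
      (Y (r (node n (Suc k))) w - Y (r (node n k)) w))" for n w
  have S: "(\<lambda>n. S n w) \<longlonglongrightarrow> random_integral h Y r w" if "w \<in> space M" for w
    unfolding S_def by (rule random_integral_sum_tendsto[OF h r that])
  have mS[measurable]: "S n \<in> borel_measurable M" for n
    unfolding S_def[abs_def]
    by (intro borel_measurable_sum borel_measurable_scaleR borel_measurable_diff measurable_Y r0 grid borel_measurable_const)
       (auto simp del: of_nat_Suc)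
  show mR[measurable]: "random_integral h Y r \<in> borel_measurable M"
    by (rule borel_measurable_LIMSEQ_metric[OF mS S])
  fix V \<tau> \<psi> assume mono: "\<And>x y. x \<le> y \<Longrightarrow> V x \<le> V y" and cont: "\<And>a. continuous (at_right a) V"
    and rV: "\<And>x. x \<in> {0..1} \<Longrightarrow> r x = \<tau> * V x"
    and \<psi>: "continuous_on UNIV \<psi>" and phi: "\<And>t u. 0 \<le> t \<Longrightarrow> phi t u = exp (of_real t * \<psi> u)"
  define c where "c n k = \<psi> (h (node n (Suc k)) *\<^sub>R u)" for n k :: nat
  have chS: "(CLINT w|M. iexp (u \<bullet> S n w)) =
      exp (of_real \<tau> * (\<Sum>k<Suc n. (V (node n (Suc k)) - V (node n k)) *\<^sub>R c n k))" for n
  proof -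
    let ?t = "\<lambda>k. r (min 1 (node n k))"
    have mn: "min 1 (node n k) = node n k" if "k \<le> Suc n" for k
      using grid[OF that] by simp
    have "(CLINT w|M. iexp (u \<bullet> S n w)) = (CLINT w|M. iexp (\<Sum>k<Suc n.
        (h (node n (Suc k)) *\<^sub>R u) \<bullet> (Y (?t (Suc k)) w - Y (?t k) w)))"
      unfolding S_def inner_sum_right inner_scaleR_right inner_scaleR_left
      by (intro Bochner_Integration.integral_cong refl arg_cong[where f="\<lambda>x. iexp x"] sum.cong)
        (simp add: mn del: of_nat_Suc)
    also have "\<dots> = (\<Prod>k<Suc n. phi (?t (Suc k) - ?t k) (h (node n (Suc k)) *\<^sub>R u))"
    proof (rule char_increments)
      show "0 \<le> ?t 0" using r(3) by simp
      fix k assume "k < Suc n"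
      then show "?t k \<le> ?t (Suc k)"
        using strict_mono_onD[OF r(1) grid[of k n] grid[of "Suc k" n]]
        by (simp add: mn divide_strict_right_mono less_imp_le del: of_nat_Suc)

    qed
    also have "\<dots> = (\<Prod>k<Suc n. exp (of_real \<tau> * ((V (node n (Suc k)) - V (node n k)) *\<^sub>R c n k)))"
    proof (intro prod.cong refl)
      fix k assume k: "k \<in> {..<Suc n}"
      have "r (node n k) \<le> r (node n (Suc k))"
        using strict_mono_onD[OF r(1) grid[of k n] grid[of "Suc k" n]] k
        by (simp add: divide_strict_right_mono less_imp_le)
      then show "phi (?t (Suc k) - ?t k) (h (node n (Suc k)) *\<^sub>R u) =
          exp (of_real \<tau> * ((V (node n (Suc k)) - V (node n k)) *\<^sub>R c n k))"
        using k by (simp add: mn phi rV[OF grid] c_def scaleR_conv_of_real algebra_simps del: of_nat_Suc)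
    qed
    finally show ?thesis by (simp add: exp_sum sum_distrib_left del: of_nat_Suc sum.lessThan_Suc prod.lessThan_Suc)
  qed
  have ch: "continuous_on {0..1} (\<lambda>t. \<psi> (h t *\<^sub>R u))"
    by (rule continuous_on_compose2[OF \<psi>]) (intro continuous_intros h, auto)
  obtain B where B: "\<And>t. t \<in> {0..1} \<Longrightarrow> norm (\<psi> (h t *\<^sub>R u)) \<le> B"
    using compact_imp_bounded[OF compact_continuous_image[OF ch compact_Icc]]
    unfolding bounded_iff by (metis imageI)
  have "(\<lambda>n. \<Sum>k<Suc n. (V (node n (Suc k)) - V (node n k)) *\<^sub>R c n k)
      \<longlonglongrightarrow> set_lebesgue_integral (interval_measure V) {0<..1} (\<lambda>t. \<psi> (h t *\<^sub>R u))"
  proof (rule stieltjes_sum_tendsto[OF mono cont])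
    fix t :: real assume t: "0 < t" "t \<le> 1"
    show "(\<lambda>n. c n (grid_index n t)) \<longlonglongrightarrow> \<psi> (h t *\<^sub>R u)" unfolding c_def
      by (rule continuous_on_tendsto_compose[OF ch grid_index_tendsto(2)[OF t]])
        (use t grid_index(1)[OF t] in \<open>auto intro!: always_eventually grid simp del: of_nat_Suc\<close>)
  next
    fix n k :: nat assume "k \<le> n" then show "norm (c n k) \<le> B" unfolding c_def by (intro B grid) simp
  qed
  then have "(\<lambda>n. CLINT w|M. iexp (u \<bullet> S n w)) \<longlonglongrightarrow>
      exp (of_real \<tau> * set_lebesgue_integral (interval_measure V) {0<..1} (\<lambda>t. \<psi> (h t *\<^sub>R u)))"
    unfolding chS by (intro tendsto_intros)
  moreover have "(\<lambda>n. CLINT w|M. iexp (u \<bullet> S n w)) \<longlonglongrightarrow> (CLINT w|M. iexp (u \<bullet> random_integral h Y r w))"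
    by (rule integral_dominated_convergence[where w="\<lambda>_. 1"]) (auto intro!: AE_I2 tendsto_intros S)
  ultimately show "(CLINT w|M. iexp (u \<bullet> random_integral h Y r w)) =
          exp (of_real \<tau> * set_lebesgue_integral (interval_measure V) {0<..1} (\<lambda>t. \<psi> (h t *\<^sub>R u)))"
    by (rule LIMSEQ_unique[symmetric])
qed

end

section \<open>The mapping \<open>J\<close> is well defined\<close>

text \<open>Factorisation into functions of the time differences encodes both Levy properties: one
  increment gives stationarity, several give independence.\<close>

lemma levy_processI_char:
  fixes Y :: "real \<Rightarrow> 'w \<Rightarrow> 'a::euclidean_space"
  assumes "prob_space M" and Y[measurable]: "\<And>t. 0 \<le> t \<Longrightarrow> Y t \<in> borel_measurable M"
    and Y0: "\<And>w. w \<in> space M \<Longrightarrow> Y 0 w = 0" and cad: "\<And>w. w \<in> space M \<Longrightarrow> cadlag (\<lambda>t. Y t w)"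
    and char: "\<And>n t u. 0 \<le> t 0 \<Longrightarrow> (\<And>i. i < n \<Longrightarrow> t i \<le> t (Suc i)) \<Longrightarrow>
      (CLINT w|M. iexp (\<Sum>i<n. u i \<bullet> (Y (t (Suc i)) w - Y (t i) w))) = (\<Prod>i<n. F (t (Suc i) - t i) (u i))"
  shows "levy_process M Y"
proof -
  interpret prob_space M by fact
  have inc: "(CLINT w|M. iexp (u \<bullet> (Y t w - Y s w))) = F (t - s) u" if "0 \<le> s" "s \<le> t" for s t u
    using char[of "\<lambda>i. if i = 0 then s else t" 1 "\<lambda>_. u"] that by simp
  have "distr M borel (\<lambda>w. Y (s + h) w - Y s w) = distr M borel (\<lambda>w. Y h w - Y 0 w)"
    if "0 \<le> s" "0 \<le> h" for s h
  proof (rule mchar_unique)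
    show "mchar (distr M borel (\<lambda>w. Y (s + h) w - Y s w)) u = mchar (distr M borel (\<lambda>w. Y h w - Y 0 w)) u" for u
      using that inc[of s "s + h" u] inc[of 0 h u] by (simp add: mchar_distr)
  qed (use that in \<open>auto intro!: prob_space_distr\<close>)
  moreover have "indep_vars (\<lambda>_. borel) (\<lambda>i w. Y (t (Suc i)) w - Y (t i) w) {..<n}"
    if t: "0 \<le> t 0" "\<forall>i<n. t i \<le> t (Suc i)" for n :: nat and t
  proof -
    have t0: "0 \<le> t i" if "i \<le> n" for i
      by (rule nonneg_of_steps[where n=n, OF _ _ that]) (use t in auto)
    show ?thesis
    proof (rule indep_vars_charI)
      show "(\<lambda>w. Y (t (Suc i)) w - Y (t i) w) \<in> borel_measurable M" if "i \<in> {..<n}" for i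
        using that t0[of i] t0[of "Suc i"] by simp
      fix u
      have "(CLINT w|M. iexp (u i \<bullet> (Y (t (Suc i)) w - Y (t i) w))) = F (t (Suc i) - t i) (u i)" if "i < n" for i
        using that t t0[of i] by (intro inc) auto
      then show "(CLINT w|M. iexp (\<Sum>i<n. u i \<bullet> (Y (t (Suc i)) w - Y (t i) w))) =
        (\<Prod>i<n. CLINT w|M. iexp (u i \<bullet> (Y (t (Suc i)) w - Y (t i) w)))"
        using char[of t n u] t by simp
    qed simp
  qed
  ultimately show ?thesis
    unfolding levy_process_def using assms by auto
qed

text \<open>Meant for paths restricted to \<open>{0..}\<close>, which are \<open>undefined\<close>
  at negative times.\<close>

lemma cadlag_cong:
  assumes f: "cadlag f" and eq: "\<And>t. 0 \<le> t \<Longrightarrow> f t = g t"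
  shows "cadlag g"
  unfolding cadlag_def
proof (intro conjI allI impI)
  fix t :: real assume t: "0 \<le> t"
  have "(f \<longlongrightarrow> f t) (at_right t)" using f t by (simp add: cadlag_def continuous_within)
  moreover have "\<forall>\<^sub>F s in at_right t. f s = g s"
    using eventually_at_right_less[of t] by eventually_elim (use t eq in auto)
  ultimately have "(g \<longlongrightarrow> f t) (at_right t)" by (rule Lim_transform_eventually)
  then show "continuous (at_right t) g" using eq[OF t] by (simp add: continuous_within)
next
  fix t :: real assume t: "0 < t"
  obtain l where "(f \<longlongrightarrow> l) (at_left t)" using f t by (auto simp: cadlag_def)
  moreover have "\<forall>\<^sub>F s in at_left t. f s = g s"
    by (rule eventually_at_leftI[OF _ t]) (use eq in auto)
  ultimately show "\<exists>l. (g \<longlongrightarrow> l) (at_left t)" using Lim_transform_eventually by blast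
qed

text \<open>The law of the whole path realises the process on the type over which \<open>J\<close>
  quantifies. Being cadlag depends on uncountably many coordinates, so the product sigma-algebra is
  replaced by its trace on \<open>C\<close>, which contains all paths.\<close>

lemma levy_process_path_space:
  fixes Y :: "real \<Rightarrow> 'w \<Rightarrow> 'a::euclidean_space"
  assumes "levy_process M Y"
  obtains M' :: "(real \<Rightarrow> 'a) measure"
  where "levy_process M' (\<lambda>t f. f t)" "distr M' borel (\<lambda>f. f 1) = distr M borel (Y 1)"
proof -
  interpret levy M Y by unfold_locales fact
  define C where "C = {f :: real \<Rightarrow> 'a. f 0 = 0 \<and> cadlag f}"
  define R where "R = restrict_space (PiM {0..} (\<lambda>_. borel :: 'a measure)) C"
  define p where "p w = (\<lambda>t\<in>{0..}. Y t w)" for w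
  have pC: "p w \<in> C" if "w \<in> space M" for w
    using that cadlag_cong[OF cadlag_Y[OF that], of "p w"] by (auto simp: C_def p_def Y_0)
  have [measurable]: "p \<in> measurable M R"
    unfolding R_def using pC
    by (intro measurable_restrict_space2) (auto simp: p_def[abs_def] intro!: measurable_restrict)
  have co[measurable]: "(\<lambda>f. f t) \<in> borel_measurable R" if "0 \<le> t" for t
    unfolding R_def using that by (intro measurable_restrict_space1 measurable_component_singleton) simp
  define M' where "M' = distr M R p"
  have prob: "prob_space M'" unfolding M'_def by (rule prob_space_distr) simp
  have sp: "space M' \<subseteq> C" by (auto simp: M'_def R_def space_restrict_space)
  show ?thesis
  proof
    show "levy_process M' (\<lambda>t f. f t)"
    proof (rule levy_processI_char[where F=phi, OF prob])
      show "(\<lambda>f. f t) \<in> borel_measurable M'" if "0 \<le> t" for t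
        using that by (simp add: M'_def)
      show "f 0 = 0" "cadlag (\<lambda>t. f t)" if "f \<in> space M'" for f
        using sp that by (auto simp: C_def)
      fix n u and t :: "nat \<Rightarrow> real" assume t: "0 \<le> t 0" "\<And>i. i < n \<Longrightarrow> t i \<le> t (Suc i)"
      have t0: "0 \<le> t i" if "i \<le> n" for i
      by (rule nonneg_of_steps[where n=n, OF _ _ that]) (use t in auto)
      have [measurable]: "(\<lambda>f. f (t (Suc i)) - f (t i)) \<in> borel_measurable R" if "i < n" for i
        using that by (intro borel_measurable_diff co t0) auto
      have "(CLINT f|M'. iexp (\<Sum>i<n. u i \<bullet> (f (t (Suc i)) - f (t i)))) =
          (CLINT w|M. iexp (\<Sum>i<n. u i \<bullet> (p w (t (Suc i)) - p w (t i))))"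
        unfolding M'_def by (rule integral_distr) (auto intro!: borel_measurable_sum)
      also have "\<dots> = (CLINT w|M. iexp (\<Sum>i<n. u i \<bullet> (Y (t (Suc i)) w - Y (t i) w)))"
        by (intro Bochner_Integration.integral_cong refl arg_cong[where f="\<lambda>x. iexp x"] sum.cong)
          (simp add: p_def t0)
      finally show "(CLINT f|M'. iexp (\<Sum>i<n. u i \<bullet> (f (t (Suc i)) - f (t i)))) = (\<Prod>i<n. phi (t (Suc i) - t i) (u i))"
        using char_increments[OF t] by simp
    qed
    show "distr M' borel (\<lambda>f. f 1) = distr M borel (Y 1)"
      unfolding M'_def by (subst distr_distr) (auto intro!: distr_cong simp: p_def)
  qed
qed

lemma powr_integrand:
  assumes "0 < \<beta>"
  shows "mono_on {0..1} (\<lambda>t::real. t powr (1 / \<beta>))" "continuous_on {0..1} (\<lambda>t::real. t powr (1 / \<beta>))"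
  using assms by (auto intro!: mono_onI powr_mono2 continuous_on_powr' continuous_on_id continuous_on_const)

text \<open>With \<open>\<tau> * t\<close> as time change the integral runs up to horizon \<tau>.
  Its exponent is linear in \<tau>, which makes these laws a convolution semigroup through the value
  of \<open>J\<close> at \<tau> = 1.\<close>

lemma (in levy) char_J_integral:
  assumes "0 < \<beta>" "0 < \<tau>" and \<psi>: "continuous_on UNIV \<psi>" "\<And>t u. 0 \<le> t \<Longrightarrow> phi t u = exp (of_real t * \<psi> u)"
  shows "random_integral (\<lambda>t. t powr (1 / \<beta>)) Y (\<lambda>t. \<tau> * t) \<in> borel_measurable M"
    "(CLINT w|M. iexp (u \<bullet> random_integral (\<lambda>t. t powr (1 / \<beta>)) Y (\<lambda>t. \<tau> * t) w)) =
      exp (of_real \<tau> * (CLBINT t:{0<..1}. \<psi> (t powr (1 / \<beta>) *\<^sub>R u)))"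
proof -
  have r: "strict_mono_on {0..1} (\<lambda>t. \<tau> * t)" "continuous_on {0..1} (\<lambda>t. \<tau> * t)" "0 \<le> \<tau> * 0"
    using assms by (auto intro!: strict_mono_onI continuous_intros)
  show "random_integral (\<lambda>t. t powr (1 / \<beta>)) Y (\<lambda>t. \<tau> * t) \<in> borel_measurable M"
    by (rule measurable_random_integral[OF powr_integrand[OF assms(1)] r])
  show "(CLINT w|M. iexp (u \<bullet> random_integral (\<lambda>t. t powr (1 / \<beta>)) Y (\<lambda>t. \<tau> * t) w)) =
      exp (of_real \<tau> * (CLBINT t:{0<..1}. \<psi> (t powr (1 / \<beta>) *\<^sub>R u)))"
    unfolding lborel_eq_real
    by (rule char_random_integral[OF powr_integrand[OF assms(1)] r _ _ _ \<psi>]) (use assms in auto)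
qed

text \<open>Equal laws at time one allow a single \<psi> for both processes, hence equal exponents.
  The sample space types may differ, as the comparison with path space demands.\<close>

lemma J_integral_law_unique:
  fixes Y :: "real \<Rightarrow> 'w \<Rightarrow> 'a::euclidean_space" and Y' :: "real \<Rightarrow> 'v \<Rightarrow> 'a"
  assumes "0 < \<beta>" "levy_process M Y" "levy_process M' Y'" and eq: "distr M borel (Y 1) = distr M' borel (Y' 1)"
  shows "distr M borel (random_integral (\<lambda>t. t powr (1 / \<beta>)) Y (\<lambda>t. t)) =
    distr M' borel (random_integral (\<lambda>t. t powr (1 / \<beta>)) Y' (\<lambda>t. t))"
proof -
  interpret Y: levy M Y by unfold_locales fact
  interpret Y': levy M' Y' by unfold_locales fact
  obtain \<psi> where \<psi>: "continuous_on UNIV \<psi>" "\<psi> 0 = 0" "\<And>u. Y.phi 1 u = exp (\<psi> u)"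
    using Y.exponent_exists by blast
  have "Y.phi 1 u = Y'.phi 1 u" for u
    using arg_cong[OF eq, of "\<lambda>\<mu>. mchar \<mu> u"] by (simp add: mchar_distr Y.phi_def Y'.phi_def)
  then have \<psi>': "\<And>u. Y'.phi 1 u = exp (\<psi> u)" using \<psi> by simp
  note * = Y.char_J_integral[OF \<open>0 < \<beta>\<close> zero_less_one \<psi>(1) Y.phi_eq_exp[OF \<psi>], simplified]
  note ** = Y'.char_J_integral[OF \<open>0 < \<beta>\<close> zero_less_one \<psi>(1) Y'.phi_eq_exp[OF \<psi>(1,2) \<psi>'], simplified]
  show ?thesis
    by (rule mchar_unique) (use * ** in \<open>auto intro!: Y.prob_space_distr Y'.prob_space_distr simp: mchar_distr\<close>)
qed

lemma J_eq:
  fixes Y :: "real \<Rightarrow> 'w \<Rightarrow> 'a::euclidean_space"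
  assumes "0 < \<beta>" "levy_process M Y"
  shows "J \<beta> (distr M borel (Y 1)) = distr M borel (random_integral (\<lambda>t. t powr (1 / \<beta>)) Y (\<lambda>t. t))"
  unfolding J_def
proof (rule the_equality)
  obtain M' :: "(real \<Rightarrow> 'a) measure"
    where M': "levy_process M' (\<lambda>t f. f t)" "distr M' borel (\<lambda>f. f 1) = distr M borel (Y 1)"
    using levy_process_path_space[OF assms(2)] .
  show "\<exists>(M' :: (real \<Rightarrow> 'a) measure) Y'. levy_process M' Y' \<and> distr M' borel (Y' 1) = distr M borel (Y 1) \<and>
     distr M borel (random_integral (\<lambda>t. t powr (1 / \<beta>)) Y (\<lambda>t. t)) =
     distr M' borel (random_integral (\<lambda>t. t powr (1 / \<beta>)) Y' (\<lambda>t. t))"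
    using M' J_integral_law_unique[OF assms M'(1) M'(2)[symmetric]] by blast
qed (use J_integral_law_unique[OF assms(1) _ assms(2)] in blast)

section \<open>Oscillations of random walks\<close>

text \<open>Says that \<open>p\<close> successive blocks of indices between \<open>a\<close> and
  \<open>b\<close>, without overlap, have sums of norm above \<open>c\<close>. After the first block
  the count restarts at its end \<open>j\<close>, the form in which independence of past and future
  can be used.\<close>

primrec osc :: "real \<Rightarrow> nat \<Rightarrow> (nat \<Rightarrow> 'a::real_normed_vector) \<Rightarrow> nat \<Rightarrow> nat \<Rightarrow> bool" where
  "osc c 0 x a b = True"
| "osc c (Suc p) x a b = (\<exists>j\<in>{..b}. \<exists>i\<in>{a..<j}. c < norm (sum x {i..<j}) \<and> osc c p x j b)"

lemma osc_antimono: "osc c p x a b \<Longrightarrow> a' \<le> a \<Longrightarrow> osc c p x a' b"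
  by (cases p) force+

lemma osc_cong:
  assumes "\<And>l. a \<le> l \<Longrightarrow> x l = y l"
  shows "osc c p x a b = osc c p y a b"
  using assms
proof (induction p arbitrary: a)
  case (Suc p)
  have "sum x {i..<j} = sum y {i..<j}" if "a \<le> i" for i j
    using Suc.prems that by (intro sum.cong) auto
  moreover have "osc c p x j b = osc c p y j b" if "a \<le> j" for j
    using Suc.prems that by (intro Suc.IH) auto
  ultimately show ?case by auto
qed simp

lemma sum_component_measurable:
  fixes I :: "nat set"
  assumes "{i..<j} \<subseteq> I"
  shows "(\<lambda>x. sum x {i..<j} :: 'a::euclidean_space) \<in> borel_measurable (PiM I (\<lambda>_. borel))"
  using assms by (intro borel_measurable_sum measurable_component_singleton) auto

text \<open>Only coordinates from \<open>a\<close> on enter, so the event belongs to the future of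
  \<open>a\<close>.\<close>

lemma osc_measurable:
  assumes "{a..} \<subseteq> I"
  shows "Measurable.pred (PiM I (\<lambda>_. borel :: 'a::euclidean_space measure)) (\<lambda>x. osc c p x a b)"
  using assms
proof (induction p arbitrary: a)
  case (Suc p)
  show ?case
    unfolding osc.simps
  proof (intro pred_intros_finite pred_intros_logic finite_atMost finite_atLeastLessThan)
    fix i j assume "i \<in> {a..<j}"
    then have "{i..<j} \<subseteq> I" "{j..} \<subseteq> I" using Suc.prems by auto
    with Suc.IH[of j] show "Measurable.pred (PiM I (\<lambda>_. borel :: 'a measure)) (\<lambda>x. osc c p x j b)" by simp
    note [measurable] = sum_component_measurable[OF \<open>{i..<j} \<subseteq> I\<close>]
    show "Measurable.pred (PiM I (\<lambda>_. borel)) (\<lambda>x. c < norm (sum x {i..<j} :: 'a))" by measurable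
  qed
qed simp

section \<open>First passage and maximal inequalities for independent sequences\<close>

context prob_space
begin

text \<open>Past and future events are predicates on sequences that ignore the other coordinates;
  invariance under \<open>restrict\<close> expresses this, because elements of the product spaces
  are \<open>undefined\<close> off their index set.\<close>

lemma indep_past_future:
  fixes \<xi> :: "nat \<Rightarrow> 'a \<Rightarrow> 'b::euclidean_space"
  assumes ind: "indep_vars (\<lambda>_. borel) \<xi> UNIV"
    and P: "Measurable.pred (PiM {..<k} (\<lambda>_. borel)) P" "\<And>f. P (restrict f {..<k}) = P f"
    and Q: "Measurable.pred (PiM {k..} (\<lambda>_. borel)) Q" "\<And>f. Q (restrict f {k..}) = Q f"
  shows "prob {w \<in> space M. P (\<lambda>l. \<xi> l w) \<and> Q (\<lambda>l. \<xi> l w)} =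
    prob {w \<in> space M. P (\<lambda>l. \<xi> l w)} * prob {w \<in> space M. Q (\<lambda>l. \<xi> l w)}"
proof -
  let ?A = "\<lambda>w. restrict (\<lambda>l. \<xi> l w) {..<k}" and ?B = "\<lambda>w. restrict (\<lambda>l. \<xi> l w) {k..}"
  let ?X = "{f \<in> space (PiM {..<k} (\<lambda>_. borel)). P f}" and ?Y = "{f \<in> space (PiM {k..} (\<lambda>_. borel)). Q f}"
  have i: "indep_var (PiM {..<k} (\<lambda>_. borel)) ?A (PiM {k..} (\<lambda>_. borel)) ?B"
    by (rule indep_var_restrict[OF ind]) auto
  have "prob ((\<lambda>w. (?A w, ?B w)) -` (?X \<times> ?Y) \<inter> space M) =
    prob (?A -` ?X \<inter> space M) * prob (?B -` ?Y \<inter> space M)"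
    by (rule indep_varD[OF i]) (use P(1) Q(1) in \<open>simp_all add: pred_def\<close>)
  moreover have "(\<lambda>w. (?A w, ?B w)) -` (?X \<times> ?Y) \<inter> space M = {w \<in> space M. P (\<lambda>l. \<xi> l w) \<and> Q (\<lambda>l. \<xi> l w)}"
    using P(2) Q(2) by (auto simp: space_PiM)
  moreover have "?A -` ?X \<inter> space M = {w \<in> space M. P (\<lambda>l. \<xi> l w)}" using P(2) by (auto simp: space_PiM)
  moreover have "?B -` ?Y \<inter> space M = {w \<in> space M. Q (\<lambda>l. \<xi> l w)}" using Q(2) by (auto simp: space_PiM)
  ultimately show ?thesis by simp
qed

text \<open>The event that some \<open>A k\<close> occurs is split by the first such k. First
  occurrence at k belongs to the past of k and \<open>Q k\<close> to its future, so probabilities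
  multiply; summing the disjoint cases bounds \<open>R\<close> from below and \<open>R'\<close> from
  above.\<close>

lemma first_passage:
  fixes \<xi> :: "nat \<Rightarrow> 'a \<Rightarrow> 'b::euclidean_space"
  assumes ind: "indep_vars (\<lambda>_. borel) \<xi> UNIV"
    and A: "\<And>k K. k \<le> K \<Longrightarrow> Measurable.pred (PiM {..<K} (\<lambda>_. borel)) (A k)"
      "\<And>k K f. k \<le> K \<Longrightarrow> A k (restrict f {..<K}) = A k f"
    and Q: "\<And>k. Measurable.pred (PiM {k..} (\<lambda>_. borel)) (Q k)" "\<And>k f. Q k (restrict f {k..}) = Q k f"
    and sub: "\<And>w k. w \<in> space M \<Longrightarrow> k \<in> {a..b} \<Longrightarrow> A k (\<lambda>l. \<xi> l w) \<Longrightarrow> (\<forall>i\<in>{a..<k}. \<not> A i (\<lambda>l. \<xi> l w)) \<Longrightarrow>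
      Q k (\<lambda>l. \<xi> l w) \<Longrightarrow> R w"
    and R: "Measurable.pred M R"
    and sup: "\<And>w. w \<in> space M \<Longrightarrow> R' w \<Longrightarrow>
      \<exists>k\<in>{a..b}. A k (\<lambda>l. \<xi> l w) \<and> (\<forall>i\<in>{a..<k}. \<not> A i (\<lambda>l. \<xi> l w)) \<and> Q k (\<lambda>l. \<xi> l w)"
    and R': "Measurable.pred M R'"
  shows "(\<And>k. k \<in> {a..b} \<Longrightarrow> q \<le> prob {w \<in> space M. Q k (\<lambda>l. \<xi> l w)}) \<Longrightarrow>
      q * prob {w \<in> space M. \<exists>k\<in>{a..b}. A k (\<lambda>l. \<xi> l w)} \<le> prob {w \<in> space M. R w}"
    and "(\<And>k. k \<in> {a..b} \<Longrightarrow> prob {w \<in> space M. Q k (\<lambda>l. \<xi> l w)} \<le> q) \<Longrightarrow>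
      prob {w \<in> space M. R' w} \<le> q * prob {w \<in> space M. \<exists>k\<in>{a..b}. A k (\<lambda>l. \<xi> l w)}"
proof -
  have [measurable]: "\<xi> l \<in> borel_measurable M" for l using ind by (simp add: indep_vars_def)
  define P where "P k f \<longleftrightarrow> A k f \<and> (\<forall>i\<in>{a..<k}. \<not> A i f)" for k f
  have P1: "Measurable.pred (PiM {..<k} (\<lambda>_. borel)) (P k)" for k
    unfolding P_def by (intro pred_intros_logic pred_intros_finite A(1)) auto
  have P2: "P k (restrict f {..<k}) = P k f" for k f
    unfolding P_def using A(2)[of k k f] A(2)[of _ k f] by auto
  define E where "E k = {w \<in> space M. P k (\<lambda>l. \<xi> l w)}" for k
  define G where "G k = {w \<in> space M. P k (\<lambda>l. \<xi> l w) \<and> Q k (\<lambda>l. \<xi> l w)}" for k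
  have mE: "E k \<in> events" for k
  proof -
    have "(\<lambda>w. restrict (\<lambda>l. \<xi> l w) {..<k}) \<in> measurable M (PiM {..<k} (\<lambda>_. borel))" by measurable
    from measurable_compose[OF this P1] show ?thesis by (simp add: E_def P2 pred_def)
  qed
  have mQ: "{w \<in> space M. Q k (\<lambda>l. \<xi> l w)} \<in> events" for k
  proof -
    have "(\<lambda>w. restrict (\<lambda>l. \<xi> l w) {k..}) \<in> measurable M (PiM {k..} (\<lambda>_. borel))" by measurable
    from measurable_compose[OF this Q(1)] show ?thesis by (simp add: Q(2) pred_def)
  qed
  have mG: "G k \<in> events" for k
  proof -
    have "G k = E k \<inter> {w \<in> space M. Q k (\<lambda>l. \<xi> l w)}" by (auto simp: G_def E_def)
    then show ?thesis using mE mQ by auto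
  qed
  have dE: "disjoint_family_on E {a..b}"
    unfolding disjoint_family_on_def
  proof (intro ballI impI)
    fix m n assume mn: "m \<in> {a..b}" "n \<in> {a..b}" "m \<noteq> n"
    show "E m \<inter> E n = {}"
      using mn by (cases m n rule: linorder_cases) (auto simp: E_def P_def)
  qed
  then have dG: "disjoint_family_on G {a..b}"
    unfolding disjoint_family_on_def E_def G_def by blast
  have U: "(\<Union>k\<in>{a..b}. E k) = {w \<in> space M. \<exists>k\<in>{a..b}. A k (\<lambda>l. \<xi> l w)}"
  proof (intro equalityI subsetI)
    fix w assume "w \<in> {w \<in> space M. \<exists>k\<in>{a..b}. A k (\<lambda>l. \<xi> l w)}"
    then obtain k where w: "w \<in> space M" and k: "k \<in> {a..b}" "A k (\<lambda>l. \<xi> l w)" by auto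
    define m where "m = (LEAST k. k \<in> {a..b} \<and> A k (\<lambda>l. \<xi> l w))"
    have m: "m \<in> {a..b} \<and> A m (\<lambda>l. \<xi> l w)"
      unfolding m_def by (rule LeastI[of _ k]) (use k in auto)
    have "\<not> A i (\<lambda>l. \<xi> l w)" if "i \<in> {a..<m}" for i
      using not_less_Least[of i "\<lambda>k. k \<in> {a..b} \<and> A k (\<lambda>l. \<xi> l w)"] that m unfolding m_def[symmetric] by auto
    then show "w \<in> (\<Union>k\<in>{a..b}. E k)" using m w by (auto simp: E_def P_def)
  qed (auto simp: E_def P_def)
  have sE: "prob {w \<in> space M. \<exists>k\<in>{a..b}. A k (\<lambda>l. \<xi> l w)} = (\<Sum>k\<in>{a..b}. prob (E k))"
    unfolding U[symmetric] by (rule finite_measure_finite_Union) (use mE dE in auto)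
  have sG: "prob (\<Union>k\<in>{a..b}. G k) = (\<Sum>k\<in>{a..b}. prob (G k))"
    by (rule finite_measure_finite_Union) (use mG dG in auto)
  have pG: "prob (G k) = prob (E k) * prob {w \<in> space M. Q k (\<lambda>l. \<xi> l w)}" for k
    unfolding G_def E_def by (rule indep_past_future[OF ind P1 P2 Q])
  show "q * prob {w \<in> space M. \<exists>k\<in>{a..b}. A k (\<lambda>l. \<xi> l w)} \<le> prob {w \<in> space M. R w}"
    if q: "\<And>k. k \<in> {a..b} \<Longrightarrow> q \<le> prob {w \<in> space M. Q k (\<lambda>l. \<xi> l w)}"
  proof -
    have "q * prob {w \<in> space M. \<exists>k\<in>{a..b}. A k (\<lambda>l. \<xi> l w)} \<le> (\<Sum>k\<in>{a..b}. prob (G k))"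
      unfolding sE sum_distrib_left pG by (intro sum_mono) (metis q mult.commute mult_left_mono measure_nonneg)
    also have "\<dots> \<le> prob {w \<in> space M. R w}"
      unfolding sG[symmetric] using R
      by (intro finite_measure_mono) (auto simp: G_def P_def intro: sub)
    finally show ?thesis .
  qed
  show "prob {w \<in> space M. R' w} \<le> q * prob {w \<in> space M. \<exists>k\<in>{a..b}. A k (\<lambda>l. \<xi> l w)}"
    if q: "\<And>k. k \<in> {a..b} \<Longrightarrow> prob {w \<in> space M. Q k (\<lambda>l. \<xi> l w)} \<le> q"
  proof -
    have "prob {w \<in> space M. R' w} \<le> prob (\<Union>k\<in>{a..b}. G k)"
      using sup by (intro finite_measure_mono sets.finite_UN mG) (auto simp: G_def P_def)
    also have "\<dots> \<le> q * prob {w \<in> space M. \<exists>k\<in>{a..b}. A k (\<lambda>l. \<xi> l w)}"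
      unfolding sE sG sum_distrib_left pG by (intro sum_mono) (metis q mult.commute mult_left_mono measure_nonneg)
    finally show ?thesis .
  qed
qed

text \<open>If the sum from \<open>a\<close> first exceeds \<open>2 * c\<close> at k while the
  remainder up to \<open>b\<close> stays within \<open>c\<close>, the total exceeds
  \<open>c\<close>. The remainder does so with probability at least 2/3, the total is that large
  with probability at most 1/3; the quotient is 1/2.\<close>

lemma ottaviani:
  fixes \<xi> :: "nat \<Rightarrow> 'a \<Rightarrow> 'b::euclidean_space"
  assumes ind: "indep_vars (\<lambda>_. borel) \<xi> UNIV" and "a \<le> b"
    and small: "\<And>i. i \<in> {a..b} \<Longrightarrow> prob {w \<in> space M. c < norm (\<Sum>l\<in>{i..<b}. \<xi> l w)} \<le> 1 / 3"
  shows "prob {w \<in> space M. \<exists>k\<in>{a..b}. 2 * c < norm (\<Sum>l\<in>{a..<k}. \<xi> l w)} \<le> 1 / 2"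
proof -
  have [measurable]: "\<xi> l \<in> borel_measurable M" for l using ind by (simp add: indep_vars_def)
  have "2 / 3 * prob {w \<in> space M. \<exists>k\<in>{a..b}. 2 * c < norm (\<Sum>l\<in>{a..<k}. \<xi> l w)} \<le>
    prob {w \<in> space M. c < norm (\<Sum>l\<in>{a..<b}. \<xi> l w)}"
  proof (rule first_passage(1)[OF ind, where A="\<lambda>k x. 2 * c < norm (sum x {a..<k})"
        and Q="\<lambda>k x. norm (sum x {k..<b}) \<le> c" and R'="\<lambda>_. False"])
    fix k K :: nat assume k: "k \<le> K"
    note [measurable] = sum_component_measurable[of a k "{..<K}", where 'a='b]
    show "Measurable.pred (PiM {..<K} (\<lambda>_. borel)) (\<lambda>x. 2 * c < norm (sum x {a..<k} :: 'b))"
      by measurable (use k in auto)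
    show "(2 * c < norm (sum (restrict f {..<K}) {a..<k})) = (2 * c < norm (sum f {a..<k} :: 'b))" for f
      using k by (intro arg_cong[where f="\<lambda>x. 2 * c < norm x"] sum.cong) auto
  next
    fix k
    note [measurable] = sum_component_measurable[of k b "{k..}", where 'a='b]
    show "Measurable.pred (PiM {k..} (\<lambda>_. borel)) (\<lambda>x. norm (sum x {k..<b} :: 'b) \<le> c)" by measurable auto
    show "(norm (sum (restrict f {k..}) {k..<b}) \<le> c) = (norm (sum f {k..<b} :: 'b) \<le> c)" for f
      by (intro arg_cong[where f="\<lambda>x. norm x \<le> c"] sum.cong) auto
  next
    fix w k assume k: "k \<in> {a..b}" and g: "2 * c < norm (\<Sum>l\<in>{a..<k}. \<xi> l w)" "norm (\<Sum>l\<in>{k..<b}. \<xi> l w) \<le> c"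
    have "(\<Sum>l\<in>{a..<b}. \<xi> l w) = (\<Sum>l\<in>{a..<k}. \<xi> l w) + (\<Sum>l\<in>{k..<b}. \<xi> l w)"
      using k by (simp add: sum.atLeastLessThan_concat)
    then show "c < norm (\<Sum>l\<in>{a..<b}. \<xi> l w)"
      using g norm_diff_ineq[of "\<Sum>l\<in>{a..<k}. \<xi> l w" "\<Sum>l\<in>{k..<b}. \<xi> l w"] by simp
  next
    fix k assume k: "k \<in> {a..b}"
    have "prob {w \<in> space M. norm (\<Sum>l\<in>{k..<b}. \<xi> l w) \<le> c} = 1 - prob {w \<in> space M. c < norm (\<Sum>l\<in>{k..<b}. \<xi> l w)}"
      by (subst prob_compl[symmetric]) (auto intro!: arg_cong[where f=prob])
    then show "2 / 3 \<le> prob {w \<in> space M. norm (\<Sum>l\<in>{k..<b}. \<xi> l w) \<le> c}" using small[OF k] by simp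
  qed (auto)
  also have "\<dots> \<le> 1 / 3" using small[of a] \<open>a \<le> b\<close> by simp
  finally show ?thesis by simp
qed

text \<open>Each oscillation costs a factor 1/2: a block sum above \<open>4 * c\<close> is a
  difference of two sums from \<open>a\<close>, one of which exceeds \<open>2 * c\<close>, and
  Ottaviani's inequality bounds that. When the first block is completed, the count restarts
  independently of the past.\<close>

lemma prob_osc_le:
  fixes \<xi> :: "nat \<Rightarrow> 'a \<Rightarrow> 'b::euclidean_space"
  assumes ind: "indep_vars (\<lambda>_. borel) \<xi> UNIV"
    and small: "\<And>i j. a0 \<le> i \<Longrightarrow> i \<le> j \<Longrightarrow> j \<le> b \<Longrightarrow> prob {w \<in> space M. c < norm (\<Sum>l\<in>{i..<j}. \<xi> l w)} \<le> 1 / 3"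
    and a: "a0 \<le> a" "a \<le> b"
  shows "prob {w \<in> space M. osc (4 * c) p (\<lambda>l. \<xi> l w) a b} \<le> (1 / 2) ^ p"
  using a
proof (induction p arbitrary: a)
  case 0
  then show ?case by simp
next
  case (Suc p)
  have [measurable]: "\<xi> l \<in> borel_measurable M" for l using ind by (simp add: indep_vars_def)
  have mosc: "Measurable.pred M (\<lambda>w. osc c p (\<lambda>l. \<xi> l w) a b)" for c p a b
  proof -
    have "(\<lambda>w. restrict (\<lambda>l. \<xi> l w) UNIV) \<in> measurable M (PiM UNIV (\<lambda>_. borel))" by measurable
    from measurable_compose[OF this osc_measurable[of a UNIV c p b]] show ?thesis
      by (simp add: restrict_def)
  qed
  define A where "A k x \<longleftrightarrow> (\<exists>i\<in>{a..<k}. 4 * c < norm (sum x {i..<k} :: 'b))" for k x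
  have "prob {w \<in> space M. osc (4 * c) (Suc p) (\<lambda>l. \<xi> l w) a b} \<le>
      (1 / 2) ^ p * prob {w \<in> space M. \<exists>k\<in>{a..b}. A k (\<lambda>l. \<xi> l w)}"
  proof (rule first_passage(2)[OF ind, where R="\<lambda>_. True" and Q="\<lambda>k x. osc (4 * c) p x k b"])
    fix k K :: nat assume k: "k \<le> K"
    show "Measurable.pred (PiM {..<K} (\<lambda>_. borel)) (A k)"
      unfolding A_def
    proof (intro pred_intros_finite)
      fix i assume "i \<in> {a..<k}"
      then have "{i..<k} \<subseteq> {..<K}" using k by auto
      note [measurable] = sum_component_measurable[OF this, where 'a='b]
      show "Measurable.pred (PiM {..<K} (\<lambda>_. borel)) (\<lambda>x. 4 * c < norm (sum x {i..<k} :: 'b))" by measurable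
    qed simp
    show "A k (restrict f {..<K}) = A k f" for f
    proof -
      have "sum (restrict f {..<K}) {i..<k} = sum f {i..<k}" for i
        using k by (intro sum.cong) auto
      then show ?thesis by (simp add: A_def)
    qed
  next
    fix k
    show "Measurable.pred (PiM {k..} (\<lambda>_. borel)) (\<lambda>x. osc (4 * c) p (x :: nat \<Rightarrow> 'b) k b)"
      by (rule osc_measurable) simp
    show "osc (4 * c) p (restrict f {k..}) k b = osc (4 * c) p (f :: nat \<Rightarrow> 'b) k b" for f
      by (rule osc_cong) auto
  next
    fix w assume "osc (4 * c) (Suc p) (\<lambda>l. \<xi> l w) a b"
    then obtain i j where ij: "j \<le> b" "a \<le> i" "i < j" "4 * c < norm (\<Sum>l\<in>{i..<j}. \<xi> l w)" "osc (4 * c) p (\<lambda>l. \<xi> l w) j b"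
      by auto
    let ?P = "\<lambda>k. a \<le> k \<and> A k (\<lambda>l. \<xi> l w)"
    have Pj: "?P j" using ij by (auto simp: A_def)
    \<comment> \<open>The first completion may precede the end \<open>j\<close> of the given block;
      the oscillations after \<open>j\<close> still count as oscillations after
      \<open>k\<close>.\<close>
    define k where "k = (LEAST k. ?P k)"
    have k: "?P k" "k \<le> j" unfolding k_def using LeastI[of ?P j] Least_le[of ?P j] Pj by auto
    have "\<not> A i (\<lambda>l. \<xi> l w)" if "i \<in> {a..<k}" for i
      using not_less_Least[of i ?P] that unfolding k_def[symmetric] by auto
    then show "\<exists>k\<in>{a..b}. A k (\<lambda>l. \<xi> l w) \<and> (\<forall>i\<in>{a..<k}. \<not> A i (\<lambda>l. \<xi> l w)) \<and> osc (4 * c) p (\<lambda>l. \<xi> l w) k b"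
      using k ij osc_antimono[OF ij(5) k(2)] by (intro bexI[of _ k]) auto
  next
    show "Measurable.pred M (\<lambda>w. osc (4 * c) (Suc p) (\<lambda>l. \<xi> l w) a b)" by (rule mosc)
    show "prob {w \<in> space M. osc (4 * c) p (\<lambda>l. \<xi> l w) k b} \<le> (1 / 2) ^ p" if "k \<in> {a..b}" for k
      using that Suc.prems by (intro Suc.IH) auto
  qed auto
  also have "prob {w \<in> space M. \<exists>k\<in>{a..b}. A k (\<lambda>l. \<xi> l w)} \<le>
      prob {w \<in> space M. \<exists>k\<in>{a..b}. 2 * c < norm (\<Sum>l\<in>{a..<k}. \<xi> l w)}"
  proof (rule finite_measure_mono)
    show "{w \<in> space M. \<exists>k\<in>{a..b}. A k (\<lambda>l. \<xi> l w)} \<subseteq> {w \<in> space M. \<exists>k\<in>{a..b}. 2 * c < norm (\<Sum>l\<in>{a..<k}. \<xi> l w)}"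
    proof safe
      fix w k assume k: "k \<in> {a..b}" "A k (\<lambda>l. \<xi> l w)"
      then obtain i where i: "i \<in> {a..<k}" "4 * c < norm (\<Sum>l\<in>{i..<k}. \<xi> l w)" by (auto simp: A_def)
      have "(\<Sum>l\<in>{i..<k}. \<xi> l w) = (\<Sum>l\<in>{a..<k}. \<xi> l w) - (\<Sum>l\<in>{a..<i}. \<xi> l w)"
        using i sum.atLeastLessThan_concat[of a i k "\<lambda>l. \<xi> l w"] by (simp add: algebra_simps)
      then have "4 * c < norm (\<Sum>l\<in>{a..<k}. \<xi> l w) + norm (\<Sum>l\<in>{a..<i}. \<xi> l w)"
        using i norm_triangle_ineq4[of "\<Sum>l\<in>{a..<k}. \<xi> l w" "\<Sum>l\<in>{a..<i}. \<xi> l w"] by simp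
      then have "2 * c < norm (\<Sum>l\<in>{a..<k}. \<xi> l w) \<or> 2 * c < norm (\<Sum>l\<in>{a..<i}. \<xi> l w)" by linarith
      moreover have "i \<in> {a..b}" using i k by auto
      ultimately show "\<exists>k\<in>{a..b}. 2 * c < norm (\<Sum>l\<in>{a..<k}. \<xi> l w)" using k by blast
    qed
  qed measurable
  also have "\<dots> \<le> 1 / 2"
    using Suc.prems by (intro ottaviani[OF ind] small) auto
  finally show ?case by simp
qed

end

section \<open>Regularization along the dyadic rationals\<close>

definition dyadic_grid :: "nat \<Rightarrow> real set" where
  "dyadic_grid m = range (\<lambda>k::nat. real k / 2 ^ m)"

lemma dyadic_grid_mono:
  assumes "m \<le> n"
  shows "dyadic_grid m \<subseteq> dyadic_grid n"
proof
  fix q assume "q \<in> dyadic_grid m"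
  then obtain k where "q = real k / 2 ^ m" by (auto simp: dyadic_grid_def)
  then have "q = real (k * 2 ^ (n - m)) / 2 ^ n"
    using assms power_add[of "2 :: real" m "n - m"] by (simp add: field_simps)
  then show "q \<in> dyadic_grid n" unfolding dyadic_grid_def by blast
qed

lemma dyadic_grid_dense:
  assumes "0 \<le> a" "a < b"
  obtains q m where "q \<in> dyadic_grid m" "a < q" "q < b"
proof -
  obtain m :: nat where "1 / (b - a) < 2 ^ m"
    using real_arch_pow[of 2 "1 / (b - a)"] by auto
  then have m: "1 < (b - a) * 2 ^ m" using assms by (simp add: field_simps)
  let ?k = "Suc (nat \<lfloor>a * 2 ^ m\<rfloor>)"
  have k: "real ?k = of_int \<lfloor>a * 2 ^ m\<rfloor> + 1" using assms by simp
  have "1 + a * 2 ^ m < b * 2 ^ m" using m by (simp add: algebra_simps)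
  then have "a * 2 ^ m < real ?k" "real ?k < b * 2 ^ m"
    unfolding k using floor_correct[of "a * 2 ^ m"] by linarith+
  then show ?thesis
    by (intro that[of "real ?k / 2 ^ m" m])
      (auto simp: dyadic_grid_def pos_less_divide_eq pos_divide_less_eq simp del: of_nat_Suc)
qed

text \<open>Counterpart of \<open>osc\<close> for paths, at times from \<open>G\<close>. A count
  involves finitely many times, so for nested grids it is already seen at one level.\<close>

primrec path_osc :: "real set \<Rightarrow> real \<Rightarrow> nat \<Rightarrow> (real \<Rightarrow> 'a::metric_space) \<Rightarrow> real \<Rightarrow> real \<Rightarrow> bool" where
  "path_osc G c 0 X a b = True"
| "path_osc G c (Suc p) X a b =
    (\<exists>q\<in>G. \<exists>q'\<in>G. a \<le> q \<and> q < q' \<and> q' \<le> b \<and> c < dist (X q) (X q') \<and> path_osc G c p X q' b)"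

lemma path_osc_mono:
  "path_osc G c p X a b \<Longrightarrow> G \<subseteq> G' \<Longrightarrow> a' \<le> a \<Longrightarrow> b \<le> b' \<Longrightarrow> path_osc G' c p X a' b'"
proof (induction p arbitrary: a a')
  case (Suc p)
  then obtain q q' where "q \<in> G" "q' \<in> G" "a \<le> q" "q < q'" "q' \<le> b" "c < dist (X q) (X q')" "path_osc G c p X q' b"
    by auto
  with Suc.IH[of q' q'] Suc.prems show ?case
    unfolding path_osc.simps by (intro bexI[of _ q] bexI[of _ q'] conjI) auto
qed simp

lemma path_osc_Union_chain:
  assumes mono: "\<And>m n. m \<le> n \<Longrightarrow> G m \<subseteq> G (n :: nat)"
  shows "path_osc (\<Union>m. G m) c p X a b \<Longrightarrow> \<exists>m. path_osc (G m) c p X a b"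
proof (induction p arbitrary: a)
  case (Suc p)
  then obtain q q' m1 m2 where q: "q \<in> G m1" "q' \<in> G m2" "a \<le> q" "q < q'" "q' \<le> b" "c < dist (X q) (X q')"
    and "path_osc (\<Union>m. G m) c p X q' b" by auto
  then obtain m3 where m3: "path_osc (G m3) c p X q' b" using Suc.IH by blast
  let ?m = "max m1 (max m2 m3)"
  have "m1 \<le> ?m" "m2 \<le> ?m" by simp_all
  then have "q \<in> G ?m" "q' \<in> G ?m" using q mono by blast+
  moreover have "path_osc (G ?m) c p X q' b"
    by (rule path_osc_mono[OF m3 mono]) auto
  ultimately show ?case using q unfolding path_osc.simps by blast
qed simp

section \<open>One-sided limits along the dyadic rationals\<close>

lemma one_sided_limit:
  fixes X :: "real \<Rightarrow> 'a::complete_space"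
  assumes s: "\<And>n. s n \<in> S" "s \<longlonglongrightarrow> t"
    and cauchy: "\<And>e. 0 < e \<Longrightarrow> \<exists>d>0. \<forall>q\<in>S. \<forall>q'\<in>S. \<bar>q - t\<bar> < d \<longrightarrow> \<bar>q' - t\<bar> < d \<longrightarrow> dist (X q) (X q') \<le> e"
  shows "\<exists>l. \<forall>e>0. \<exists>d>0. \<forall>q\<in>S. \<bar>q - t\<bar> < d \<longrightarrow> dist (X q) l \<le> e"
proof -
  have near: "\<exists>N. \<forall>n\<ge>N. \<bar>s n - t\<bar> < d" if "d > 0" for d
    using LIMSEQ_D[OF s(2) that] by simp
  have "Cauchy (\<lambda>n. X (s n))"
  proof (rule metric_CauchyI)
    fix e :: real assume "0 < e"
    then obtain d where d: "d > 0" "\<forall>q\<in>S. \<forall>q'\<in>S. \<bar>q - t\<bar> < d \<longrightarrow> \<bar>q' - t\<bar> < d \<longrightarrow> dist (X q) (X q') \<le> e / 2"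
      using cauchy[of "e / 2"] by auto
    obtain N where "\<forall>n\<ge>N. \<bar>s n - t\<bar> < d" using near[OF d(1)] by blast
    then have "\<forall>m\<ge>N. \<forall>n\<ge>N. dist (X (s m)) (X (s n)) \<le> e / 2" using d(2) s(1) by auto
    then show "\<exists>N. \<forall>m\<ge>N. \<forall>n\<ge>N. dist (X (s m)) (X (s n)) < e" using \<open>0 < e\<close> by force
  qed
  then obtain l where l: "(\<lambda>n. X (s n)) \<longlonglongrightarrow> l" using Cauchy_convergent convergent_def by blast
  show ?thesis
  proof (intro exI[of _ l] allI impI)
    fix e :: real assume "0 < e"
    then obtain d where d: "d > 0" "\<forall>q\<in>S. \<forall>q'\<in>S. \<bar>q - t\<bar> < d \<longrightarrow> \<bar>q' - t\<bar> < d \<longrightarrow> dist (X q) (X q') \<le> e"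
      using cauchy[of e] by auto
    have "dist (X q) l \<le> e" if q: "q \<in> S" "\<bar>q - t\<bar> < d" for q
    proof (rule LIMSEQ_le_const2)
      show "(\<lambda>n. dist (X q) (X (s n))) \<longlonglongrightarrow> dist (X q) l" by (intro tendsto_intros l)
      obtain N where "\<forall>n\<ge>N. \<bar>s n - t\<bar> < d" using near[OF d(1)] by blast
      then show "\<exists>N. \<forall>n\<ge>N. dist (X q) (X (s n)) \<le> e"
        using d(2) q s(1) by (intro exI[of _ N]) auto
    qed
    then show "\<exists>d>0. \<forall>q\<in>S. \<bar>q - t\<bar> < d \<longrightarrow> dist (X q) l \<le> e" using d(1) by auto
  qed
qed

lemma far_pair:
  fixes X :: "real \<Rightarrow> 'a::metric_space"
  assumes "\<not> (\<exists>d>0. \<forall>q\<in>S. \<forall>q'\<in>S. \<bar>q - t\<bar> < d \<longrightarrow> \<bar>q' - t\<bar> < d \<longrightarrow> dist (X q) (X q') \<le> e)" and "0 < d" "0 < e"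
  shows "\<exists>q\<in>S. \<exists>q'\<in>S. q < q' \<and> \<bar>q - t\<bar> < d \<and> \<bar>q' - t\<bar> < d \<and> e < dist (X q) (X q')"
proof -
  have "\<not> (\<forall>q\<in>S. \<forall>q'\<in>S. \<bar>q - t\<bar> < d \<longrightarrow> \<bar>q' - t\<bar> < d \<longrightarrow> dist (X q) (X q') \<le> e)"
    using assms by blast
  then obtain q q' where q: "q \<in> S" "q' \<in> S" "\<bar>q - t\<bar> < d" "\<bar>q' - t\<bar> < d" "e < dist (X q) (X q')"
    by (auto simp: not_le)
  then have "q \<noteq> q'" using \<open>0 < e\<close> by auto
  then consider "q < q'" | "q' < q" by linarith
  then show ?thesis using q dist_commute[of "X q" "X q'"] by cases (metis, metis)
qed

text \<open>If the Cauchy condition fails to the right of t, distant pairs of values occur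
  arbitrarily close to t, hence arbitrarily many oscillations.\<close>

lemma right_limit_exists:
  fixes X :: "real \<Rightarrow> 'a::complete_space"
  defines "G \<equiv> \<Union>m. dyadic_grid m"
  assumes t: "0 \<le> t" and R: "\<And>e. 0 < e \<Longrightarrow> \<exists>b>t. \<exists>p. \<not> path_osc G e p X t b"
  shows "\<exists>l. \<forall>e>0. \<exists>d>0. \<forall>q\<in>G. t < q \<longrightarrow> q < t + d \<longrightarrow> dist (X q) l \<le> e"
proof -
  have "\<exists>q. q \<in> G \<inter> {t<..} \<and> q < t + 1 / real (Suc n)" for n
  proof -
    have "t < t + 1 / real (Suc n)" by simp
    from dyadic_grid_dense[OF t this] obtain q m
      where "q \<in> dyadic_grid m" "t < q" "q < t + 1 / real (Suc n)" .
    then show ?thesis unfolding G_def by (intro exI[of _ q]) auto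
  qed
  then obtain s where s: "\<And>n. s n \<in> G \<inter> {t<..}" "\<And>n. s n < t + 1 / real (Suc n)" by metis
  have "(\<lambda>n. t + 1 / real (Suc n)) \<longlonglongrightarrow> t + 0"
    by (rule tendsto_add[OF tendsto_const LIMSEQ_Suc[OF lim_const_over_n]])
  moreover have "t \<le> s n" for n using s(1)[of n] by simp
  then have "\<forall>\<^sub>F n in sequentially. t \<le> s n" by (intro always_eventually allI)
  moreover have "\<forall>\<^sub>F n in sequentially. s n \<le> t + 1 / real (Suc n)"
    by (intro always_eventually allI less_imp_le s(2))
  ultimately have st: "s \<longlonglongrightarrow> t"
    using tendsto_sandwich[OF _ _ tendsto_const[of t], of s sequentially] by simp
  have "\<exists>l. \<forall>e>0. \<exists>d>0. \<forall>q\<in>G \<inter> {t<..}. \<bar>q - t\<bar> < d \<longrightarrow> dist (X q) l \<le> e"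
  proof (rule one_sided_limit[OF s(1) st])
    fix e :: real assume e: "0 < e"
    show "\<exists>d>0. \<forall>q\<in>G \<inter> {t<..}. \<forall>q'\<in>G \<inter> {t<..}. \<bar>q - t\<bar> < d \<longrightarrow> \<bar>q' - t\<bar> < d \<longrightarrow> dist (X q) (X q') \<le> e"
    proof (rule ccontr)
      assume n: "\<not> ?thesis"
      have pair: "\<exists>q\<in>G. \<exists>q'\<in>G. t < q \<and> q < q' \<and> q' < b \<and> e < dist (X q) (X q')" if "t < b" for b
        using far_pair[OF n _ e, of "b - t"] that by fastforce
      \<comment> \<open>The pairs accumulate at t from the right, so each new pair precedes those
        found before. Keeping \<open>a\<close> strictly above t leaves room for it.\<close>
      have "\<exists>a. t < a \<and> a < b \<and> path_osc G e p X a b" if "t < b" for p b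
        using that
      proof (induction p)
        case 0
        then show ?case using dense by auto
      next
        case (Suc p)
        then obtain a where a: "t < a" "a < b" "path_osc G e p X a b" by auto
        obtain q q' where q: "q \<in> G" "q' \<in> G" "t < q" "q < q'" "q' < a" "e < dist (X q) (X q')"
          using pair[OF a(1)] by auto
        have "path_osc G e p X q' b" by (rule path_osc_mono[OF a(3)]) (use q in auto)
        then have "path_osc G e (Suc p) X q b"
          using q a unfolding path_osc.simps by (intro bexI[of _ q] bexI[of _ q']) auto
        then show ?case using q a by (intro exI[of _ q]) auto
      qed
      then have "path_osc G e p X t b" if "t < b" for p b
        using that by (meson less_imp_le order_refl path_osc_mono)
      then show False using R[OF e] by blast
    qed
  qed
  then obtain l where l: "\<forall>e>0. \<exists>d>0. \<forall>q\<in>G \<inter> {t<..}. \<bar>q - t\<bar> < d \<longrightarrow> dist (X q) l \<le> e" by blast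
  show ?thesis
  proof (intro exI[of _ l] allI impI)
    fix e :: real assume "0 < e"
    then obtain d where "d > 0" "\<forall>q\<in>G \<inter> {t<..}. \<bar>q - t\<bar> < d \<longrightarrow> dist (X q) l \<le> e" using l by blast
    then show "\<exists>d>0. \<forall>q\<in>G. t < q \<longrightarrow> q < t + d \<longrightarrow> dist (X q) l \<le> e"
      by (intro exI[of _ d]) auto
  qed
qed

text \<open>Here further pairs lie closer to t and hence later, so the recursion of
  \<open>path_osc\<close> is followed forward.\<close>

lemma left_limit_exists:
  fixes X :: "real \<Rightarrow> 'a::complete_space"
  defines "G \<equiv> \<Union>m. dyadic_grid m"
  assumes t: "0 < t" and L: "\<And>e. 0 < e \<Longrightarrow> \<exists>a<t. \<exists>p. \<not> path_osc G e p X a t"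
  shows "\<exists>l. \<forall>e>0. \<exists>d>0. \<forall>q\<in>G. t - d < q \<longrightarrow> q < t \<longrightarrow> dist (X q) l \<le> e"
proof -
  have "\<exists>q. q \<in> G \<inter> {..<t} \<and> t - 1 / real (Suc n) < q" for n
  proof -
    have "0 \<le> max 0 (t - 1 / real (Suc n))" "max 0 (t - 1 / real (Suc n)) < t" using t by simp_all
    from dyadic_grid_dense[OF this] obtain q m
      where q: "q \<in> dyadic_grid m" "max 0 (t - 1 / real (Suc n)) < q" "q < t" .
    then have "t - 1 / real (Suc n) < q" by linarith
    then show ?thesis using q unfolding G_def by (intro exI[of _ q]) auto
  qed
  then obtain s where s: "\<And>n. s n \<in> G \<inter> {..<t}" "\<And>n. t - 1 / real (Suc n) < s n" by metis
  have "(\<lambda>n. t - 1 / real (Suc n)) \<longlonglongrightarrow> t - 0"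
    by (rule tendsto_diff[OF tendsto_const LIMSEQ_Suc[OF lim_const_over_n]])
  moreover have "s n \<le> t" for n using s(1)[of n] by simp
  then have "\<forall>\<^sub>F n in sequentially. s n \<le> t" by (intro always_eventually allI)
  moreover have "\<forall>\<^sub>F n in sequentially. t - 1 / real (Suc n) \<le> s n"
    by (intro always_eventually allI less_imp_le s(2))
  ultimately have st: "s \<longlonglongrightarrow> t"
    using tendsto_sandwich[OF _ _ _ tendsto_const[of t], of "\<lambda>n. t - 1 / real (Suc n)" s sequentially] by simp
  have "\<exists>l. \<forall>e>0. \<exists>d>0. \<forall>q\<in>G \<inter> {..<t}. \<bar>q - t\<bar> < d \<longrightarrow> dist (X q) l \<le> e"
  proof (rule one_sided_limit[OF s(1) st])
    fix e :: real assume e: "0 < e"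
    show "\<exists>d>0. \<forall>q\<in>G \<inter> {..<t}. \<forall>q'\<in>G \<inter> {..<t}. \<bar>q - t\<bar> < d \<longrightarrow> \<bar>q' - t\<bar> < d \<longrightarrow> dist (X q) (X q') \<le> e"
    proof (rule ccontr)
      assume n: "\<not> ?thesis"
      have pair: "\<exists>q\<in>G. \<exists>q'\<in>G. a < q \<and> q < q' \<and> q' < t \<and> e < dist (X q) (X q')" if "a < t" for a
        using far_pair[OF n _ e, of "t - a"] that by fastforce
      have "path_osc G e p X a t" if "a < t" for p a
        using that
      proof (induction p arbitrary: a)
        case (Suc p)
        obtain q q' where q: "q \<in> G" "q' \<in> G" "a < q" "q < q'" "q' < t" "e < dist (X q) (X q')"
          using pair[OF Suc.prems] by auto
        with Suc.IH[of q'] show ?case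
          unfolding path_osc.simps by (intro bexI[of _ q] bexI[of _ q']) auto
      qed simp
      then show False using L[OF e] by blast
    qed
  qed
  then obtain l where l: "\<forall>e>0. \<exists>d>0. \<forall>q\<in>G \<inter> {..<t}. \<bar>q - t\<bar> < d \<longrightarrow> dist (X q) l \<le> e" by blast
  show ?thesis
  proof (intro exI[of _ l] allI impI)
    fix e :: real assume "0 < e"
    then obtain d where "d > 0" "\<forall>q\<in>G \<inter> {..<t}. \<bar>q - t\<bar> < d \<longrightarrow> dist (X q) l \<le> e" using l by blast
    then show "\<exists>d>0. \<forall>q\<in>G. t - d < q \<longrightarrow> q < t \<longrightarrow> dist (X q) l \<le> e"
      by (intro exI[of _ d]) auto
  qed
qed

text \<open>\<open>Z t\<close> is the limit of \<open>X\<close> along dyadic times strictly above t,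
  and may differ from \<open>X t\<close> when t is dyadic. The level of the cells may depend on
  \<open>e\<close>.\<close>

lemma cadlag_regularization:
  fixes X :: "real \<Rightarrow> 'a::euclidean_space"
  defines "G \<equiv> \<Union>m. dyadic_grid m"
  assumes osc: "\<And>e. 0 < e \<Longrightarrow> \<exists>m. \<forall>k::nat. \<exists>p. \<not> path_osc G e p X (real k / 2 ^ m) (real (Suc k) / 2 ^ m)"
  shows "\<exists>Z. cadlag Z \<and> (\<forall>t q. 0 \<le> t \<longrightarrow> (\<forall>n::nat. q n \<in> G \<and> t < q n) \<longrightarrow> q \<longlonglongrightarrow> t \<longrightarrow> (\<lambda>n. X (q n)) \<longlonglongrightarrow> Z t)"
proof -
  have "\<exists>l. \<forall>e>0. \<exists>d>0. \<forall>q\<in>G. t < q \<longrightarrow> q < t + d \<longrightarrow> dist (X q) l \<le> e" if t: "0 \<le> t" for t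
    unfolding G_def
  proof (rule right_limit_exists[OF t])
    fix e :: real assume "0 < e"
    then obtain m where m: "\<forall>k::nat. \<exists>p. \<not> path_osc G e p X (real k / 2 ^ m) (real (Suc k) / 2 ^ m)" using osc by blast
    let ?k = "nat \<lfloor>t * 2 ^ m\<rfloor>"
    have k: "real ?k = of_int \<lfloor>t * 2 ^ m\<rfloor>" using t by simp
    have k1: "real ?k / 2 ^ m \<le> t" "t < real (Suc ?k) / 2 ^ m"
      using floor_correct[of "t * 2 ^ m"] unfolding of_nat_Suc k by (simp_all add: field_simps)
    obtain p where "\<not> path_osc G e p X (real ?k / 2 ^ m) (real (Suc ?k) / 2 ^ m)" using m by blast
    then have "\<not> path_osc G e p X t (real (Suc ?k) / 2 ^ m)"
      using path_osc_mono[OF _ order_refl k1(1) order_refl] by blast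
    then show "\<exists>b>t. \<exists>p. \<not> path_osc (\<Union>m. dyadic_grid m) e p X t b" using k1(2) unfolding G_def by blast
  qed
  then obtain Z where Z: "\<And>t e. 0 \<le> t \<Longrightarrow> 0 < e \<Longrightarrow> \<exists>d>0. \<forall>q\<in>G. t < q \<longrightarrow> q < t + d \<longrightarrow> dist (X q) (Z t) \<le> e"
    by metis
  have left: "\<exists>l. \<forall>e>0. \<exists>d>0. \<forall>q\<in>G. t - d < q \<longrightarrow> q < t \<longrightarrow> dist (X q) l \<le> e" if t: "0 < t" for t
    unfolding G_def
  proof (rule left_limit_exists[OF t])
    fix e :: real assume "0 < e"
    then obtain m where m: "\<forall>k::nat. \<exists>p. \<not> path_osc G e p X (real k / 2 ^ m) (real (Suc k) / 2 ^ m)" using osc by blast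
    \<comment> \<open>The left end of the cell must lie strictly below t: hence the ceiling minus
      one, where the right limit used the floor.\<close>
    let ?k = "nat (\<lceil>t * 2 ^ m\<rceil> - 1)"
    have "0 < \<lceil>t * 2 ^ m\<rceil>" using t by simp
    then have k: "real ?k = of_int \<lceil>t * 2 ^ m\<rceil> - 1" by simp
    have k1: "real ?k / 2 ^ m < t" "t \<le> real (Suc ?k) / 2 ^ m"
      using ceiling_correct[of "t * 2 ^ m"] unfolding of_nat_Suc k by (simp_all add: field_simps)
    obtain p where "\<not> path_osc G e p X (real ?k / 2 ^ m) (real (Suc ?k) / 2 ^ m)" using m by blast
    then have "\<not> path_osc G e p X (real ?k / 2 ^ m) t"
      using path_osc_mono[OF _ order_refl order_refl k1(2)] by blast
    then show "\<exists>a<t. \<exists>p. \<not> path_osc (\<Union>m. dyadic_grid m) e p X a t" using k1(1) unfolding G_def by blast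
  qed
  \<comment> \<open>A bound on \<open>X\<close> at dyadic times just after s passes to
    \<open>Z s\<close> with twice the error; used with \<open>e / 3\<close> it gives a strict
    inequality.\<close>
  have close: "dist (Z s) y \<le> 2 * e" if "0 < e" "0 \<le> s" "s < b" and y: "\<And>q. q \<in> G \<Longrightarrow> s < q \<Longrightarrow> q < b \<Longrightarrow> dist (X q) y \<le> e"
    for s b y e
  proof -
    obtain d where d: "d > 0" "\<forall>q\<in>G. s < q \<longrightarrow> q < s + d \<longrightarrow> dist (X q) (Z s) \<le> e" using Z[OF \<open>0 \<le> s\<close> \<open>0 < e\<close>] by blast
    have "s < min b (s + d)" using that d(1) by simp
    from dyadic_grid_dense[OF \<open>0 \<le> s\<close> this] obtain q m
      where q: "q \<in> dyadic_grid m" "s < q" "q < min b (s + d)" .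
    then have "dist (X q) (Z s) \<le> e" "dist (X q) y \<le> e" using d(2) y by (auto simp: G_def)
    then show ?thesis using dist_triangle[of "Z s" y "X q"] by (simp add: dist_commute)
  qed
  have "cadlag Z"
    unfolding cadlag_def
  proof (intro conjI allI impI)
    fix t :: real assume t: "0 \<le> t"
    have "(Z \<longlongrightarrow> Z t) (at_right t)"
    proof (rule tendstoI)
      fix e :: real assume "0 < e"
      then obtain d where d: "d > 0" "\<forall>q\<in>G. t < q \<longrightarrow> q < t + d \<longrightarrow> dist (X q) (Z t) \<le> e / 3"
        using Z[OF t, of "e / 3"] by auto
      have "dist (Z s) (Z t) < e" if "t < s" "s < t + d" for s
        using close[of "e / 3" s "t + d" "Z t"] d t that \<open>0 < e\<close> by force
      then show "\<forall>\<^sub>F s in at_right t. dist (Z s) (Z t) < e"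
        using d(1) by (auto simp: eventually_at_right_field intro!: exI[of _ "t + d"])
    qed
    then show "continuous (at_right t) Z" by (simp add: continuous_within)
  next
    fix t :: real assume t: "0 < t"
    obtain l where l: "\<forall>e>0. \<exists>d>0. \<forall>q\<in>G. t - d < q \<longrightarrow> q < t \<longrightarrow> dist (X q) l \<le> e" using left[OF t] by blast
    have "(Z \<longlongrightarrow> l) (at_left t)"
    proof (rule tendstoI)
      fix e :: real assume "0 < e"
      then obtain d where d: "d > 0" "\<forall>q\<in>G. t - d < q \<longrightarrow> q < t \<longrightarrow> dist (X q) l \<le> e / 3"
        using l[rule_format, of "e / 3"] by auto
      have "dist (Z s) l < e" if "max 0 (t - d) < s" "s < t" for s
        using close[of "e / 3" s t l] d t that \<open>0 < e\<close> by force
      then show "\<forall>\<^sub>F s in at_left t. dist (Z s) l < e"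
        using d(1) t by (auto simp: eventually_at_left_field intro!: exI[of _ "max 0 (t - d)"])
    qed
    then show "\<exists>l. (Z \<longlongrightarrow> l) (at_left t)" by blast
  qed
  moreover have "(\<lambda>n. X (q n)) \<longlonglongrightarrow> Z t" if t: "0 \<le> t" and q: "\<forall>n::nat. q n \<in> G \<and> t < q n" "q \<longlonglongrightarrow> t" for t q
  proof (rule metric_LIMSEQ_I)
    fix e :: real assume "0 < e"
    then obtain d where d: "d > 0" "\<forall>q\<in>G. t < q \<longrightarrow> q < t + d \<longrightarrow> dist (X q) (Z t) \<le> e / 2"
      using Z[OF t, of "e / 2"] by auto
    obtain N where N: "\<And>n. n \<ge> N \<Longrightarrow> \<bar>q n - t\<bar> < d" using LIMSEQ_D[OF q(2) d(1)] by auto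
    have "q n < t + d" if "n \<ge> N" for n using N[OF that] by linarith
    then have "\<forall>n\<ge>N. dist (X (q n)) (Z t) \<le> e / 2" using d(2) q(1) by auto
    then show "\<exists>N. \<forall>n\<ge>N. dist (X (q n)) (Z t) < e" using \<open>0 < e\<close> by force
  qed
  ultimately show ?thesis by blast
qed

section \<open>Levy processes from convolution semigroups\<close>

locale dyadic_semigroup =
  fixes \<rho> :: "real \<Rightarrow> 'a::euclidean_space measure" and \<Psi> :: "'a \<Rightarrow> complex"
  assumes prob_rho: "0 < t \<Longrightarrow> prob_space (\<rho> t)"
    and sets_rho: "0 < t \<Longrightarrow> sets (\<rho> t) = sets borel"
    and mchar_rho: "0 < t \<Longrightarrow> mchar (\<rho> t) u = exp (of_real t * \<Psi> u)"
begin

text \<open>Law of the independent increments over all consecutive intervals of length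
  \<open>1 / 2 ^ m\<close>; \<open>coarsen\<close> adds neighbours and so passes to the next coarser
  level.\<close>

definition Q :: "nat \<Rightarrow> (nat \<Rightarrow> 'a) measure" where
  "Q m = PiM UNIV (\<lambda>_. \<rho> (1 / 2 ^ m))"

definition coarsen :: "(nat \<Rightarrow> 'a) \<Rightarrow> nat \<Rightarrow> 'a" where
  "coarsen x k = x (2 * k) + x (2 * k + 1)"

lemma prob_Q: "prob_space (Q m)"
  unfolding Q_def by (intro prob_space_PiM prob_rho) simp

lemma sets_Q[measurable_cong]: "sets (Q m) = sets (PiM UNIV (\<lambda>_. borel))"
  unfolding Q_def by (intro sets_PiM_cong refl sets_rho) simp

lemma measurable_coarsen[measurable]:
  "coarsen \<in> measurable (PiM UNIV (\<lambda>_. borel)) (PiM UNIV (\<lambda>_. borel))"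
proof -
  have "(\<lambda>x. coarsen x k) \<in> borel_measurable (PiM UNIV (\<lambda>_. borel))" for k
    unfolding coarsen_def by measurable
  then show ?thesis by (intro measurable_PiM_single') auto
qed

lemma distr_Q_component: "distr (Q m) borel (\<lambda>x. x k) = \<rho> (1 / 2 ^ m)"
proof -
  interpret product_prob_space "\<lambda>_::nat. \<rho> (1 / 2 ^ m)" UNIV
    by (rule product_prob_spaceI) (simp add: prob_rho)
  have "distr (Q m) borel (\<lambda>x. x k) = distr (Q m) (\<rho> (1 / 2 ^ m)) (\<lambda>x. x k)"
    by (intro distr_cong) (simp_all add: sets_rho)
  also have "\<dots> = \<rho> (1 / 2 ^ m)" unfolding Q_def by (rule PiM_component) simp
  finally show ?thesis .
qed

lemma indep_vars_Q: "prob_space.indep_vars (Q m) (\<lambda>_. borel) (\<lambda>k x. x k) UNIV"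
proof -
  interpret prob_space "Q m" by (rule prob_Q)
  have "distr (Q m) (PiM UNIV (\<lambda>_. borel)) (\<lambda>x. \<lambda>k\<in>UNIV. x k) = distr (Q m) (Q m) (\<lambda>x. x)"
    by (intro distr_cong) (simp_all add: sets_Q restrict_def)
  also have "\<dots> = PiM UNIV (\<lambda>k. distr (Q m) borel (\<lambda>x. x k))"
    unfolding distr_Q_component by (simp add: Q_def)
  finally show ?thesis
    by (subst indep_vars_iff_distr_eq_PiM) (auto simp: measurable_cong_sets[OF sets_Q refl])
qed

text \<open>Sums over disjoint pairs stay independent, and the time in the exponent doubles from
  \<open>1 / 2 ^ Suc m\<close> to \<open>1 / 2 ^ m\<close>.\<close>

lemma distr_coarsen_Suc: "distr (Q (Suc m)) (PiM UNIV (\<lambda>_. borel)) coarsen = Q m"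
proof -
  interpret prob_space "Q (Suc m)" by (rule prob_Q)
  have comp[measurable]: "(\<lambda>x. x k) \<in> borel_measurable (Q (Suc m))" for k
    by (simp add: measurable_cong_sets[OF sets_Q refl])
  have c1: "(CLINT x|Q (Suc m). iexp (u \<bullet> x k)) = exp (of_real (1 / 2 ^ Suc m) * \<Psi> u)" for u k
    using arg_cong[OF distr_Q_component[of "Suc m" k], of "\<lambda>\<mu>. mchar \<mu> u"]
    by (simp add: mchar_distr mchar_rho)
  have ind: "indep_vars (\<lambda>_. borel) (\<lambda>k x. coarsen x k) UNIV"
  proof -
    have "indep_vars (\<lambda>k. PiM {2 * k, 2 * k + 1} (\<lambda>_. borel)) (\<lambda>k x. restrict (\<lambda>i. x i) {2 * k, 2 * k + 1}) UNIV"
    proof (rule indep_vars_restrict[OF indep_vars_Q])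
      show "disjoint_family_on (\<lambda>k::nat. {2 * k, 2 * k + 1}) UNIV"
        unfolding disjoint_family_on_def
      proof (intro ballI impI)
        fix m n :: nat assume "m \<noteq> n"
        then have "2 * m \<noteq> 2 * n" "2 * m \<noteq> 2 * n + 1" "2 * m + 1 \<noteq> 2 * n" "2 * m + 1 \<noteq> 2 * n + 1"
          by presburger+
        then show "{2 * m, 2 * m + 1} \<inter> {2 * n, 2 * n + 1} = {}" by simp
      qed
    qed simp
    then have "indep_vars (\<lambda>_. borel)
        (\<lambda>k x. (\<lambda>f. f (2 * k) + f (2 * k + 1)) (restrict (\<lambda>i. x i) {2 * k, 2 * k + 1})) UNIV"
      by (rule indep_vars_compose2) (intro borel_measurable_add measurable_component_singleton, auto)
    also have "(\<lambda>k x. (\<lambda>f. f (2 * k) + f (2 * k + 1)) (restrict (\<lambda>i. x i) {2 * k, 2 * k + 1})) =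
        (\<lambda>k x. coarsen x k)"
      by (simp add: coarsen_def fun_eq_iff)
    finally show ?thesis .
  qed
  have law: "distr (Q (Suc m)) borel (\<lambda>x. coarsen x k) = \<rho> (1 / 2 ^ m)" for k
  proof (rule mchar_unique)
    fix u
    have "mchar (distr (Q (Suc m)) borel (\<lambda>x. coarsen x k)) u =
      (CLINT x|Q (Suc m). iexp (\<Sum>i\<in>{2 * k, 2 * k + 1}. u \<bullet> x i))"
      unfolding coarsen_def by (subst mchar_distr) (auto simp: inner_add_right)
    also have "\<dots> = (\<Prod>i\<in>{2 * k, 2 * k + 1}. CLINT x|Q (Suc m). iexp (u \<bullet> x i))"
      by (rule char_indep_sum) (auto intro: indep_vars_subset[OF indep_vars_Q])
    also have "\<dots> = exp (of_real (1 / 2 ^ m) * \<Psi> u)"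
      unfolding c1 by (simp add: exp_add[symmetric] field_simps)
    finally show "mchar (distr (Q (Suc m)) borel (\<lambda>x. coarsen x k)) u = mchar (\<rho> (1 / 2 ^ m)) u"
      by (simp add: mchar_rho)
  qed (auto intro!: prob_space_distr prob_rho simp: sets_rho coarsen_def)
  have "distr (Q (Suc m)) (PiM UNIV (\<lambda>_. borel)) (\<lambda>x. \<lambda>k\<in>UNIV. coarsen x k) = PiM UNIV (\<lambda>k. distr (Q (Suc m)) borel (\<lambda>x. coarsen x k))"
    by (rule indep_vars_iff_distr_eq_PiM[THEN iffD1, OF _ _ ind]) (auto simp: coarsen_def)
  then show ?thesis unfolding law by (simp add: Q_def restrict_def)
qed

lemma measurable_coarsen_pow[measurable]:
  "(coarsen ^^ j) \<in> measurable (PiM UNIV (\<lambda>_. borel)) (PiM UNIV (\<lambda>_. borel))"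
  by (induction j) (auto intro: measurable_comp measurable_coarsen)

lemma distr_coarsen_pow: "distr (Q (m + j)) (PiM UNIV (\<lambda>_. borel)) (coarsen ^^ j) = Q m"
proof (induction j)
  case 0
  have "distr (Q m) (PiM UNIV (\<lambda>_. borel)) (\<lambda>x. x) = Q m" by (rule distr_id2) (simp add: sets_Q)
  then show ?case by (simp add: id_def)
next
  case (Suc j)
  have "distr (Q (m + Suc j)) (PiM UNIV (\<lambda>_. borel)) (coarsen ^^ Suc j) =
    distr (distr (Q (Suc (m + j))) (PiM UNIV (\<lambda>_. borel)) coarsen) (PiM UNIV (\<lambda>_. borel)) (coarsen ^^ j)"
    by (subst distr_distr) (auto simp: funpow_Suc_right simp del: funpow.simps cong: measurable_cong_sets)
  then show ?case by (simp only: distr_coarsen_Suc Suc)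
qed

section \<open>Consistent joint laws of the refinement levels\<close>

definition level_map :: "nat set \<Rightarrow> nat \<Rightarrow> (nat \<Rightarrow> 'a) \<Rightarrow> nat \<Rightarrow> nat \<Rightarrow> 'a" where
  "level_map L m x = (\<lambda>n\<in>L. (coarsen ^^ (m - n)) x)"

text \<open>All levels in \<open>L\<close> are computed from the finest one. Inserting 0 keeps
  \<open>Max\<close> meaningful for the empty set.\<close>

definition P :: "nat set \<Rightarrow> (nat \<Rightarrow> nat \<Rightarrow> 'a) measure" where
  "P L = distr (Q (Max (insert 0 L))) (PiM L (\<lambda>_. borel)) (level_map L (Max (insert 0 L)))"

text \<open>One coordinate of the projective family is a whole level, a point of the Polish space of
  sequences. Its Borel sets agree with the product sigma-algebra that carries
  \<open>Q\<close>.\<close>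

lemma measurable_borel_fun: "measurable M (borel :: (nat \<Rightarrow> 'a) measure) = measurable M (PiM UNIV (\<lambda>_. borel))"
  by (rule measurable_cong_sets) (simp_all add: sets_PiM_equal_borel)

lemma measurable_level_map[measurable]:
  "level_map L m \<in> measurable (PiM UNIV (\<lambda>_. borel)) (PiM L (\<lambda>_. borel))"
  unfolding level_map_def[abs_def]
  by (rule measurable_restrict) (simp add: measurable_borel_fun measurable_coarsen_pow)

lemma P_eq:
  assumes "finite L" "\<And>n. n \<in> L \<Longrightarrow> n \<le> m"
  shows "P L = distr (Q m) (PiM L (\<lambda>_. borel)) (level_map L m)"
proof -
  let ?m = "Max (insert 0 L)"
  have "?m \<le> m" using assms by simp
  then have Q: "Q ?m = distr (Q m) (PiM UNIV (\<lambda>_. borel)) (coarsen ^^ (m - ?m))"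
    using distr_coarsen_pow[of ?m "m - ?m"] by simp
  have "P L = distr (Q m) (PiM L (\<lambda>_. borel)) (level_map L ?m \<circ> (coarsen ^^ (m - ?m)))"
    unfolding P_def Q
    by (rule distr_distr) (auto simp: measurable_cong_sets[OF sets_Q refl])
  also have "level_map L ?m \<circ> (coarsen ^^ (m - ?m)) = level_map L m"
  proof
    fix x
    have "(coarsen ^^ (?m - n)) ((coarsen ^^ (m - ?m)) x) = (coarsen ^^ (m - n)) x" if "n \<in> L" for n
    proof -
      have "n \<le> ?m" using assms that by simp
      then have "(?m - n) + (m - ?m) = m - n" using \<open>?m \<le> m\<close> by simp
      then show ?thesis by (metis funpow_add comp_apply)
    qed
    then show "(level_map L ?m \<circ> (coarsen ^^ (m - ?m))) x = level_map L m x"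
      by (auto simp: level_map_def)
  qed
  finally show ?thesis .
qed

lemma polish_projective_P: "polish_projective UNIV P"
  unfolding polish_projective_def projective_family_def
proof (intro conjI allI impI)
  fix I L :: "nat set" assume IL: "I \<subseteq> L" "finite L"
  let ?m = "Max (insert 0 L)"
  have le: "n \<le> ?m" if "n \<in> L" for n using that IL by simp
  have fI: "finite I" using IL finite_subset by auto
  have "distr (P L) (PiM I (\<lambda>_. borel)) (\<lambda>f. restrict f I) =
      distr (Q ?m) (PiM I (\<lambda>_. borel)) ((\<lambda>f. restrict f I) \<circ> level_map L ?m)"
    unfolding P_def using IL
    by (intro distr_distr measurable_restrict_subset) (auto simp: measurable_cong_sets[OF sets_Q refl])
  also have "(\<lambda>f. restrict f I) \<circ> level_map L ?m = level_map I ?m"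
    using IL by (auto simp: level_map_def fun_eq_iff)
  also have "distr (Q ?m) (PiM I (\<lambda>_. borel)) (level_map I ?m) = P I"
    by (rule P_eq[symmetric, OF fI]) (use le IL in auto)
  finally show "P I = distr (P L) (PiM I (\<lambda>_. borel)) (\<lambda>f. restrict f I)" ..
next
  fix L :: "nat set" assume "finite L"
  interpret prob_space "Q (Max (insert 0 L))" by (rule prob_Q)
  show "prob_space (P L)"
    unfolding P_def by (rule prob_space_distr) (simp add: measurable_cong_sets[OF sets_Q refl])
qed

text \<open>Kolmogorov extension over the refinement levels: level \<open>m\<close> carries the whole sequence of
  increments over the dyadic intervals of length \<open>2\<^sup>-\<^sup>m\<close>.\<close>

lemma dyadic_increments:
  obtains L :: "(nat \<Rightarrow> nat \<Rightarrow> 'a) measure"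
  where "prob_space L" "\<And>m. prob_space.indep_vars L (\<lambda>_. borel) (\<lambda>k w. w m k) UNIV"
    "\<And>m k. distr L borel (\<lambda>w. w m k) = \<rho> (1 / 2 ^ m)"
    "AE w in L. \<forall>m k. w m k = w (Suc m) (2 * k) + w (Suc m) (2 * k + 1)"
proof -
  interpret polish_projective UNIV P by (rule polish_projective_P)
  have c[measurable]: "(\<lambda>f. f n) \<in> measurable (PiM I (\<lambda>_. borel :: (nat \<Rightarrow> 'a) measure)) (PiM UNIV (\<lambda>_. borel))"
    if "n \<in> I" for n and I :: "nat set"
    using measurable_component_singleton[OF that, of "\<lambda>_. borel :: (nat \<Rightarrow> 'a) measure"]
    by (simp add: measurable_borel_fun)
  have cc[measurable]: "(\<lambda>f. f n k) \<in> borel_measurable (PiM I (\<lambda>_. borel :: (nat \<Rightarrow> 'a) measure))"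
    if "n \<in> I" for n k and I :: "nat set"
    by (rule measurable_compose[OF c[OF that]]) simp
  have fd: "distr lim (PiM I (\<lambda>_. borel)) (\<lambda>f. restrict f I) = P I" if I: "finite I" for I
  proof (rule measure_eqI)
    show "sets (distr lim (PiM I (\<lambda>_. borel)) (\<lambda>f. restrict f I)) = sets (P I)" using I by (simp add: sets_P)
    fix A assume "A \<in> sets (distr lim (PiM I (\<lambda>_. borel)) (\<lambda>f. restrict f I))"
    then have A: "A \<in> sets (PiM I (\<lambda>_. borel))" by simp
    have "emeasure (distr lim (PiM I (\<lambda>_. borel)) (\<lambda>f. restrict f I)) A = emeasure lim (emb UNIV I A)"
      using A by (subst emeasure_distr)
        (auto simp: prod_emb_def space_PiM measurable_cong_sets[OF sets_lim refl] intro!: measurable_restrict_subset)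
    then show "emeasure (distr lim (PiM I (\<lambda>_. borel)) (\<lambda>f. restrict f I)) A = emeasure (P I) A"
      using emeasure_lim_emb[of I A] I A by simp
  qed
  have level: "distr lim (PiM UNIV (\<lambda>_. borel)) (\<lambda>w. w m) = Q m" for m
  proof -
    have "distr lim (PiM UNIV (\<lambda>_. borel)) (\<lambda>w. w m) =
        distr (distr lim (PiM {m} (\<lambda>_. borel)) (\<lambda>f. restrict f {m})) (PiM UNIV (\<lambda>_. borel)) (\<lambda>f. f m)"
      by (subst distr_distr)
        (auto simp: comp_def measurable_cong_sets[OF sets_lim refl] intro!: measurable_restrict_subset c)
    also have "\<dots> = distr (distr (Q m) (PiM {m} (\<lambda>_. borel)) (level_map {m} m)) (PiM UNIV (\<lambda>_. borel)) (\<lambda>f. f m)"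
      using fd[of "{m}"] P_eq[of "{m}" m] by simp
    also have "\<dots> = distr (Q m) (PiM UNIV (\<lambda>_. borel)) (\<lambda>x. x)"
      by (subst distr_distr) (auto simp: comp_def level_map_def measurable_cong_sets[OF sets_Q refl] intro!: c)
    also have "\<dots> = Q m" by (rule distr_id2) (simp add: sets_Q)
    finally show ?thesis .
  qed
  have cl[measurable]: "(\<lambda>w. w m) \<in> measurable lim (PiM UNIV (\<lambda>_. borel))" for m
    by (simp add: measurable_cong_sets[OF sets_lim refl] c)
  have cl2[measurable]: "(\<lambda>w. w m k) \<in> borel_measurable lim" for m k
    by (simp add: measurable_cong_sets[OF sets_lim refl] cc)
  have comp: "distr lim borel (\<lambda>w. w m k) = \<rho> (1 / 2 ^ m)" for m k
  proof -
    have "distr lim borel (\<lambda>w. w m k) = distr (distr lim (PiM UNIV (\<lambda>_. borel)) (\<lambda>w. w m)) borel (\<lambda>x. x k)"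
      by (subst distr_distr) (auto simp: comp_def)
    then show ?thesis by (simp add: level distr_Q_component)
  qed
  show ?thesis
  proof
    show "prob_space lim" by (rule P.prob_space_axioms)
    show "P.indep_vars (\<lambda>_. borel) (\<lambda>k w. w m k) UNIV" for m
    proof (subst P.indep_vars_iff_distr_eq_PiM)
      have "distr lim (PiM UNIV (\<lambda>_. borel)) (\<lambda>w. \<lambda>k\<in>UNIV. w m k) = Q m"
        using level[of m] by (simp add: restrict_def)
      then show "distr lim (PiM UNIV (\<lambda>_. borel)) (\<lambda>w. \<lambda>k\<in>UNIV. w m k) = PiM UNIV (\<lambda>k. distr lim borel (\<lambda>w. w m k))"
        by (simp add: comp Q_def)
    qed auto
    show "distr lim borel (\<lambda>w. w m k) = \<rho> (1 / 2 ^ m)" for m k by (rule comp)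
    \<comment> \<open>The relation involves two levels only and holds identically on the image of
      \<open>level_map\<close>, hence almost surely under the finite marginal and under the
      limit.\<close>
    have "AE w in lim. w m k = w (Suc m) (2 * k) + w (Suc m) (2 * k + 1)" for m k
    proof -
      let ?I = "{m, Suc m}"
      let ?E = "\<lambda>f :: nat \<Rightarrow> nat \<Rightarrow> 'a. f m k = f (Suc m) (2 * k) + f (Suc m) (2 * k + 1)"
      have mE: "{f \<in> space (PiM ?I (\<lambda>_. borel)). ?E f} \<in> sets (PiM ?I (\<lambda>_. borel))"
      proof -
        have "{f \<in> space (PiM ?I (\<lambda>_. borel)). norm (f m k - (f (Suc m) (2 * k) + f (Suc m) (2 * k + 1))) = 0}
            \<in> sets (PiM ?I (\<lambda>_. borel :: (nat \<Rightarrow> 'a) measure))"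
          by (rule borel_measurable_eq)
            (auto intro!: borel_measurable_norm borel_measurable_diff borel_measurable_add cc)
        then show ?thesis by simp
      qed
      have PI: "P ?I = distr (Q (Suc m)) (PiM ?I (\<lambda>_. borel)) (level_map ?I (Suc m))"
        by (rule P_eq) auto
      have "AE f in P ?I. ?E f"
        unfolding PI
        by (subst AE_distr_iff[OF _ mE])
          (auto simp: level_map_def coarsen_def measurable_cong_sets[OF sets_Q refl] intro!: measurable_level_map)
      then have "AE w in lim. ?E (restrict w ?I)"
        unfolding fd[of ?I, simplified, symmetric]
        by (subst (asm) AE_distr_iff[OF _ mE])
          (auto simp: measurable_cong_sets[OF sets_lim refl] intro!: measurable_restrict_subset)
      then show ?thesis by simp
    qed
    then show "AE w in lim. \<forall>m k. w m k = w (Suc m) (2 * k) + w (Suc m) (2 * k + 1)"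
      by (simp add: AE_all_countable)
  qed
qed

end

section \<open>From increments at all levels to dyadic paths\<close>

lemma osc_refine:
  assumes "\<And>k. x k = y (2 * k) + y (2 * k + 1)"
  shows "osc c p x a b \<Longrightarrow> osc c p y (2 * a) (2 * b)"
proof (induction p arbitrary: a)
  case (Suc p)
  have s: "sum x {i..<j} = sum y {2 * i..<2 * j}" if "i \<le> j" for i j
    using that
  proof (induction j rule: dec_induct)
    case (step j)
    then show ?case using assms[of j] by (simp add: sum.atLeastLessThan_Suc add.assoc)
  qed simp
  from Suc.prems obtain i j where ij: "j \<le> b" "a \<le> i" "i < j" "c < norm (sum x {i..<j})" "osc c p x j b"
    by auto
  then show ?case
    using s[of i j] Suc.IH[of j] unfolding osc.simps
    by (intro bexI[of _ "2 * j"] bexI[of _ "2 * i"] conjI) auto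
qed simp

lemma path_osc_weaken: "path_osc G c p X a b \<Longrightarrow> c' \<le> c \<Longrightarrow> path_osc G c' p X a b"
  by (induction p arbitrary: a) force+

lemma path_osc_imp_osc:
  assumes X: "\<And>k. X (real k / 2 ^ m) = sum x {..<k}"
  shows "path_osc (dyadic_grid m) c p X (real a / 2 ^ m) (real b / 2 ^ m) \<Longrightarrow> osc c p x a b"
proof (induction p arbitrary: a)
  case (Suc p)
  then obtain i j where ij: "real a / 2 ^ m \<le> real i / 2 ^ m" "real i / 2 ^ m < real j / 2 ^ m"
      "real j / 2 ^ m \<le> real b / 2 ^ m" "c < dist (X (real i / 2 ^ m)) (X (real j / 2 ^ m))"
      "path_osc (dyadic_grid m) c p X (real j / 2 ^ m) (real b / 2 ^ m)"
    by (auto simp: dyadic_grid_def)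
  then have le: "a \<le> i" "i < j" "j \<le> b" by (simp_all add: divide_le_cancel divide_less_cancel)
  have "sum x {..<j} = sum x {..<i} + sum x {i..<j}"
    using le sum.atLeastLessThan_concat[of 0 i j x] by (simp add: atLeast0LessThan)
  then have "dist (X (real i / 2 ^ m)) (X (real j / 2 ^ m)) = norm (sum x {i..<j})"
    unfolding X by (simp add: dist_norm norm_minus_commute)
  then show ?case using ij le Suc.IH[OF ij(5)] unfolding osc.simps
    by (intro bexI[of _ j] bexI[of _ i] conjI) auto
qed simp

text \<open>A dyadic time is evaluated at the coarsest level whose grid contains it; there
  \<open>q * 2 ^ m\<close> is an integer and the floor is exact.\<close>

definition dyadic_path :: "(nat \<Rightarrow> nat \<Rightarrow> 'a::real_normed_vector) \<Rightarrow> real \<Rightarrow> 'a" where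
  "dyadic_path w q = (let m = LEAST m. q \<in> dyadic_grid m in sum (w m) {..<nat \<lfloor>q * 2 ^ m\<rfloor>})"

lemma dyadic_path_eq:
  assumes w: "\<And>m k. w m k = w (Suc m) (2 * k) + w (Suc m) (2 * k + 1)"
  shows "dyadic_path w (real k / 2 ^ m) = sum (w m) {..<k}"
proof -
  have d: "sum (w m) {..<k} = sum (w (Suc m)) {..<2 * k}" for m k
    by (induction k) (simp_all add: w[of m] add.assoc)
  have p: "sum (w m) {..<k} = sum (w (m + j)) {..<k * 2 ^ j}" for m j k
  proof (induction j)
    case (Suc j)
    then show ?case using d[of "m + j" "k * 2 ^ j"] by (simp add: mult.commute mult.left_commute)
  qed simp
  let ?q = "real k / 2 ^ m"
  define m0 where "m0 = (LEAST m. ?q \<in> dyadic_grid m)"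
  have q: "?q \<in> dyadic_grid m" by (auto simp: dyadic_grid_def)
  have "?q \<in> dyadic_grid m0" "m0 \<le> m"
    unfolding m0_def by (rule LeastI[of _ m], fact q) (rule Least_le, fact q)
  then obtain k0 where k0: "?q = real k0 / 2 ^ m0" by (auto simp: dyadic_grid_def)
  have "real k = real (k0 * 2 ^ (m - m0))"
    using k0 \<open>m0 \<le> m\<close> power_add[of "2 :: real" m0 "m - m0"] by (simp add: field_simps)
  then have k: "k = k0 * 2 ^ (m - m0)" by (simp only: of_nat_eq_iff)
  have "nat \<lfloor>?q * 2 ^ m0\<rfloor> = k0" unfolding k0 by simp
  then have "dyadic_path w ?q = sum (w m0) {..<k0}"
    unfolding dyadic_path_def m0_def[symmetric] Let_def by simp
  then show ?thesis using p[of m0 k0 "m - m0"] \<open>m0 \<le> m\<close> k by simp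
qed

text \<open>The block sums form one linear combination of the single variables, with coefficients
  \<open>v\<close> constant on blocks. The induction builds \<open>v\<close> for the exponent and
  for the product at once.\<close>

lemma (in prob_space) char_block_sums:
  fixes \<xi> :: "nat \<Rightarrow> 'a \<Rightarrow> 'b::euclidean_space"
  assumes ind: "indep_vars (\<lambda>_. borel) \<xi> UNIV" and a: "\<And>j. j < n \<Longrightarrow> a j \<le> a (Suc j)"
  shows "(CLINT w|M. iexp (\<Sum>j<n. u j \<bullet> (\<Sum>i\<in>{a j..<a (Suc j)}. \<xi> i w))) =
    (\<Prod>j<n. \<Prod>i\<in>{a j..<a (Suc j)}. CLINT w|M. iexp (u j \<bullet> \<xi> i w))"
proof -
  define g where "g i v = (CLINT w|M. iexp (v \<bullet> \<xi> i w))" for i v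
  have "a 0 \<le> a n \<and> (\<exists>v. (\<forall>w. (\<Sum>j<n. u j \<bullet> (\<Sum>i\<in>{a j..<a (Suc j)}. \<xi> i w)) = (\<Sum>i\<in>{a 0..<a n}. v i \<bullet> \<xi> i w)) \<and>
      (\<Prod>j<n. \<Prod>i\<in>{a j..<a (Suc j)}. g i (u j)) = (\<Prod>i\<in>{a 0..<a n}. g i (v i)))"
    using a
  proof (induction n)
    case (Suc n)
    then have an: "a 0 \<le> a n" "a n \<le> a (Suc n)" by auto
    from Suc obtain v where v: "\<And>w. (\<Sum>j<n. u j \<bullet> (\<Sum>i\<in>{a j..<a (Suc j)}. \<xi> i w)) = (\<Sum>i\<in>{a 0..<a n}. v i \<bullet> \<xi> i w)"
      "(\<Prod>j<n. \<Prod>i\<in>{a j..<a (Suc j)}. g i (u j)) = (\<Prod>i\<in>{a 0..<a n}. g i (v i))" by auto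
    define v' where "v' i = (if i < a n then v i else u n)" for i
    have "(\<Sum>j<Suc n. u j \<bullet> (\<Sum>i\<in>{a j..<a (Suc j)}. \<xi> i w)) = (\<Sum>i\<in>{a 0..<a (Suc n)}. v' i \<bullet> \<xi> i w)" for w
    proof -
      have "(\<Sum>i\<in>{a 0..<a (Suc n)}. v' i \<bullet> \<xi> i w) =
          (\<Sum>i\<in>{a 0..<a n}. v' i \<bullet> \<xi> i w) + (\<Sum>i\<in>{a n..<a (Suc n)}. v' i \<bullet> \<xi> i w)"
        using an by (simp add: sum.atLeastLessThan_concat)
      also have "\<dots> = (\<Sum>i\<in>{a 0..<a n}. v i \<bullet> \<xi> i w) + (\<Sum>i\<in>{a n..<a (Suc n)}. u n \<bullet> \<xi> i w)"
        by (intro arg_cong2[where f="(+)"] sum.cong) (auto simp: v'_def)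
      finally show ?thesis using v(1)[of w] by (simp add: inner_sum_right)
    qed
    moreover have "(\<Prod>j<Suc n. \<Prod>i\<in>{a j..<a (Suc j)}. g i (u j)) = (\<Prod>i\<in>{a 0..<a (Suc n)}. g i (v' i))"
    proof -
      have "(\<Prod>i\<in>{a 0..<a (Suc n)}. g i (v' i)) =
          (\<Prod>i\<in>{a 0..<a n}. g i (v' i)) * (\<Prod>i\<in>{a n..<a (Suc n)}. g i (v' i))"
        using an by (simp add: prod.atLeastLessThan_concat)
      also have "\<dots> = (\<Prod>i\<in>{a 0..<a n}. g i (v i)) * (\<Prod>i\<in>{a n..<a (Suc n)}. g i (u n))"
        by (intro arg_cong2[where f="(*)"] prod.cong) (auto simp: v'_def)
      finally show ?thesis using v(2) by simp
    qed
    ultimately show ?case using an by (intro conjI exI[of _ v']) auto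
  qed simp
  then obtain v where v: "\<And>w. (\<Sum>j<n. u j \<bullet> (\<Sum>i\<in>{a j..<a (Suc j)}. \<xi> i w)) = (\<Sum>i\<in>{a 0..<a n}. v i \<bullet> \<xi> i w)"
      "(\<Prod>j<n. \<Prod>i\<in>{a j..<a (Suc j)}. g i (u j)) = (\<Prod>i\<in>{a 0..<a n}. g i (v i))" by blast
  have "(CLINT w|M. iexp (\<Sum>i\<in>{a 0..<a n}. v i \<bullet> \<xi> i w)) = (\<Prod>i\<in>{a 0..<a n}. CLINT w|M. iexp (v i \<bullet> \<xi> i w))"
    by (rule char_indep_sum) (auto intro: indep_vars_subset[OF ind])
  then show ?thesis using v unfolding g_def by simp
qed

text \<open>The successor of the floor is strictly above t even for dyadic t, as right limits
  require.\<close>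

definition dyadic_above :: "nat \<Rightarrow> real \<Rightarrow> nat" where
  "dyadic_above n t = Suc (nat \<lfloor>t * 2 ^ n\<rfloor>)"

lemma dyadic_above:
  assumes "0 \<le> t"
  shows "real (dyadic_above n t) / 2 ^ n \<in> dyadic_grid n" "t < real (dyadic_above n t) / 2 ^ n"
    "real (dyadic_above n t) / 2 ^ n \<le> t + 1 / 2 ^ n"
    "(\<lambda>n. real (dyadic_above n t) / 2 ^ n) \<longlonglongrightarrow> t"
proof -
  have k: "real (dyadic_above n t) = of_int \<lfloor>t * 2 ^ n\<rfloor> + 1" for n
    unfolding dyadic_above_def using assms by simp
  show "real (dyadic_above n t) / 2 ^ n \<in> dyadic_grid n" for n by (auto simp: dyadic_grid_def)
  have 1: "t < real (dyadic_above n t) / 2 ^ n" for n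
    using floor_correct[of "t * 2 ^ n"] unfolding k by (simp add: pos_less_divide_eq)
  have 2: "real (dyadic_above n t) / 2 ^ n \<le> t + 1 / 2 ^ n" for n
  proof -
    have "real (dyadic_above n t) / 2 ^ n \<le> (t * 2 ^ n + 1) / 2 ^ n"
      using floor_correct[of "t * 2 ^ n"] unfolding k by (intro divide_right_mono) auto
    then show ?thesis by (simp add: add_divide_distrib)
  qed
  show "t < real (dyadic_above n t) / 2 ^ n" "real (dyadic_above n t) / 2 ^ n \<le> t + 1 / 2 ^ n" by (fact 1, fact 2)
  have "(\<lambda>n. (1 / 2 :: real) ^ n) \<longlonglongrightarrow> 0" by (rule LIMSEQ_power_zero) simp
  then have z: "(\<lambda>n. t + 1 / 2 ^ n) \<longlonglongrightarrow> t"
    using tendsto_add[OF tendsto_const, of "\<lambda>n. (1 / 2 :: real) ^ n" 0 sequentially t] by (simp add: power_divide)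
  show "(\<lambda>n. real (dyadic_above n t) / 2 ^ n) \<longlonglongrightarrow> t"
    by (rule tendsto_sandwich[OF _ _ tendsto_const z])
      (intro always_eventually allI less_imp_le 1, intro always_eventually allI 2)
qed

lemma dyadic_above_mono: "s \<le> t \<Longrightarrow> dyadic_above n s \<le> dyadic_above n t"
  unfolding dyadic_above_def by (intro Suc_le_mono[THEN iffD2] nat_mono floor_mono mult_right_mono) auto

locale dyadic_semigroup_small = dyadic_semigroup +
  assumes small: "0 < c \<Longrightarrow> \<exists>\<delta>>0. \<forall>t. 0 < t \<longrightarrow> t \<le> \<delta> \<longrightarrow> measure (\<rho> t) {x. c < norm x} \<le> 1 / 3"
begin

lemma levy_process_exists:
  obtains L :: "(nat \<Rightarrow> nat \<Rightarrow> 'a) measure" and Y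
  where "levy_process L Y" "\<And>u. mchar (distr L borel (Y 1)) u = exp (\<Psi> u)"
proof -
  obtain L :: "(nat \<Rightarrow> nat \<Rightarrow> 'a) measure" where L: "prob_space L"
    and ind: "\<And>m. prob_space.indep_vars L (\<lambda>_. borel) (\<lambda>k w. w m k) UNIV"
    and law: "\<And>m k. distr L borel (\<lambda>w. w m k) = \<rho> (1 / 2 ^ m)"
    and AEc: "AE w in L. \<forall>m k. w m k = w (Suc m) (2 * k) + w (Suc m) (2 * k + 1)"
    by (rule dyadic_increments) (rule that; simp)
  interpret prob_space L by (rule L)
  have m[measurable]: "(\<lambda>w. w m k) \<in> borel_measurable L" for m k
    using ind[of m] by (simp add: indep_vars_def)
  have c1: "(CLINT w|L. iexp (u \<bullet> w m k)) = exp (\<Psi> u / 2 ^ m)" for u m k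
    using arg_cong[OF law[of m k], of "\<lambda>\<mu>. mchar \<mu> u"] by (simp add: mchar_distr mchar_rho)
  have block_law: "distr L borel (\<lambda>w. \<Sum>l\<in>{i..<j}. w m l) = \<rho> (real (j - i) / 2 ^ m)" if "i < j" for i j m
  proof (rule mchar_unique)
    fix u
    have "mchar (distr L borel (\<lambda>w. \<Sum>l\<in>{i..<j}. w m l)) u = (CLINT w|L. iexp (\<Sum>l\<in>{i..<j}. u \<bullet> w m l))"
      by (subst mchar_distr) (auto simp: inner_sum_right)
    also have "\<dots> = (\<Prod>l\<in>{i..<j}. CLINT w|L. iexp (u \<bullet> w m l))"
      by (rule char_indep_sum) (auto intro: indep_vars_subset[OF ind])
    also have "\<dots> = exp (of_real (real (j - i) / 2 ^ m) * \<Psi> u)"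
      by (simp add: c1 exp_of_nat_mult[symmetric])
    finally show "mchar (distr L borel (\<lambda>w. \<Sum>l\<in>{i..<j}. w m l)) u = mchar (\<rho> (real (j - i) / 2 ^ m)) u"
      using that by (simp add: mchar_rho)
  qed (use that in \<open>auto intro!: prob_space_distr prob_rho simp: sets_rho\<close>)
  obtain N0 where N0: "{w \<in> space L. \<not> (\<forall>m k. w m k = w (Suc m) (2 * k) + w (Suc m) (2 * k + 1))} \<subseteq> N0"
    "N0 \<in> null_sets L"
    using AEc by (rule AE_E) (auto simp: null_sets_def)
  have cons: "w m k = w (Suc m) (2 * k) + w (Suc m) (2 * k + 1)" if "w \<in> space L - N0" for w m k
    using N0(1) that by blast
  have mosc: "Measurable.pred L (\<lambda>w. osc c p (w m) a b)" for c p m a b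
  proof -
    have "(\<lambda>w. w m) \<in> measurable L (PiM UNIV (\<lambda>_. borel))"
      by (rule measurable_PiM_single') auto
    from measurable_compose[OF this osc_measurable[of a UNIV c p b]] show ?thesis by simp
  qed
  \<comment> \<open>In each cell of level \<open>n\<close>, one bound on the number of oscillations
    serves all finer levels.\<close>
  define tame where "tame e n w \<longleftrightarrow> (\<forall>k. \<exists>p. \<forall>i. \<not> osc e p (w (n + i)) (k * 2 ^ i) (Suc k * 2 ^ i))"
    for e n and w :: "nat \<Rightarrow> nat \<Rightarrow> 'a"
  have fin_osc: "\<exists>n0. AE w in L. tame e n0 w" if e: "0 < e" for e
  proof -
    \<comment> \<open>The value \<open>e / 4\<close> is taken because \<open>prob_osc_le\<close>
      counts oscillations above \<open>4 * c\<close>.\<close>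
    obtain \<delta> where \<delta>: "\<delta> > 0" "\<And>t. 0 < t \<Longrightarrow> t \<le> \<delta> \<Longrightarrow> measure (\<rho> t) {x. e / 4 < norm x} \<le> 1 / 3"
      using small[of "e / 4"] e by auto
    \<comment> \<open>Every block inside a cell of level \<open>n0\<close> then spans a time below
      \<delta>, at any finer level.\<close>
    obtain n0 where n0: "(1 / 2) ^ n0 < \<delta>" using real_arch_pow_inv[of \<delta> "1 / 2"] \<delta>(1) by auto
    have bound: "prob {w \<in> space L. osc e p (w (n0 + i)) (k * 2 ^ i) (Suc k * 2 ^ i)} \<le> (1 / 2) ^ p" for p i k
    proof -
      have "prob {w \<in> space L. e / 4 < norm (\<Sum>l\<in>{a..<b}. w (n0 + i) l)} \<le> 1 / 3"
        if ab: "k * 2 ^ i \<le> a" "a \<le> b" "b \<le> Suc k * 2 ^ i" for a b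
      proof (cases "a = b")
        case True
        then show ?thesis using e by simp
      next
        case False
        then have lt: "a < b" using ab by simp
        have "b - a \<le> 2 ^ i" using ab by simp
        then have "real (b - a) \<le> 2 ^ i" by (metis of_nat_le_iff of_nat_numeral of_nat_power)
        then have "real (b - a) / 2 ^ (n0 + i) \<le> 2 ^ i / 2 ^ (n0 + i)" by (rule divide_right_mono) simp
        also have "\<dots> = (1 / 2) ^ n0" by (simp add: power_add power_divide)
        finally have le: "real (b - a) / 2 ^ (n0 + i) \<le> \<delta>" using n0 by simp
        have "prob {w \<in> space L. e / 4 < norm (\<Sum>l\<in>{a..<b}. w (n0 + i) l)} =
            measure (distr L borel (\<lambda>w. \<Sum>l\<in>{a..<b}. w (n0 + i) l)) {x. e / 4 < norm x}"
          by (subst measure_distr) (auto intro!: arg_cong[where f=prob])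
        also have "\<dots> \<le> 1 / 3" unfolding block_law[OF lt] using lt le by (intro \<delta>) auto
        finally show ?thesis .
      qed
      from prob_osc_le[OF ind this, where a="k * 2 ^ i" and p=p and b="Suc k * 2 ^ i"]
      show ?thesis by simp
    qed
    have "AE w in L. \<exists>p. \<forall>i. \<not> osc e p (w (n0 + i)) (k * 2 ^ i) (Suc k * 2 ^ i)" for k
    proof -
      \<comment> \<open>Off \<open>N0\<close> refinement preserves oscillations, so
        \<open>F p i\<close> increases with i. The bound \<open>(1 / 2) ^ p\<close> is uniform in i
        and survives the union; as p grows, the intersection is null.\<close>
      define F where "F p i = {w \<in> space L. osc e p (w (n0 + i)) (k * 2 ^ i) (Suc k * 2 ^ i)} - N0" for p i
      have mF: "F p i \<in> events" for p i unfolding F_def using mosc N0(2) by (intro sets.Diff) (auto simp: pred_def)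
      have inc: "F p i \<subseteq> F p (Suc i)" for p i
      proof
        fix w assume w: "w \<in> F p i"
        then have "osc e p (w (Suc (n0 + i))) (2 * (k * 2 ^ i)) (2 * (Suc k * 2 ^ i))"
          by (intro osc_refine[of "w (n0 + i)"] cons) (auto simp: F_def)
        then show "w \<in> F p (Suc i)" using w by (simp add: F_def mult.left_commute)
      qed
      have pF: "prob (F p i) \<le> (1 / 2) ^ p" for p i
        using finite_measure_mono[of "F p i" "{w \<in> space L. osc e p (w (n0 + i)) (k * 2 ^ i) (Suc k * 2 ^ i)}"]
          bound[of p i k] mosc[of e p "n0 + i" "k * 2 ^ i" "Suc k * 2 ^ i"] unfolding pred_def F_def by fastforce
      have pU: "prob (\<Union>i. F p i) \<le> (1 / 2) ^ p" for p
      proof (rule LIMSEQ_le_const2)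
        show "(\<lambda>i. prob (F p i)) \<longlonglongrightarrow> prob (\<Union>i. F p i)"
          by (rule finite_Lim_measure_incseq) (use mF inc in \<open>auto simp: incseq_Suc_iff\<close>)
      qed (use pF in auto)
      have "prob (\<Inter>p. \<Union>i. F p i) \<le> (1 / 2) ^ p" for p
      proof -
        have "prob (\<Inter>p. \<Union>i. F p i) \<le> prob (\<Union>i. F p i)"
          by (rule finite_measure_mono) (use mF in auto)
        then show ?thesis using pU[of p] by simp
      qed
      then have "prob (\<Inter>p. \<Union>i. F p i) \<le> 0"
        by (intro LIMSEQ_le_const[OF LIMSEQ_power_zero[of "1 / 2 :: real"]]) auto
      then have "(\<Inter>p. \<Union>i. F p i) \<in> null_sets L"
        using mF by (auto simp: null_sets_def emeasure_eq_measure measure_le_0_iff)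
      then have "(\<Inter>p. \<Union>i. F p i) \<union> N0 \<in> null_sets L" using N0(2) by (rule null_sets.Un)
      then show ?thesis
        by (rule AE_I') (auto simp: F_def)
    qed
    then show ?thesis by (auto simp: tame_def AE_all_countable)
  qed
  then have "\<forall>e\<in>{0<..}. \<exists>n0. AE w in L. tame e n0 w" by blast
  from bchoice[OF this] obtain n0 where n0: "\<forall>e\<in>{0<..}. AE w in L. tame e (n0 e) w" ..
  \<comment> \<open>Countably many thresholds suffice: an oscillation above \<open>e\<close> is also
    one above any smaller \<open>1 / real (Suc l)\<close>.\<close>
  have "AE w in L. \<forall>l. tame (1 / real (Suc l)) (n0 (1 / real (Suc l))) w"
    by (subst AE_all_countable, intro allI n0[rule_format]) simp
  then obtain N1 where N1: "{w \<in> space L. \<not> (\<forall>l. tame (1 / real (Suc l)) (n0 (1 / real (Suc l))) w)} \<subseteq> N1"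
    "N1 \<in> null_sets L" by (rule AE_E) (auto simp: null_sets_def)
  define G where "G = space L - (N0 \<union> N1)"
  have N01: "N0 \<union> N1 \<in> null_sets L" using N0 N1 by auto
  have [measurable]: "G \<in> sets L" using N01 by (auto simp: G_def)
  have AEG: "AE w in L. w \<in> G" using AE_not_in[OF N01] AE_space by eventually_elim (auto simp: G_def)
  have path: "dyadic_path w (real k / 2 ^ m) = sum (w m) {..<k}" if "w \<in> G" for w m k
    by (rule dyadic_path_eq[OF cons]) (use that in \<open>auto simp: G_def\<close>)
  have "\<exists>Z. cadlag Z \<and> (\<forall>t q. 0 \<le> t \<longrightarrow> (\<forall>n::nat. q n \<in> (\<Union>m. dyadic_grid m) \<and> t < q n) \<longrightarrow> q \<longlonglongrightarrow> t \<longrightarrow> (\<lambda>n. dyadic_path w (q n)) \<longlonglongrightarrow> Z t)"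
    if w: "w \<in> G" for w
  proof (rule cadlag_regularization)
    fix e :: real assume "0 < e"
    then obtain l where l: "1 / real (Suc l) < e" by (rule nat_approx_posE)
    let ?c = "1 / real (Suc l)"
    have "\<exists>p. \<not> path_osc (\<Union>m. dyadic_grid m) e p (dyadic_path w) (real k / 2 ^ n0 ?c) (real (Suc k) / 2 ^ n0 ?c)"
      (is "\<exists>p. \<not> path_osc _ _ p ?X ?a ?b") for k
    proof -
      obtain p where p: "\<And>i. \<not> osc ?c p (w (n0 ?c + i)) (k * 2 ^ i) (Suc k * 2 ^ i)"
        using N1(1) w unfolding G_def tame_def by blast
      have "\<not> path_osc (\<Union>m. dyadic_grid m) e p ?X ?a ?b"
      proof
        assume "path_osc (\<Union>m. dyadic_grid m) e p ?X ?a ?b"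
        then have "path_osc (\<Union>m. dyadic_grid m) ?c p ?X ?a ?b"
          by (rule path_osc_weaken) (use l in simp)
        then obtain m where m: "path_osc (dyadic_grid m) ?c p ?X ?a ?b"
          using path_osc_Union_chain[of dyadic_grid, OF dyadic_grid_mono] by blast
        have "path_osc (dyadic_grid (n0 ?c + m)) ?c p ?X ?a ?b"
          by (rule path_osc_mono[OF m dyadic_grid_mono]) auto
        moreover have "real j / 2 ^ a = real (j * 2 ^ m) / 2 ^ (a + m)" for j a :: nat
          by (simp add: power_add)
        ultimately have "osc ?c p (w (n0 ?c + m)) (k * 2 ^ m) (Suc k * 2 ^ m)"
          by (intro path_osc_imp_osc[OF path[OF w]]) (simp only:)
        with p show False by blast
      qed
      then show ?thesis by blast
    qed
    then show "\<exists>m. \<forall>k::nat. \<exists>p. \<not> path_osc (\<Union>m. dyadic_grid m) e p (dyadic_path w) (real k / 2 ^ m) (real (Suc k) / 2 ^ m)"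
      by blast
  qed
  then obtain Z where Z: "\<And>w. w \<in> G \<Longrightarrow> cadlag (Z w)"
    "\<And>w t q. w \<in> G \<Longrightarrow> 0 \<le> t \<Longrightarrow> (\<And>n::nat. q n \<in> (\<Union>m. dyadic_grid m)) \<Longrightarrow> (\<And>n. t < q n) \<Longrightarrow> q \<longlonglongrightarrow> t \<Longrightarrow>
      (\<lambda>n. dyadic_path w (q n)) \<longlonglongrightarrow> Z w t"
    by metis
  \<comment> \<open>Subtracting \<open>Z w 0\<close> makes each path start at 0; exceptional paths
    become zero.\<close>
  define Y where "Y t w = (if w \<in> G then Z w t - Z w 0 else 0)" for t w
  \<comment> \<open>The term at \<open>dyadic_above n 0\<close> mirrors \<open>Z w 0\<close> and
    cancels in increments, which on \<open>G\<close> are block sums at level n.\<close>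
  define T where "T n t w = indicator G w *\<^sub>R (sum (w n) {..<dyadic_above n t} - sum (w n) {..<dyadic_above n 0})" for n t w
  have mT[measurable]: "T n t \<in> borel_measurable L" for n t unfolding T_def[abs_def] by measurable
  have lim: "(\<lambda>n. T n t w) \<longlonglongrightarrow> Y t w" if t: "0 \<le> t" for t w
  proof (cases "w \<in> G")
    case True
    have "(\<lambda>n. sum (w n) {..<dyadic_above n t}) \<longlonglongrightarrow> Z w t" if "0 \<le> t" for t
      unfolding path[OF True, symmetric]
      by (rule Z(2)[OF True that]) (use dyadic_above[OF that] in auto)
    from tendsto_diff[OF this[OF t] this[OF order_refl]] show ?thesis
      using True by (simp add: T_def Y_def)
  next
    case False
    then show ?thesis by (simp add: T_def Y_def)
  qed
  have mY[measurable]: "Y t \<in> borel_measurable L" if "0 \<le> t" for t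
    by (rule borel_measurable_LIMSEQ_metric[OF mT lim[OF that]])
  have char: "(CLINT w|L. iexp (\<Sum>i<n. u i \<bullet> (Y (t (Suc i)) w - Y (t i) w))) = (\<Prod>i<n. exp (of_real (t (Suc i) - t i) * \<Psi> (u i)))"
    if t: "0 \<le> t 0" "\<And>i. i < n \<Longrightarrow> t i \<le> t (Suc i)" for n t and u :: "nat \<Rightarrow> 'a"
  proof -
    have t0: "0 \<le> t i" if "i \<le> n" for i
      by (rule nonneg_of_steps[where n=n, OF _ _ that]) (use t in auto)
    have my: "(\<lambda>w. iexp (\<Sum>i<n. u i \<bullet> (Y (t (Suc i)) w - Y (t i) w))) \<in> borel_measurable L"
    proof -
      have "(\<lambda>w. Y (t (Suc i)) w - Y (t i) w) \<in> borel_measurable L" if "i < n" for i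
        using that t0[of i] t0[of "Suc i"] by simp
      then have "(\<lambda>w. \<Sum>i<n. u i \<bullet> (Y (t (Suc i)) w - Y (t i) w)) \<in> borel_measurable L"
        by (intro borel_measurable_sum borel_measurable_inner) auto
      then show ?thesis by measurable
    qed
    have "(\<lambda>m. CLINT w|L. iexp (\<Sum>i<n. u i \<bullet> (T m (t (Suc i)) w - T m (t i) w))) \<longlonglongrightarrow>
        (CLINT w|L. iexp (\<Sum>i<n. u i \<bullet> (Y (t (Suc i)) w - Y (t i) w)))"
    proof (rule integral_dominated_convergence[where w="\<lambda>_. 1"])
      show "AE w in L. (\<lambda>m. iexp (\<Sum>i<n. u i \<bullet> (T m (t (Suc i)) w - T m (t i) w))) \<longlonglongrightarrow>
          iexp (\<Sum>i<n. u i \<bullet> (Y (t (Suc i)) w - Y (t i) w))"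
        by (intro AE_I2 tendsto_intros lim t0) auto
    qed (use my in auto)
    moreover have "(CLINT w|L. iexp (\<Sum>i<n. u i \<bullet> (T m (t (Suc i)) w - T m (t i) w))) =
        (\<Prod>i<n. exp (of_real (real (dyadic_above m (t (Suc i))) / 2 ^ m - real (dyadic_above m (t i)) / 2 ^ m) * \<Psi> (u i)))" for m
    proof -
      let ?a = "\<lambda>i. dyadic_above m (t i)"
      have a: "?a i \<le> ?a (Suc i)" if "i < n" for i using t(2)[OF that] by (rule dyadic_above_mono)
      have "(CLINT w|L. iexp (\<Sum>i<n. u i \<bullet> (T m (t (Suc i)) w - T m (t i) w))) =
          (CLINT w|L. iexp (\<Sum>i<n. u i \<bullet> (\<Sum>l\<in>{?a i..<?a (Suc i)}. w m l)))"
      proof (intro integral_cong_AE)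
        show "AE w in L. iexp (\<Sum>i<n. u i \<bullet> (T m (t (Suc i)) w - T m (t i) w)) =
          iexp (\<Sum>i<n. u i \<bullet> (\<Sum>l\<in>{?a i..<?a (Suc i)}. w m l))"
          using AEG
        proof eventually_elim
          fix w assume w: "w \<in> G"
          have "T m (t (Suc i)) w - T m (t i) w = (\<Sum>l\<in>{?a i..<?a (Suc i)}. w m l)" if "i < n" for i
            using w sum.atLeastLessThan_concat[OF le0 a[OF that], of "w m"]
            by (simp add: T_def atLeast0LessThan algebra_simps)
          then show "iexp (\<Sum>i<n. u i \<bullet> (T m (t (Suc i)) w - T m (t i) w)) =
            iexp (\<Sum>i<n. u i \<bullet> (\<Sum>l\<in>{?a i..<?a (Suc i)}. w m l))" by simp
        qed
      qed auto
      also have "\<dots> = (\<Prod>i<n. \<Prod>l\<in>{?a i..<?a (Suc i)}. CLINT w|L. iexp (u i \<bullet> w m l))"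
        by (rule char_block_sums[where a="?a" and \<xi>="\<lambda>l w. w m l", OF ind]) (rule a)
      also have "\<dots> = (\<Prod>i<n. exp (of_real (real (?a (Suc i)) / 2 ^ m - real (?a i) / 2 ^ m) * \<Psi> (u i)))"
        using a by (intro prod.cong refl)
          (simp add: c1 exp_of_nat_mult[symmetric] of_nat_diff diff_divide_distrib algebra_simps)
      finally show ?thesis .
    qed
    moreover have "(\<lambda>m. \<Prod>i<n. exp (of_real (real (dyadic_above m (t (Suc i))) / 2 ^ m - real (dyadic_above m (t i)) / 2 ^ m) * \<Psi> (u i)))
        \<longlonglongrightarrow> (\<Prod>i<n. exp (of_real (t (Suc i) - t i) * \<Psi> (u i)))"
      by (intro tendsto_prod tendsto_exp tendsto_mult_right tendsto_of_real tendsto_diff dyadic_above(4) t0) auto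
    ultimately show ?thesis using LIMSEQ_unique by fastforce
  qed
  have levy: "levy_process L Y"
  proof (rule levy_processI_char[where F="\<lambda>h u. exp (of_real h * \<Psi> u)", OF L])
    show "cadlag (\<lambda>t. Y t w)" for w
    proof (cases "w \<in> G")
      case True
      have eq: "(\<lambda>t. Y t w) = (\<lambda>t. Z w t - Z w 0)" using True by (simp add: Y_def)
      have "continuous (at_right t) (\<lambda>t. Z w t - Z w 0)" if "0 \<le> t" for t
        using Z(1)[OF True] that by (intro continuous_intros) (auto simp: cadlag_def)
      moreover have "\<exists>l. ((\<lambda>t. Z w t - Z w 0) \<longlongrightarrow> l) (at_left t)" if t: "0 < t" for t
      proof -
        obtain l where "(Z w \<longlongrightarrow> l) (at_left t)" using Z(1)[OF True] t by (auto simp: cadlag_def)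
        from tendsto_diff[OF this tendsto_const] show ?thesis by blast
      qed
      ultimately show ?thesis unfolding eq cadlag_def by blast
    next
      case False
      then show ?thesis by (auto simp: Y_def cadlag_def)
    qed
  qed (use mY char in \<open>auto simp: Y_def\<close>)
  have "mchar (distr L borel (Y 1)) u = exp (\<Psi> u)" for u
  proof -
    have "Y 0 w = 0" for w by (simp add: Y_def)
    then show ?thesis
      using char[of "\<lambda>i. real i" 1 "\<lambda>_. u"] by (simp add: mchar_distr)
  qed
  with levy show ?thesis by (rule that)
qed

end

section \<open>The time change \<open>r_beta\<close>\<close>

lemma r_beta_pos_eq: "0 < u \<Longrightarrow> r_beta \<beta> u = u powr \<beta> * (1 - \<beta> * ln u)"
  by (simp add: r_beta_def)

lemma r_beta_0: "r_beta \<beta> 0 = 0" and r_beta_1: "r_beta \<beta> 1 = 1"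
  by (simp_all add: r_beta_def)

text \<open>The derivative \<open>- (\<beta> * \<beta>) * (u powr (\<beta> - 1) * ln u)\<close> is
  positive on the open unit interval, where the logarithm is negative. The endpoint 0 is treated
  separately.\<close>

lemma strict_mono_on_r_beta:
  assumes "0 < \<beta>"
  shows "strict_mono_on {0..1} (r_beta \<beta>)"
proof (rule strict_mono_onI)
  fix x y :: real assume xy: "x \<in> {0..1}" "y \<in> {0..1}" "x < y"
  show "r_beta \<beta> x < r_beta \<beta> y"
  proof (cases "x = 0")
    case True
    have "\<beta> * ln y \<le> 0" using assms xy by (simp add: mult_nonneg_nonpos)
    then show ?thesis using True xy by (simp add: r_beta_def)
  next
    case False
    then have x: "0 < x" using xy by simp
    have "x powr \<beta> * (1 - \<beta> * ln x) < y powr \<beta> * (1 - \<beta> * ln y)"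
    proof (rule DERIV_pos_imp_increasing_open[OF xy(3)])
      fix u assume u: "x < u" "u < y"
      then have u01: "0 < u" "u < 1" using x xy by auto
      have "((\<lambda>u. u powr \<beta> * (1 - \<beta> * ln u)) has_real_derivative - (\<beta> * \<beta>) * (u powr (\<beta> - 1) * ln u)) (at u)"
        using u01 by (auto intro!: derivative_eq_intros simp: powr_diff field_simps)
      moreover have "0 < - (\<beta> * \<beta>) * (u powr (\<beta> - 1) * ln u)"
        using u01 assms by (simp add: mult_pos_neg)
      ultimately show "\<exists>D. ((\<lambda>u. u powr \<beta> * (1 - \<beta> * ln u)) has_real_derivative D) (at u) \<and> 0 < D" by blast
    next
      show "continuous_on {x..y} (\<lambda>u. u powr \<beta> * (1 - \<beta> * ln u))"
        using x by (intro continuous_intros) auto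
    qed
    then show ?thesis using x xy by (simp add: r_beta_pos_eq)
  qed
qed

lemma continuous_on_r_beta:
  assumes "0 < \<beta>"
  shows "continuous_on {0..1} (r_beta \<beta>)"
  unfolding continuous_on_def
proof
  fix x :: real assume x: "x \<in> {0..1}"
  show "(r_beta \<beta> \<longlongrightarrow> r_beta \<beta> x) (at x within {0..1})"
  proof (cases "x = 0")
    case True
    have "((\<lambda>u. u powr \<beta> * (1 - \<beta> * ln u)) \<longlongrightarrow> 0) (at_right 0)"
      using assms by real_asymp
    moreover have "\<forall>\<^sub>F u in at_right 0. u powr \<beta> * (1 - \<beta> * ln u) = r_beta \<beta> u"
      using eventually_at_right_less[of 0] by eventually_elim (simp add: r_beta_pos_eq)
    ultimately have "(r_beta \<beta> \<longlongrightarrow> 0) (at_right 0)" by (rule Lim_transform_eventually)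
    then show ?thesis using True by (simp add: r_beta_0 at_within_Icc_at_right)
  next
    case False
    then have x0: "0 < x" using x by simp
    have "isCont (\<lambda>u. u powr \<beta> * (1 - \<beta> * ln u)) x"
      using x0 by (intro continuous_intros) auto
    then have "((\<lambda>u. u powr \<beta> * (1 - \<beta> * ln u)) \<longlongrightarrow> r_beta \<beta> x) (at x)"
      using x0 by (simp add: isCont_def r_beta_pos_eq)
    moreover have "\<forall>\<^sub>F u in at x. u powr \<beta> * (1 - \<beta> * ln u) = r_beta \<beta> u"
      using eventually_at_in_open'[OF open_greaterThan, of x 0] x0
      by (auto elim!: eventually_mono simp: r_beta_pos_eq)
    ultimately have "(r_beta \<beta> \<longlongrightarrow> r_beta \<beta> x) (at x)" by (rule Lim_transform_eventually)
    then show ?thesis by (rule tendsto_within_subset) simp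
  qed
qed

lemma r_beta_clip_mono:
  assumes "0 < \<beta>" "x \<le> y"
  shows "r_beta \<beta> (unit_clip x) \<le> r_beta \<beta> (unit_clip y)"
  using mono_onD[OF strict_mono_on_imp_mono_on[OF strict_mono_on_r_beta[OF assms(1)]]
      unit_clip_in unit_clip_in unit_clip_mono[OF assms(2)]] .

lemma continuous_r_beta_clip:
  assumes "0 < \<beta>"
  shows "continuous (at_right a) (\<lambda>x. r_beta \<beta> (unit_clip x))"
proof -
  have "continuous_on UNIV (\<lambda>x. r_beta \<beta> (unit_clip x))"
    using unit_clip_in by (intro continuous_on_compose2[OF continuous_on_r_beta[OF assms] continuous_unit_clip]) auto
  then show ?thesis
    by (metis continuous_at_imp_continuous_at_within continuous_on_eq_continuous_at iso_tuple_UNIV_I open_UNIV)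
qed

lemma time_change_r_beta:
  assumes "0 < \<beta>"
  shows "time_change (r_beta \<beta>)"
  unfolding time_change_def
proof (intro conjI ballI)
  show "continuous_on {0..1} (r_beta \<beta>)" by (rule continuous_on_r_beta[OF assms])
  show m: "mono_on {0..1} (r_beta \<beta>)" by (rule strict_mono_on_imp_mono_on[OF strict_mono_on_r_beta[OF assms]])
  show "0 \<le> r_beta \<beta> t" if "t \<in> {0..1}" for t
    using mono_onD[OF m, of 0 t] that by (simp add: r_beta_0)
qed

section \<open>The time change as a distribution function\<close>

definition unit_uniform :: "real measure" where
  "unit_uniform = density lborel (\<lambda>x. ennreal (indicator {0<..1} x))"

lemma sets_unit_uniform[measurable_cong]: "sets unit_uniform = sets borel"
  and space_unit_uniform[simp]: "space unit_uniform = UNIV"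
  by (simp_all add: unit_uniform_def)

lemma emeasure_unit_uniform:
  "A \<in> sets borel \<Longrightarrow> emeasure unit_uniform A = emeasure lborel (A \<inter> {0<..1})"
  unfolding unit_uniform_def
  by (subst emeasure_density) (auto simp: ennreal_indicator nn_integral_set_ennreal indicator_inter_arith[symmetric] mult.commute
      simp flip: nn_integral_indicator)

lemma prob_space_unit_uniform: "prob_space unit_uniform"
  by (rule prob_spaceI) (simp add: emeasure_unit_uniform)

lemma integral_unit_uniform:
  fixes f :: "real \<Rightarrow> 'b::{banach, second_countable_topology}"
  assumes "f \<in> borel_measurable borel"
  shows "(LINT x|unit_uniform. f x) = (LBINT x:{0<..1}. f x)"
  unfolding unit_uniform_def set_lebesgue_integral_def using assms by (subst integral_density) auto

text \<open>\<open>min 1 (w / x)\<close> is the probability that a uniform variable T satisfies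
  \<open>x * T \<le> w\<close>; the integral is the distribution function at w of a product of two
  independent uniform variables.\<close>

lemma nn_integral_min_inverse:
  assumes "0 \<le> w" "w \<le> 1"
  shows "(\<integral>\<^sup>+x. ennreal (min 1 (w / x)) \<partial>unit_uniform) = ennreal (if w = 0 then 0 else w * (1 - ln w))"
proof (cases "w = 0")
  case True
  then show ?thesis by simp
next
  case False
  then have w: "0 < w" using assms by simp
  have "(\<integral>\<^sup>+x. ennreal (min 1 (w / x)) \<partial>unit_uniform) =
      (\<integral>\<^sup>+x. ennreal (indicator {0<..1} x) * ennreal (min 1 (w / x)) \<partial>lborel)"
    unfolding unit_uniform_def by (subst nn_integral_density) auto
  \<comment> \<open>The integrand is 1 up to w and \<open>w / x\<close> beyond. The closed interval
    \<open>{w..1}\<close> suits the fundamental theorem; counting w twice is harmless since it is a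
    null set.\<close>
  also have "\<dots> = (\<integral>\<^sup>+x. indicator {0<..w} x + ennreal (w / x) * indicator {w..1} x \<partial>lborel)"
  proof (rule nn_integral_cong_AE)
    have "AE x in lborel. x \<noteq> w" by (rule AE_lborel_singleton)
    then show "AE x in lborel. ennreal (indicator {0<..1} x) * ennreal (min 1 (w / x)) =
        indicator {0<..w} x + ennreal (w / x) * indicator {w..1} x"
      by eventually_elim (use w assms in \<open>auto simp: indicator_def min_def field_simps\<close>)
  qed
  also have "\<dots> = (\<integral>\<^sup>+x. indicator {0<..w} x \<partial>lborel) + (\<integral>\<^sup>+x. ennreal (w / x) * indicator {w..1} x \<partial>lborel)"
    by (rule nn_integral_add) auto
  also have "(\<integral>\<^sup>+x. ennreal (w / x) * indicator {w..1} x \<partial>lborel) = ennreal (w * ln 1 - w * ln w)"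
    by (rule nn_integral_FTC_Icc) (use w assms in \<open>auto intro!: derivative_eq_intros\<close>)
  also have "(\<integral>\<^sup>+x. indicator {0<..w} x \<partial>lborel) = ennreal w" using w by simp
  also have "ennreal w + ennreal (w * ln 1 - w * ln w) = ennreal (w * (1 - ln w))"
    using w assms by (subst ennreal_plus[symmetric]) (auto simp: algebra_simps mult_nonneg_nonpos)
  finally show ?thesis using False by simp
qed

text \<open>The time change is the distribution function of \<open>(S T)\<^bsup>1/\<beta>\<^esup>\<close> with \<open>S\<close> and \<open>T\<close> independent and
  uniform on \<open>(0,1]\<close>.\<close>

lemma r_beta_distribution:
  assumes \<beta>: "0 < \<beta>"
  shows "interval_measure (\<lambda>x. r_beta \<beta> (unit_clip x)) =
    distr (unit_uniform \<Otimes>\<^sub>M unit_uniform) borel (\<lambda>(s, t). (s * t) powr (1 / \<beta>))" (is "?I = ?D")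
proof -
  let ?V = "\<lambda>x. r_beta \<beta> (unit_clip x)"
  interpret U: prob_space unit_uniform by (rule prob_space_unit_uniform)
  interpret UU: pair_prob_space unit_uniform unit_uniform ..
  note mono = r_beta_clip_mono[OF \<beta>] and cont = continuous_r_beta_clip[OF \<beta>]
  have bot: "(?V \<longlongrightarrow> 0) at_bot"
    by (rule tendsto_eventually) (auto simp: eventually_at_bot_linorder unit_clip_def r_beta_0 intro!: exI[of _ 0])
  have top: "(?V \<longlongrightarrow> 1) at_top"
    by (rule tendsto_eventually) (auto simp: eventually_at_top_linorder unit_clip_def r_beta_1 intro!: exI[of _ 1])
  have mp[measurable]: "(\<lambda>(s, t). (s * t) powr (1 / \<beta>)) \<in> borel_measurable (unit_uniform \<Otimes>\<^sub>M unit_uniform)"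
    by measurable
  have rI: "real_distribution ?I" by (rule real_distribution_interval_measure[OF mono cont bot top])
  have rD: "real_distribution ?D" by (rule UU.real_distribution_distr) measurable
  have AEU: "AE s in unit_uniform. s \<in> {0<..1}"
    unfolding unit_uniform_def by (subst AE_density) (auto simp: indicator_def)
  have "measure ?D {..x} = ?V x" for x
  proof -
    let ?A = "{p. (fst p * snd p) powr (1 / \<beta>) \<le> x}"
    have mA: "?A \<in> sets (unit_uniform \<Otimes>\<^sub>M unit_uniform)"
    proof -
      have "Measurable.pred (unit_uniform \<Otimes>\<^sub>M unit_uniform) (\<lambda>p. (fst p * snd p) powr (1 / \<beta>) \<le> x)" by measurable
      then show ?thesis by (simp add: pred_def space_pair_measure)
    qed
    have slice: "emeasure unit_uniform (Pair s -` ?A) = emeasure lborel (Pair s -` ?A \<inter> {0<..1})" for s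
      by (rule emeasure_unit_uniform) (use sets_Pair1[OF mA, of s] in \<open>simp add: sets_unit_uniform\<close>)
    have "emeasure ?D {..x} = emeasure (unit_uniform \<Otimes>\<^sub>M unit_uniform) ?A"
      by (subst emeasure_distr) (auto simp: space_pair_measure split_beta intro!: arg_cong2[where f=emeasure])
    also have "\<dots> = (\<integral>\<^sup>+s. emeasure unit_uniform (Pair s -` ?A) \<partial>unit_uniform)"
      by (rule U.emeasure_pair_measure_alt[OF mA])
    also have "\<dots> = ennreal (?V x)"
    proof -
      consider "x < 0" | "0 \<le> x" "x \<le> 1" | "1 < x" by linarith
      then show ?thesis
      proof cases
        case 1
        then have "Pair s -` ?A = {}" for s by (auto simp: not_le intro: less_le_trans)
        then show ?thesis using 1 by (simp add: unit_clip_def r_beta_0)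
      next
        case 2
        \<comment> \<open>Raising to the power \<beta> turns the event into
          \<open>s * t \<le> ?w\<close>. For positive x, \<open>ln ?w = \<beta> * ln x\<close> makes
          \<open>?w * (1 - ln ?w)\<close> equal to \<open>r_beta \<beta> x\<close>.\<close>
        let ?w = "x powr \<beta>"
        have w: "0 \<le> ?w" "?w \<le> 1" using 2 \<beta> powr_mono2[of \<beta> x 1] by auto
        have "emeasure unit_uniform (Pair s -` ?A) = ennreal (min 1 (?w / s))" if s: "s \<in> {0<..1}" for s
        proof -
          have le: "(s * t) powr (1 / \<beta>) \<le> x \<longleftrightarrow> t \<le> ?w / s" if "0 < t" for t
          proof -
            have "(s * t) powr (1 / \<beta>) \<le> x \<longleftrightarrow> ((s * t) powr (1 / \<beta>)) powr \<beta> \<le> ?w"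
              using 2 \<beta> powr_mono2[of \<beta> "(s * t) powr (1 / \<beta>)" x]
                powr_less_mono2[of \<beta> x "(s * t) powr (1 / \<beta>)"]
              by (meson not_le order.strict_implies_order powr_ge_zero)
            also have "((s * t) powr (1 / \<beta>)) powr \<beta> = s * t" using s that \<beta> by (simp add: powr_powr)
            finally show ?thesis using s by (simp add: field_simps)
          qed
          note slice[of s]
          also have "Pair s -` ?A \<inter> {0<..1} = {0<..min 1 (?w / s)}" using le by auto
          also have "emeasure lborel {0<..min 1 (?w / s)} = ennreal (min 1 (?w / s))" using w s by simp
          finally show ?thesis .
        qed
        then have "(\<integral>\<^sup>+s. emeasure unit_uniform (Pair s -` ?A) \<partial>unit_uniform) = (\<integral>\<^sup>+s. ennreal (min 1 (?w / s)) \<partial>unit_uniform)"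
          by (intro nn_integral_cong_AE) (use AEU in eventually_elim, simp)
        also have "\<dots> = ennreal (?V x)"
          unfolding nn_integral_min_inverse[OF w] using 2 by (simp add: unit_clip_id r_beta_def ln_powr)
        finally show ?thesis .
      next
        case 3
        have "emeasure unit_uniform (Pair s -` ?A) = 1" if s: "s \<in> {0<..1}" for s
        proof -
          note slice[of s]
          also have "Pair s -` ?A \<inter> {0<..1} = {0<..1}"
          proof -
            have "(s * t) powr (1 / \<beta>) \<le> x" if "0 < t" "t \<le> 1" for t
            proof -
              have "s * t \<le> 1" using s that by (simp add: mult_le_one)
              then have "(s * t) powr (1 / \<beta>) \<le> 1" using s that \<beta> powr_mono2[of "1 / \<beta>" "s * t" 1] by simp
              then show ?thesis using 3 by simp
            qed
            then show ?thesis by auto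
          qed
          finally show ?thesis by simp
        qed
        then have "(\<integral>\<^sup>+s. emeasure unit_uniform (Pair s -` ?A) \<partial>unit_uniform) = (\<integral>\<^sup>+s. 1 \<partial>unit_uniform)"
          by (intro nn_integral_cong_AE) (use AEU in eventually_elim, simp)
        then show ?thesis using 3 U.emeasure_space_1 by (simp add: unit_clip_def r_beta_1)
      qed
    qed
    finally have "emeasure ?D {..x} = ennreal (?V x)" .
    then show ?thesis
      using mono[of "min x 0" x] by (simp add: measure_def unit_clip_def r_beta_0 min_def split: if_splits)
  qed
  moreover have "measure ?I {..x} = ?V x" for x
    by (rule measure_interval_measure_Iic[OF mono cont bot])
  ultimately show ?thesis by (intro cdf_unique[OF rI rD]) (simp add: cdf_def fun_eq_iff)
qed

lemma r_beta_integral: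
  fixes F :: "real \<Rightarrow> complex"
  assumes \<beta>: "0 < \<beta>" and F: "continuous_on UNIV F"
  shows "set_lebesgue_integral (interval_measure (\<lambda>x. r_beta \<beta> (unit_clip x))) {0<..1} F =
    (CLBINT s:{0<..1}. (CLBINT t:{0<..1}. F ((s * t) powr (1 / \<beta>))))"
proof -
  interpret U: prob_space unit_uniform by (rule prob_space_unit_uniform)
  interpret UU: pair_prob_space unit_uniform unit_uniform ..
  have [measurable]: "F \<in> borel_measurable borel" using F by (rule borel_measurable_continuous_onI)
  \<comment> \<open>The bound on \<open>F\<close> is obtained on \<open>{0..1}\<close>. The cut-off
    function is bounded everywhere, so Fubini applies, and it agrees with \<open>F\<close> at the
    values arising from s and t in \<open>{0<..1}\<close>.\<close>
  define f where "f x = indicator {0<..1} x *\<^sub>R F x" for x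
  have [measurable]: "f \<in> borel_measurable borel" unfolding f_def[abs_def] by measurable
  have "bounded (F ` {0..1})"
    by (intro compact_imp_bounded compact_continuous_image continuous_on_subset[OF F]) auto
  then obtain B where B: "\<And>x. x \<in> {0..1} \<Longrightarrow> norm (F x) \<le> B" unfolding bounded_iff by (metis imageI)
  have "0 \<le> B" using B[of 0] norm_ge_zero[of "F 0"] by (meson atLeastAtMost_iff order.trans order_refl zero_le_one)
  then have fB: "norm (f x) \<le> B" for x using B by (auto simp: f_def indicator_def)
  have AEU: "AE s in unit_uniform. s \<in> {0<..1}"
    unfolding unit_uniform_def by (subst AE_density) (auto simp: indicator_def)
  have eq: "f ((s * t) powr (1 / \<beta>)) = F ((s * t) powr (1 / \<beta>))" if "s \<in> {0<..1}" "t \<in> {0<..1}" for s t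
  proof -
    have "s * t \<le> 1" using that by (auto intro: mult_le_one)
    then have "(s * t) powr (1 / \<beta>) \<le> 1" using that \<beta> powr_mono2[of "1 / \<beta>" "s * t" 1] by simp
    then show ?thesis using that by (simp add: f_def)
  qed
  have "set_lebesgue_integral (interval_measure (\<lambda>x. r_beta \<beta> (unit_clip x))) {0<..1} F =
      (LINT p|(unit_uniform \<Otimes>\<^sub>M unit_uniform). f ((fst p * snd p) powr (1 / \<beta>)))"
    unfolding set_lebesgue_integral_def f_def[symmetric] r_beta_distribution[OF \<beta>]
    by (subst integral_distr) (auto simp: split_beta)
  also have "\<dots> = (LINT s|unit_uniform. LINT t|unit_uniform. f ((s * t) powr (1 / \<beta>)))"
    by (subst UU.integral_fst'[symmetric])
      (auto intro!: UU.integrable_const_bound[where B=B] fB)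
  also have "\<dots> = (LINT s|unit_uniform. LINT t|unit_uniform. F ((s * t) powr (1 / \<beta>)))"
  proof (rule integral_cong_AE)
    show "AE s in unit_uniform. (LINT t|unit_uniform. f ((s * t) powr (1 / \<beta>))) = (LINT t|unit_uniform. F ((s * t) powr (1 / \<beta>)))"
      using AEU
    proof eventually_elim
      fix s :: real assume s: "s \<in> {0<..1}"
      show "(LINT t|unit_uniform. f ((s * t) powr (1 / \<beta>))) = (LINT t|unit_uniform. F ((s * t) powr (1 / \<beta>)))"
      proof (rule integral_cong_AE)
        show "AE t in unit_uniform. f ((s * t) powr (1 / \<beta>)) = F ((s * t) powr (1 / \<beta>))"
          using AEU by eventually_elim (rule eq[OF s])
      qed measurable
    qed
  qed measurable
  also have "\<dots> = (LINT s|unit_uniform. (CLBINT t:{0<..1}. F ((s * t) powr (1 / \<beta>))))"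
    by (subst integral_unit_uniform) auto
  also have "\<dots> = (CLBINT s:{0<..1}. (CLBINT t:{0<..1}. F ((s * t) powr (1 / \<beta>))))"
    unfolding set_lebesgue_integral_def[of lborel "{0<..1}" "\<lambda>t. F (_ * t powr _)"]
    by (rule integral_unit_uniform) (simp add: set_lebesgue_integral_def)
  finally show ?thesis .
qed

text \<open>A convergent sequence stays in a ball, which scaling by
  \<open>s powr (1 / \<beta>) \<le> 1\<close> does not leave; a bound of \<psi> on that ball
  dominates.\<close>

lemma continuous_J_exponent:
  fixes \<psi> :: "'a::euclidean_space \<Rightarrow> complex"
  assumes "0 < \<beta>" and \<psi>: "continuous_on UNIV \<psi>"
  shows "continuous_on UNIV (\<lambda>u. CLBINT s:{0<..1}. \<psi> (s powr (1 / \<beta>) *\<^sub>R u))"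
  unfolding continuous_on_sequentially comp_def
proof safe
  fix u and x :: "nat \<Rightarrow> 'a" assume x: "x \<longlonglongrightarrow> u"
  have [measurable]: "\<psi> \<in> borel_measurable borel" using \<psi> by (rule borel_measurable_continuous_onI)
  obtain K where K: "\<And>n. norm (x n) \<le> K"
    using convergent_imp_bounded[OF x] unfolding bounded_iff by auto
  have "bounded (\<psi> ` cball 0 K)"
    by (intro compact_imp_bounded compact_continuous_image continuous_on_subset[OF \<psi>]) auto
  then obtain B where B: "\<And>y. norm y \<le> K \<Longrightarrow> norm (\<psi> y) \<le> B"
    unfolding bounded_iff by (metis imageI mem_cball_0)
  show "(\<lambda>n. CLBINT s:{0<..1}. \<psi> (s powr (1 / \<beta>) *\<^sub>R x n)) \<longlonglongrightarrow> (CLBINT s:{0<..1}. \<psi> (s powr (1 / \<beta>) *\<^sub>R u))"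
    unfolding set_lebesgue_integral_def
  proof (rule integral_dominated_convergence[where w="\<lambda>s. indicator {0<..1} s * B"])
    show "AE s in lborel. (\<lambda>n. indicator {0<..1} s *\<^sub>R \<psi> (s powr (1 / \<beta>) *\<^sub>R x n)) \<longlonglongrightarrow>
        indicator {0<..1} s *\<^sub>R \<psi> (s powr (1 / \<beta>) *\<^sub>R u)"
      by (intro AE_I2 tendsto_scaleR tendsto_const continuous_on_tendsto_compose[OF \<psi>] x) auto
    show "integrable lborel (\<lambda>s :: real. indicator {0<..1} s * B)"
      by (intro integrable_mult_left integrable_real_indicator) auto
    show "AE s in lborel. norm (indicator {0<..1} s *\<^sub>R \<psi> (s powr (1 / \<beta>) *\<^sub>R x n)) \<le> indicator {0<..1} s * B" for n
    proof (rule AE_I2)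
      fix s :: real
      show "norm (indicator {0<..1} s *\<^sub>R \<psi> (s powr (1 / \<beta>) *\<^sub>R x n)) \<le> indicator {0<..1} s * B"
      proof (cases "s \<in> {0<..1}")
        case True
        then have "s powr (1 / \<beta>) \<le> 1" using assms(1) powr_mono2[of "1 / \<beta>" s 1] by simp
        then have "norm (s powr (1 / \<beta>) *\<^sub>R x n) \<le> 1 * norm (x n)" by (simp add: mult_left_le_one_le)
        then show ?thesis using True K[of n] by (simp add: B)
      qed simp
    qed
  qed measurable
qed

section \<open>Small horizons and the identification of the two laws\<close>

context levy
begin

text \<open>After Abel summation a Riemann sum is the last path value minus an average of path
  values, the weights being increments of \<open>t powr (1 / \<beta>)\<close> with sum 1. Each part
  contributes at most \<open>e\<close>.\<close>

lemma norm_J_integral_le: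
  assumes \<beta>: "0 < \<beta>" and \<tau>: "0 < \<tau>" and w: "w \<in> space M" and Y: "\<And>s. s \<in> {0..\<tau>} \<Longrightarrow> norm (Y s w) \<le> e"
  shows "norm (random_integral (\<lambda>t. t powr (1 / \<beta>)) Y (\<lambda>t. \<tau> * t) w) \<le> 2 * e"
proof (rule LIMSEQ_le_const2)
  let ?h = "\<lambda>t::real. t powr (1 / \<beta>)"
  have r: "strict_mono_on {0..1} (\<lambda>t. \<tau> * t)" "continuous_on {0..1} (\<lambda>t. \<tau> * t)" "0 \<le> \<tau> * 0"
    using \<tau> by (auto intro!: strict_mono_onI continuous_intros)
  from tendsto_norm[OF random_integral_sum_tendsto[OF powr_integrand[OF \<beta>] r w]]
  show "(\<lambda>n. norm (\<Sum>k<Suc n. ?h (node n (Suc k)) *\<^sub>R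
      (Y (\<tau> * (node n (Suc k))) w - Y (\<tau> * (node n k)) w))) \<longlonglongrightarrow>
      norm (random_integral ?h Y (\<lambda>t. \<tau> * t) w)" .
  have "norm (\<Sum>k<Suc n. ?h (node n (Suc k)) *\<^sub>R
      (Y (\<tau> * (node n (Suc k))) w - Y (\<tau> * (node n k)) w)) \<le> 2 * e" for n
  proof -
    define H where "H k = ?h (node n k)" for k :: nat
    define y where "y k = Y (\<tau> * (node n k)) w" for k :: nat
    have y: "norm (y k) \<le> e" if "k \<le> Suc n" for k
    proof -
      have "0 \<le> node n k" "node n k \<le> 1" using that by (simp_all del: of_nat_Suc)
      then have "\<tau> * (node n k) \<in> {0..\<tau>}"
        using \<tau> mult_left_le[of "node n k" \<tau>]
        unfolding atLeastAtMost_iff by (intro conjI mult_nonneg_nonneg) auto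
      then show ?thesis unfolding y_def by (rule Y)
    qed
    have H: "H k \<le> H (Suc k)" for k
      unfolding H_def using \<beta> by (intro powr_mono2 divide_right_mono) auto
    have H01: "H 0 = 0" "H (Suc n) = 1" using \<beta> by (simp_all add: H_def del: of_nat_Suc)
    have "norm (\<Sum>k<Suc n. (H (Suc k) - H k) *\<^sub>R y k) \<le> (\<Sum>k<Suc n. (H (Suc k) - H k) * e)"
      by (rule sum_norm_le) (use H y in \<open>auto intro!: mult_left_mono\<close>)
    also have "\<dots> = e"
      unfolding sum_distrib_right[symmetric] sum_lessThan_telescope H01 by simp
    finally have "norm (\<Sum>k<Suc n. H (Suc k) *\<^sub>R (y (Suc k) - y k)) \<le> 2 * e"
      unfolding sum_by_parts H01 using y[of "Suc n"] norm_triangle_ineq4[of "y (Suc n)" "\<Sum>k<Suc n. (H (Suc k) - H k) *\<^sub>R y k"]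
      by (simp del: sum.lessThan_Suc)
    then show ?thesis unfolding H_def y_def .
  qed
  then show "\<exists>N. \<forall>n\<ge>N. norm (\<Sum>k<Suc n. ?h (node n (Suc k)) *\<^sub>R
      (Y (\<tau> * (node n (Suc k))) w - Y (\<tau> * (node n k)) w)) \<le> 2 * e" by blast
qed

text \<open>Right continuity at 0 makes each path, and with it the integral, small for \<tau> small
  in a way that depends on the sample point; dominated convergence of indicators turns this into a
  bound on probabilities.\<close>

lemma J_integral_small:
  assumes \<beta>: "0 < \<beta>" and c: "0 < c"
    and meas: "\<And>\<tau>. 0 < \<tau> \<Longrightarrow> random_integral (\<lambda>t. t powr (1 / \<beta>)) Y (\<lambda>t. \<tau> * t) \<in> borel_measurable M"
  shows "\<exists>\<delta>>0. \<forall>\<tau>. 0 < \<tau> \<longrightarrow> \<tau> \<le> \<delta> \<longrightarrow>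
    measure (distr M borel (random_integral (\<lambda>t. t powr (1 / \<beta>)) Y (\<lambda>t. \<tau> * t))) {x. c < norm x} \<le> 1 / 3"
proof -
  let ?R = "\<lambda>\<tau>. random_integral (\<lambda>t. t powr (1 / \<beta>)) Y (\<lambda>t. \<tau> * t)"
  define m where "m \<tau> = prob {w \<in> space M. c < norm (?R \<tau> w)}" for \<tau>
  have "(m \<longlongrightarrow> 0) (at_right 0)"
  proof (rule tendsto_at_right_sequentially[OF zero_less_one])
    fix S :: "nat \<Rightarrow> real" assume S: "\<And>n. 0 < S n" "S \<longlonglongrightarrow> 0"
    have [measurable]: "?R (S n) \<in> borel_measurable M" for n by (rule meas) (rule S)
    have "(\<lambda>n. LINT w|M. indicator {w \<in> space M. c < norm (?R (S n) w)} w) \<longlonglongrightarrow> (LINT w|M. (0::real))"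
    proof (rule integral_dominated_convergence[where w="\<lambda>_. 1"])
      show "AE w in M. (\<lambda>n. indicator {w \<in> space M. c < norm (?R (S n) w)} w) \<longlonglongrightarrow> (0::real)"
      proof (rule AE_I2)
        fix w assume w: "w \<in> space M"
        have "((\<lambda>t. Y t w) \<longlongrightarrow> Y 0 w) (at_right 0)"
          using cadlag_Y[OF w] by (simp add: cadlag_def continuous_within)
        then have "\<forall>\<^sub>F t in at_right 0. dist (Y t w) (Y 0 w) < c / 2" by (rule tendstoD) (use c in simp)
        then obtain b where b: "b > 0" "\<And>t. 0 < t \<Longrightarrow> t < b \<Longrightarrow> norm (Y t w) < c / 2"
          by (auto simp: eventually_at_right_field Y_0[OF w])
        obtain N where N: "\<And>n. n \<ge> N \<Longrightarrow> S n < b"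
          using LIMSEQ_D[OF S(2) b(1)] S(1) by (auto simp: abs_of_pos)
        have "norm (?R (S n) w) \<le> 2 * (c / 2)" if n: "n \<ge> N" for n
        proof (rule norm_J_integral_le[OF \<beta> S(1) w])
          fix s assume s: "s \<in> {0..S n}"
          show "norm (Y s w) \<le> c / 2"
            using b(2)[of s] N[OF n] s c by (cases "s = 0") (auto simp: Y_0[OF w] intro: less_imp_le)
        qed
        then have "\<forall>\<^sub>F n in sequentially. indicator {w \<in> space M. c < norm (?R (S n) w)} w = (0::real)"
          unfolding eventually_sequentially by (intro exI[of _ N]) (auto simp: indicator_def not_less)
        then show "(\<lambda>n. indicator {w \<in> space M. c < norm (?R (S n) w)} w) \<longlonglongrightarrow> (0::real)"
          by (rule tendsto_eventually)
      qed
    qed (auto simp: indicator_def)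
    then show "(\<lambda>n. m (S n)) \<longlonglongrightarrow> 0" by (simp add: m_def)
  qed
  then have "\<forall>\<^sub>F \<tau> in at_right 0. m \<tau> < 1 / 3" by (rule order_tendstoD) simp
  then obtain b where b: "b > 0" "\<And>\<tau>. 0 < \<tau> \<Longrightarrow> \<tau> < b \<Longrightarrow> m \<tau> < 1 / 3"
    by (auto simp: eventually_at_right_field)
  have "measure (distr M borel (?R \<tau>)) {x. c < norm x} \<le> 1 / 3" if \<tau>: "0 < \<tau>" "\<tau> \<le> b / 2" for \<tau>
  proof -
    have [measurable]: "?R \<tau> \<in> borel_measurable M" by (rule meas[OF \<tau>(1)])
    have "measure (distr M borel (?R \<tau>)) {x. c < norm x} = m \<tau>"
      unfolding m_def by (subst measure_distr) (auto intro!: arg_cong[where f=prob])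
    then show ?thesis using b(2)[OF \<tau>(1)] \<tau> b(1) by simp
  qed
  then show ?thesis using b(1) by (intro exI[of _ "b / 2"]) auto
qed

lemma J_J_eq:
  assumes \<beta>: "0 < \<beta>"
  shows "J \<beta> (J \<beta> (distr M borel (Y 1))) = distr M borel (random_integral (\<lambda>t. t) Y (r_beta \<beta>))"
proof -
  let ?h = "\<lambda>t::real. t powr (1 / \<beta>)"
  obtain \<psi> where \<psi>: "continuous_on UNIV \<psi>" "\<psi> 0 = 0" "\<And>u. phi 1 u = exp (\<psi> u)"
    using exponent_exists by blast
  note phi = phi_eq_exp[OF \<psi>]
  define \<Psi> where "\<Psi> u = (CLBINT s:{0<..1}. \<psi> (?h s *\<^sub>R u))" for u
  have c\<Psi>: "continuous_on UNIV \<Psi>" unfolding \<Psi>_def by (rule continuous_J_exponent[OF \<beta> \<psi>(1)])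
  have \<Psi>0: "\<Psi> 0 = 0" by (simp add: \<Psi>_def \<psi>(2))
  define \<rho> where "\<rho> \<tau> = distr M borel (random_integral ?h Y (\<lambda>t. \<tau> * t))" for \<tau>
  note meas = char_J_integral(1)[OF \<beta> _ \<psi>(1) phi]
  note ch = char_J_integral(2)[OF \<beta> _ \<psi>(1) phi]
  have mchar_\<rho>: "mchar (\<rho> \<tau>) u = exp (of_real \<tau> * \<Psi> u)" if "0 < \<tau>" for \<tau> u
    by (simp add: \<rho>_def mchar_distr[OF meas[OF that]] ch[OF that] \<Psi>_def)
  have prob_\<rho>: "prob_space (\<rho> \<tau>)" if "0 < \<tau>" for \<tau>
    unfolding \<rho>_def by (rule prob_space_distr[OF meas[OF that]])
  have J1: "J \<beta> (distr M borel (Y 1)) = \<rho> 1"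
    using J_eq[OF \<beta> levy] by (simp add: \<rho>_def)
  \<comment> \<open>Supplies a Levy process with law \<open>\<rho> 1\<close> at time one, on which
    the outer \<open>J\<close> can be evaluated by \<open>J_eq\<close>.\<close>
  interpret S: dyadic_semigroup_small \<rho> \<Psi>
  proof (intro dyadic_semigroup_small.intro dyadic_semigroup.intro dyadic_semigroup_small_axioms.intro)
    show "\<exists>\<delta>>0. \<forall>t. 0 < t \<longrightarrow> t \<le> \<delta> \<longrightarrow> measure (\<rho> t) {x. c < norm x} \<le> 1 / 3" if "0 < c" for c
      unfolding \<rho>_def by (rule J_integral_small[OF \<beta> that meas])
    show "prob_space (\<rho> t)" if "0 < t" for t using that by (rule prob_\<rho>)
    show "sets (\<rho> t) = sets borel" for t by (simp add: \<rho>_def)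
    show "mchar (\<rho> t) u = exp (of_real t * \<Psi> u)" if "0 < t" for t u using that by (rule mchar_\<rho>)
  qed
  obtain L :: "(nat \<Rightarrow> nat \<Rightarrow> 'a) measure" and Z
    where Z: "levy_process L Z" "\<And>u. mchar (distr L borel (Z 1)) u = exp (\<Psi> u)"
    using S.levy_process_exists by blast
  interpret Z: levy L Z by unfold_locales (rule Z)
  have Z1: "distr L borel (Z 1) = \<rho> 1"
  proof (rule mchar_unique[OF Z.prob_space_distr prob_\<rho>[OF zero_less_one]])
    show "sets (\<rho> 1) = sets borel" by (simp add: \<rho>_def)
    show "mchar (distr L borel (Z 1)) u = mchar (\<rho> 1) u" for u by (simp add: Z(2) mchar_\<rho>)
  qed auto
  have Zphi: "Z.phi 1 u = exp (\<Psi> u)" for u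
    using Z(2)[of u] by (simp add: mchar_distr Z.phi_def)
  note Zch = Z.char_J_integral[OF \<beta> zero_less_one c\<Psi> Z.phi_eq_exp[OF c\<Psi> \<Psi>0 Zphi], simplified]
  have J2: "J \<beta> (\<rho> 1) = distr L borel (random_integral ?h Z (\<lambda>t. t))"
    using J_eq[OF \<beta> Z(1)] unfolding Z1 .
  have id: "mono_on {0..1} (\<lambda>t::real. t)" "continuous_on {0..1} (\<lambda>t::real. t)"
    by (auto intro!: mono_onI)
  have r: "strict_mono_on {0..1} (r_beta \<beta>)" "continuous_on {0..1} (r_beta \<beta>)" "0 \<le> r_beta \<beta> 0"
    by (simp_all add: strict_mono_on_r_beta[OF \<beta>] continuous_on_r_beta[OF \<beta>] r_beta_0)
  have mR: "random_integral (\<lambda>t. t) Y (r_beta \<beta>) \<in> borel_measurable M"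
    by (rule measurable_random_integral[OF id r])
  have Rch: "(CLINT w|M. iexp (u \<bullet> random_integral (\<lambda>t. t) Y (r_beta \<beta>) w)) =
      exp (CLBINT s:{0<..1}. \<Psi> (?h s *\<^sub>R u))" for u
  proof -
    let ?V = "\<lambda>x. r_beta \<beta> (unit_clip x)"
    have "(CLINT w|M. iexp (u \<bullet> random_integral (\<lambda>t. t) Y (r_beta \<beta>) w)) =
        exp (of_real 1 * set_lebesgue_integral (interval_measure ?V) {0<..1} (\<lambda>t. \<psi> (t *\<^sub>R u)))"
    proof (rule char_random_integral[OF id r _ _ _ \<psi>(1) phi])
      show "?V x \<le> ?V y" if "x \<le> y" for x y using that by (rule r_beta_clip_mono[OF \<beta>])
      show "continuous (at_right a) ?V" for a by (rule continuous_r_beta_clip[OF \<beta>])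
      show "r_beta \<beta> x = 1 * ?V x" if "x \<in> {0..1}" for x using that by (simp add: unit_clip_id)
    qed
    also have "set_lebesgue_integral (interval_measure ?V) {0<..1} (\<lambda>t. \<psi> (t *\<^sub>R u)) =
        (CLBINT s:{0<..1}. (CLBINT t:{0<..1}. \<psi> ((s * t) powr (1 / \<beta>) *\<^sub>R u)))"
      by (rule r_beta_integral[OF \<beta>]) (intro continuous_on_compose2[OF \<psi>(1)] continuous_intros, auto)
    \<comment> \<open>Multiplicativity of \<open>powr\<close> on nonnegative numbers shows the inner
      integral to be \<Psi> at \<open>s powr (1 / \<beta>) *\<^sub>R u\<close>.\<close>
    also have "\<dots> = (CLBINT s:{0<..1}. \<Psi> (?h s *\<^sub>R u))"
      unfolding \<Psi>_def by (intro set_lebesgue_integral_cong) (auto simp: powr_mult mult.commute)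
    finally show ?thesis by simp
  qed
  show ?thesis
    unfolding J1 J2
    by (rule mchar_unique)
      (use Zch mR Rch in \<open>auto simp: mchar_distr intro!: prob_space_distr Z.prob_space_distr\<close>)
qed

end

theorem proposition2:
  fixes \<beta> :: real and \<nu> :: "(real ^ 'd) measure"
  assumes "\<beta> > 0" and "infinitely_divisible \<nu>"
  shows "time_change (r_beta \<beta>) \<and> strict_mono_on {0..1} (r_beta \<beta>) \<and>
    (\<forall>(M :: 'w measure) Y. levy_process M Y \<and> distr M borel (Y 1) = \<nu> \<longrightarrow>
       J \<beta> (J \<beta> \<nu>) = distr M borel (random_integral (\<lambda>t. t) Y (r_beta \<beta>)))"
proof (intro conjI allI impI)
  show "time_change (r_beta \<beta>)" by (rule time_change_r_beta[OF assms(1)])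
  show "strict_mono_on {0..1} (r_beta \<beta>)" by (rule strict_mono_on_r_beta[OF assms(1)])
  fix M :: "'w measure" and Y :: "real \<Rightarrow> 'w \<Rightarrow> real ^ 'd"
  assume Y: "levy_process M Y \<and> distr M borel (Y 1) = \<nu>"
  then interpret levy M Y by unfold_locales simp
  show "J \<beta> (J \<beta> \<nu>) = distr M borel (random_integral (\<lambda>t. t) Y (r_beta \<beta>))"
    using J_J_eq[OF assms(1)] Y by simp
qed

end
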